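(* Let $f$ be a real $C^1$ function on $(0,\infty)$. For each $n\in\mathbb{N}$ consider the following conditions: (a)$_n'$ $f$ is $n$-monotone on $(0,\infty)$; (b)$_n'$ $\limsup_{t\to\infty}f(t)/t<+\infty$, $\limsup_{t\to\infty}f(t)>-\infty$, and $L_f(t_1,\dots,t_n)$ is conditionally positive definite for all $t_1,\dots,t_n\in(0,\infty)$; (c)$_n'$ $\liminf_{t\searrow0}tf(t)\le0$, $\limsup_{t\to\infty}f(t)>-\infty$, and $L_{tf(t)}(t_1,\dots,t_n)$ is conditionally negative definite for all $t_1,\dots,t_n\in(0,\infty)$; (d)$_n'$ $\liminf_{t\searrow0}tf(t)\le0$, $\limsup_{t\searrow0}t^2f(t)\ge0$, and $L_{t^2f(t)}(t_1,\dots,t_n)$ is conditionally positive definite for all $t_1,\dots,t_n\in(0,\infty)$. Then for every $n\in\mathbb{N}$ the following implications hold: $$ {\rm(a)}_n'\Longrightarrow{\rm(b)}_n'\ \mbox{if $n\ge2$},\quad {\rm(b)}_{4n+1}'\Longrightarrow{\rm(a)}_n',\quad {\rm(a)}_{2n+2}'\Longrightarrow{\rm(c)}_n',\quad {\rm(c)}_{2n+1}'\Longrightarrow{\rm(a)}_n', $$ $$ {\rm(a)}_n'\Longrightarrow{\rm(d)}_n'\ \mbox{if $n\ge2$},\quad {\rm(c)}_{2n+1}'\Longrightarrow{\rm(d)}_n',\quad {\rm(d)}_{2n+1}'\Longrightarrow{\rm(c)}_n'. $$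
   Context: $\mathbb{N}=\{1,2,\dots\}$; $\mathbb{M}_n$ is the set of $n\times n$ complex matrices. A continuous real function $f$ on an interval $J$ is $n$-monotone (matrix monotone of order $n$) on $J$ if $A\ge B$ implies $f(A)\ge f(B)$ for all Hermitian $A,B\in\mathbb{M}_n$ with spectra in $J$ (functional calculus, positive semidefinite order). A Hermitian $A\in\mathbb{M}_n$ is conditionally positive definite if $\langle x,Ax\rangle\ge0$ for all $x=(x_1,\dots,x_n)^t\in\mathbb{C}^n$ with $\sum_{i=1}^nx_i=0$, and conditionally negative definite if $-A$ is conditionally positive definite. For a real $C^1$ function $g$ on an open interval, $g^{[1]}(s,t):=\frac{g(s)-g(t)}{s-t}$ if $s\ne t$ and $g^{[1]}(s,s):=g'(s)$; the Loewner matrix is $L_g(t_1,\dots,t_n):=[g^{[1]}(t_i,t_j)]_{i,j=1}^n$ (the points $t_i$ need not be distinct). $L_{tf(t)}$ and $L_{t^2f(t)}$ denote the Loewner matrices of the functions $t\mapsto tf(t)$ and $t\mapsto t^2f(t)$. *)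

theory Defs
  imports
    "HOL-Analysis.Derivative"
    "HOL-Library.Extended_Real"
    "Jordan_Normal_Form.Schur_Decomposition"
    "Jordan_Normal_Form.Spectral_Radius"
begin

definition hermitian_mat :: "nat \<Rightarrow> complex mat \<Rightarrow> bool" where
  "hermitian_mat n A \<longleftrightarrow> A \<in> carrier_mat n n \<and> mat_adjoint A = A"

definition unitary_mat :: "nat \<Rightarrow> complex mat \<Rightarrow> bool" where
  "unitary_mat n U \<longleftrightarrow> U \<in> carrier_mat n n \<and>
     mat_adjoint U * U = 1\<^sub>m n \<and> U * mat_adjoint U = 1\<^sub>m n"

text \<open>In the order on \<^typ>\<open>complex\<close>, \<open>0 \<le> z\<close> says that \<open>z\<close> is real and nonnegative.\<close>

definition pos_semidef :: "nat \<Rightarrow> complex mat \<Rightarrow> bool" where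
  "pos_semidef n A \<longleftrightarrow> hermitian_mat n A \<and>
     (\<forall>x \<in> carrier_vec n. 0 \<le> (A *\<^sub>v x) \<bullet>c x)"

definition cond_pos_def :: "nat \<Rightarrow> complex mat \<Rightarrow> bool" where
  "cond_pos_def n A \<longleftrightarrow> hermitian_mat n A \<and>
     (\<forall>x \<in> carrier_vec n. (\<Sum>i<n. x $ i) = 0 \<longrightarrow> 0 \<le> (A *\<^sub>v x) \<bullet>c x)"

definition cond_neg_def :: "nat \<Rightarrow> complex mat \<Rightarrow> bool" where
  "cond_neg_def n A \<longleftrightarrow> cond_pos_def n (- A)"

text \<open>Functional calculus for a Hermitian matrix: if \<open>A = U diag(d\<^sub>0, \<dots>) U\<^sup>*\<close> with \<open>U\<close> unitary
  and \<open>d\<close> real, then \<open>f(A) = U diag(f(d\<^sub>0), \<dots>) U\<^sup>*\<close>. By the spectral theorem such a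
  decomposition exists; the result does not depend on its choice (\<open>mat_fun_eqI\<close>). The value is
  unspecified when \<open>A\<close> is not Hermitian.\<close>

definition mat_fun :: "(real \<Rightarrow> real) \<Rightarrow> complex mat \<Rightarrow> complex mat" where
  "mat_fun f A = (THE B. \<exists>U d. unitary_mat (dim_row A) U \<and>
      A = U * mat_diag (dim_row A) (\<lambda>i. complex_of_real (d i)) * mat_adjoint U \<and>
      B = U * mat_diag (dim_row A) (\<lambda>i. complex_of_real (f (d i))) * mat_adjoint U)"

lemma mat_fun_eqI:
  assumes U: "unitary_mat n U"
    and A: "A = U * mat_diag n (\<lambda>i. complex_of_real (d i)) * mat_adjoint U"
  shows "mat_fun f A = U * mat_diag n (\<lambda>i. complex_of_real (f (d i))) * mat_adjoint U"
proof -
  have adj_carrier: "mat_adjoint V \<in> carrier_mat n n" if "V \<in> carrier_mat n n" for V :: "complex mat"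
    using that unfolding mat_adjoint_def by auto
  have Uc: "U \<in> carrier_mat n n" "mat_adjoint U \<in> carrier_mat n n"
    and Uu: "mat_adjoint U * U = 1\<^sub>m n" "U * mat_adjoint U = 1\<^sub>m n"
    using U adj_carrier by (auto simp: unitary_mat_def)
  have dim: "dim_row A = n"
    using Uc unfolding A by auto
  have uniq: "V * mat_diag n (\<lambda>i. complex_of_real (f (e i))) * mat_adjoint V =
      U * mat_diag n (\<lambda>i. complex_of_real (f (d i))) * mat_adjoint U"
    if V: "unitary_mat n V" and AV: "A = V * mat_diag n (\<lambda>i. complex_of_real (e i)) * mat_adjoint V"
    for V e
  proof -
    let ?D = "\<lambda>d. mat_diag n (\<lambda>i. complex_of_real (d i))"
    have Vc: "V \<in> carrier_mat n n" "mat_adjoint V \<in> carrier_mat n n"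
      and Vu: "mat_adjoint V * V = 1\<^sub>m n" "V * mat_adjoint V = 1\<^sub>m n"
      using V adj_carrier by (auto simp: unitary_mat_def)
    define W where "W = mat_adjoint V * U"
    have Wc: "W \<in> carrier_mat n n"
      using Uc Vc by (auto simp: W_def)
    have left: "mat_adjoint V * (V * X * mat_adjoint V) * U = X * W"
      if "X \<in> carrier_mat n n" for X
    proof -
      have "mat_adjoint V * (V * X * mat_adjoint V) * U = (mat_adjoint V * V) * (X * (mat_adjoint V * U))"
        using Uc Vc that by (simp add: assoc_mult_mat[of _ n n _ n _ n])
      then show ?thesis using Uc Vc that by (simp add: Vu W_def)
    qed
    have right: "mat_adjoint V * (U * X * mat_adjoint U) * U = W * X"
      if "X \<in> carrier_mat n n" for X
    proof -
      have "mat_adjoint V * (U * X * mat_adjoint U) * U = (mat_adjoint V * U) * (X * (mat_adjoint U * U))"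
        using Uc Vc that by (simp add: assoc_mult_mat[of _ n n _ n _ n])
      then show ?thesis using Uc Vc that by (simp add: Uu W_def)
    qed
    have "?D e * W = W * ?D d"
      using left[of "?D e"] right[of "?D d"] A AV by simp
    then have "Matrix.mat n n (\<lambda>(i, j). complex_of_real (e i) * W $$ (i, j)) =
        Matrix.mat n n (\<lambda>(i, j). W $$ (i, j) * complex_of_real (d j))"
      using mat_diag_mult_left[OF Wc] mat_diag_mult_right[OF Wc] by simp
    then have eq: "complex_of_real (e i) * W $$ (i, j) = W $$ (i, j) * complex_of_real (d j)"
      if "i < n" "j < n" for i j
      using that by (metis (no_types, lifting) case_prod_conv index_mat(1))
    have "complex_of_real (f (e i)) * W $$ (i, j) = W $$ (i, j) * complex_of_real (f (d j))"
      if "i < n" "j < n" for i j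
      using eq[OF that] by (cases "W $$ (i, j) = 0") auto
    then have com: "?D (\<lambda>i. f (e i)) * W = W * ?D (\<lambda>i. f (d i))"
      unfolding mat_diag_mult_left[OF Wc] mat_diag_mult_right[OF Wc] by (intro eq_matI) auto
    have VW: "V * W = U"
      using Uc Vc Vu by (simp add: W_def assoc_mult_mat[symmetric, of _ n n _ n _ n])
    have WU: "W * mat_adjoint U = mat_adjoint V"
      using Uc Vc Uu by (simp add: W_def assoc_mult_mat[of _ n n _ n _ n])
    have "V * ?D (\<lambda>i. f (e i)) * mat_adjoint V = V * (?D (\<lambda>i. f (e i)) * W) * mat_adjoint U"
      using Uc Vc Wc
      by (simp add: assoc_mult_mat[of _ n n _ n _ n] mult_carrier_mat[of _ n n _ n] flip: WU)
    also have "\<dots> = V * W * ?D (\<lambda>i. f (d i)) * mat_adjoint U"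
      using Uc Vc Wc
      by (simp add: com assoc_mult_mat[of _ n n _ n _ n] mult_carrier_mat[of _ n n _ n])
    finally show ?thesis by (simp add: VW)
  qed
  show ?thesis
    unfolding mat_fun_def dim
  proof (rule the_equality)
    show "\<exists>V e. unitary_mat n V \<and>
        A = V * mat_diag n (\<lambda>i. complex_of_real (e i)) * mat_adjoint V \<and>
        U * mat_diag n (\<lambda>i. complex_of_real (f (d i))) * mat_adjoint U =
          V * mat_diag n (\<lambda>i. complex_of_real (f (e i))) * mat_adjoint V"
      using U A by blast
  qed (use uniq in blast)
qed

definition matrix_monotone :: "nat \<Rightarrow> (real \<Rightarrow> real) \<Rightarrow> real set \<Rightarrow> bool" where
  "matrix_monotone n f J \<longleftrightarrow> continuous_on J f \<and>
     (\<forall>A B. hermitian_mat n A \<and> hermitian_mat n B \<and>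
        spectrum A \<subseteq> complex_of_real ` J \<and> spectrum B \<subseteq> complex_of_real ` J \<and>
        pos_semidef n (A - B) \<longrightarrow> pos_semidef n (mat_fun f A - mat_fun f B))"

definition divided_diff :: "(real \<Rightarrow> real) \<Rightarrow> real \<Rightarrow> real \<Rightarrow> real" where
  "divided_diff g s t = (if s = t then deriv g s else (g s - g t) / (s - t))"

text \<open>The points \<open>t\<^sub>1, \<dots>, t\<^sub>n\<close> are \<open>t 0, \<dots>, t (n - 1)\<close>.\<close>

definition loewner_mat :: "nat \<Rightarrow> (real \<Rightarrow> real) \<Rightarrow> (nat \<Rightarrow> real) \<Rightarrow> complex mat" where
  "loewner_mat n g t = Matrix.mat n n (\<lambda>(i, j). complex_of_real (divided_diff g (t i) (t j)))"

definition cond_b :: "nat \<Rightarrow> (real \<Rightarrow> real) \<Rightarrow> bool" where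
  "cond_b n f \<longleftrightarrow>
     Limsup at_top (\<lambda>t. ereal (f t / t)) < \<infinity> \<and>
     Limsup at_top (\<lambda>t. ereal (f t)) > - \<infinity> \<and>
     (\<forall>t. (\<forall>i<n. t i > 0) \<longrightarrow> cond_pos_def n (loewner_mat n f t))"

definition cond_c :: "nat \<Rightarrow> (real \<Rightarrow> real) \<Rightarrow> bool" where
  "cond_c n f \<longleftrightarrow>
     Liminf (at_right 0) (\<lambda>t. ereal (t * f t)) \<le> 0 \<and>
     Limsup at_top (\<lambda>t. ereal (f t)) > - \<infinity> \<and>
     (\<forall>t. (\<forall>i<n. t i > 0) \<longrightarrow> cond_neg_def n (loewner_mat n (\<lambda>s. s * f s) t))"

definition cond_d :: "nat \<Rightarrow> (real \<Rightarrow> real) \<Rightarrow> bool" where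
  "cond_d n f \<longleftrightarrow>
     Liminf (at_right 0) (\<lambda>t. ereal (t * f t)) \<le> 0 \<and>
     Limsup (at_right 0) (\<lambda>t. ereal (t\<^sup>2 * f t)) \<ge> 0 \<and>
     (\<forall>t. (\<forall>i<n. t i > 0) \<longrightarrow> cond_pos_def n (loewner_mat n (\<lambda>s. s\<^sup>2 * f s) t))"

end

theory Submission
  imports Defs
begin

text \<open>By Loewner's theorem \<open>f\<close> is \<open>n\<close>-monotone iff its divided difference kernel \<open>f\<^bsup>[1]\<^esup>\<close> is positive
  semidefinite on every \<open>n\<close> points, so all implications can be read on kernels. A conditionally
  definite form gains from one more point \<open>a\<close> carrying the negated sum of the weights, and this
  point is sent to the boundary: \<open>a \<rightarrow> \<infinity>\<close> gives (b) \<open>\<Longrightarrow>\<close> (a), and (d) \<open>\<Longrightarrow>\<close> (a) is the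
  same statement for \<open>- f (1 / t)\<close>. If \<open>f\<^bsup>[1]\<^esup>\<close> is positive on \<open>n + 1\<close> points, the form
  \<open>\<Sum> x\<^sub>s x\<^sub>t f\<^bsup>[2]\<^esup>(s, t, u)\<close> on \<open>n\<close> points increases with \<open>u\<close> and tends to \<open>0\<close> at infinity, so it is
  nonpositive; letting \<open>u \<rightarrow> 0\<close> gives (a) \<open>\<Longrightarrow>\<close> (c). Applied to the second order Taylor quotient of
  \<open>t f(t)\<close> at \<open>a\<close>, read in the variable \<open>1 / (t - a)\<close>, the same fact gives (c) \<open>\<Longrightarrow>\<close> (a) as \<open>a \<rightarrow> 0\<close>.\<close>

section \<open>Definite kernels and divided differences\<close>

text \<open>Write f[k] for the divided difference of order k. Conditional positivity and
  monotonicity are linked by one identity: f[1](s,t) - f[1](s,a) - f[1](a,t) + f[1](a,a) equals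
  (s-a)(t-a) f[3](s,t,a,a), and f[3](s,t,a,a) is the derivative of f[2](s,t,a) in a. So bordering
  the kernel differentiates forms in f[2]. The obstacle is that f is only C1: f[2](s,s,u) need not
  have a limit at u = s, so monotonicity across a node cannot come from a derivative and has its own
  argument, in which upward jumps are allowed. Also, the boundary conditions hold only along
  sequences, and f(a)/a or a f(a) is not known to converge while a moves; such terms are kept apart
  until a suitable a is picked. Count of points: the border costs one point and the division by the
  variable in (c) ==> (a) another, so n + 1 points serve (b) ==> (a), (d) ==> (a) and (a) ==> (c),
  while n + 2 serve (c) ==> (a); n \<ge> 1 gives n + 2 \<le> 2n + 1.\<close>

definition psd_on :: "nat \<Rightarrow> real set \<Rightarrow> (real \<Rightarrow> real \<Rightarrow> real) \<Rightarrow> bool" where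
  "psd_on n S K \<longleftrightarrow> (\<forall>T X. finite T \<and> T \<subseteq> S \<and> card T \<le> n \<longrightarrow>
     0 \<le> (\<Sum>s\<in>T. \<Sum>t\<in>T. X s * X t * K s t))"

text \<open>In both notions the nodes form a set and the weights are a function of the node, so
  nodes never repeat and an injective change of variable acts on the weights;
  \<open>card T \<le> n\<close> makes the notions monotone in \<open>n\<close> at once. Repeated
  nodes and complex weights, which the matrix definitions allow, come back through
  \<open>quadratic_form_merge\<close> and \<open>complex_quadratic_form\<close>.\<close>

definition cpd_on :: "nat \<Rightarrow> real set \<Rightarrow> (real \<Rightarrow> real \<Rightarrow> real) \<Rightarrow> bool" where
  "cpd_on n S K \<longleftrightarrow> (\<forall>T X. finite T \<and> T \<subseteq> S \<and> card T \<le> n \<and> sum X T = 0 \<longrightarrow>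
     0 \<le> (\<Sum>s\<in>T. \<Sum>t\<in>T. X s * X t * K s t))"

lemma psd_onD:
  "psd_on n S K \<Longrightarrow> finite T \<Longrightarrow> T \<subseteq> S \<Longrightarrow> card T \<le> n \<Longrightarrow>
     0 \<le> (\<Sum>s\<in>T. \<Sum>t\<in>T. X s * X t * K s t)"
  by (auto simp: psd_on_def)

lemma cpd_onD:
  "cpd_on n S K \<Longrightarrow> finite T \<Longrightarrow> T \<subseteq> S \<Longrightarrow> card T \<le> n \<Longrightarrow> sum X T = 0 \<Longrightarrow>
     0 \<le> (\<Sum>s\<in>T. \<Sum>t\<in>T. X s * X t * K s t)"
  by (auto simp: cpd_on_def)

lemma psd_on_imp_cpd_on: "psd_on n S K \<Longrightarrow> cpd_on n S K"
  by (auto simp: psd_on_def cpd_on_def)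

lemma psd_on_mono: "psd_on n S K \<Longrightarrow> m \<le> n \<Longrightarrow> S' \<subseteq> S \<Longrightarrow> psd_on m S' K"
  unfolding psd_on_def by (meson order_trans)

lemma cpd_on_mono: "cpd_on n S K \<Longrightarrow> m \<le> n \<Longrightarrow> S' \<subseteq> S \<Longrightarrow> cpd_on m S' K"
  unfolding cpd_on_def by (meson order_trans)

text \<open>The factor \<open>c s * c t\<close> is absorbed into the weights, so this is a
  congruence combined with a change of nodes. The substitutions \<open>1 / t\<close>,
  \<open>a + 1 / \<tau>\<close> and \<open>1 / (t - a)\<close> below are instances.\<close>

lemma psd_on_transform:
  assumes K': "psd_on n S' K'" and inj: "inj_on m S" and im: "m ` S \<subseteq> S'"
    and eq: "\<And>s t. s \<in> S \<Longrightarrow> t \<in> S \<Longrightarrow> K s t = c s * c t * K' (m s) (m t)"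
  shows "psd_on n S K"
  unfolding psd_on_def
proof (intro allI impI, elim conjE)
  fix T :: "real set" and X :: "real \<Rightarrow> real"
  assume T: "finite T" "T \<subseteq> S" "card T \<le> n"
  have injT: "inj_on m T"
    using inj T(2) by (rule inj_on_subset)
  define Y where "Y u = X (the_inv_into T m u) * c (the_inv_into T m u)" for u
  have Y: "Y (m s) = X s * c s" if "s \<in> T" for s
    using the_inv_into_f_f[OF injT that] by (simp add: Y_def)
  have "0 \<le> (\<Sum>u\<in>m ` T. \<Sum>v\<in>m ` T. Y u * Y v * K' u v)"
    using T im card_image_le[OF T(1), of m] by (intro psd_onD[OF K']) auto
  also have "\<dots> = (\<Sum>s\<in>T. \<Sum>t\<in>T. Y (m s) * Y (m t) * K' (m s) (m t))"
    by (simp add: sum.reindex[OF injT])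
  also have "\<dots> = (\<Sum>s\<in>T. \<Sum>t\<in>T. X s * X t * K s t)"
    using T(2) by (intro sum.cong refl) (auto simp: Y eq subset_iff)
  finally show "0 \<le> (\<Sum>s\<in>T. \<Sum>t\<in>T. X s * X t * K s t)" .
qed

text \<open>Terms in one variable enter only through \<open>sum X T\<close>, hence vanish for
  weights of zero sum. Later proofs add or drop such terms by this identity, writing absent ones as
  \<open>0\<close>.\<close>

lemma quadratic_form_border:
  fixes X :: "real \<Rightarrow> real"
  shows "(\<Sum>s\<in>T. \<Sum>t\<in>T. X s * X t * (K s t - p s - q t + c)) =
    (\<Sum>s\<in>T. \<Sum>t\<in>T. X s * X t * K s t) - sum X T * (\<Sum>s\<in>T. X s * p s)
      - sum X T * (\<Sum>t\<in>T. X t * q t) + (sum X T)\<^sup>2 * c"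
proof -
  have 1: "(\<Sum>s\<in>T. \<Sum>t\<in>T. X s * X t * p s) = sum X T * (\<Sum>s\<in>T. X s * p s)"
    by (subst sum.swap) (simp add: sum_product mult_ac)
  have 2: "(\<Sum>s\<in>T. \<Sum>t\<in>T. X s * X t * q t) = sum X T * (\<Sum>t\<in>T. X t * q t)"
    by (simp add: sum_product mult_ac)
  have 3: "(\<Sum>s\<in>T. \<Sum>t\<in>T. X s * X t * c) = (sum X T)\<^sup>2 * c"
    unfolding power2_eq_square sum_product unfolding sum_distrib_right ..
  show ?thesis
    unfolding distrib_left right_diff_distrib sum.distrib sum_subtractf 1 2 3 ..
qed

text \<open>The four-term kernel returns as the numerator in \<open>DERIV_second_diff\<close> and
  \<open>divided_diff_taylor_quot\<close>, which is how conditional positivity reaches higher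
  divided differences. The node \<open>a\<close> is taken out because its weight is already
  fixed.\<close>

lemma cpd_on_border:
  assumes K: "cpd_on (Suc n) S K" and a: "a \<in> S"
  shows "psd_on n (S - {a}) (\<lambda>s t. K s t - K s a - K a t + K a a)"
  unfolding psd_on_def
proof (intro allI impI, elim conjE)
  fix T :: "real set" and X :: "real \<Rightarrow> real"
  assume T: "finite T" "T \<subseteq> S - {a}" "card T \<le> n"
  have aT: "a \<notin> T"
    using T by auto
  define Y where "Y = X(a := - sum X T)"
  have Y: "Y s = X s" if "s \<in> T" for s
    using that aT by (auto simp: Y_def)
  have Ya: "Y a = - sum X T"
    by (simp add: Y_def)
  have "sum Y (insert a T) = 0"
    using T(1) aT by (simp add: Y Ya)
  then have "0 \<le> (\<Sum>s\<in>insert a T. \<Sum>t\<in>insert a T. Y s * Y t * K s t)"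
    using T a aT by (intro cpd_onD[OF K]) auto
  also have "\<dots> = (\<Sum>s\<in>T. \<Sum>t\<in>T. X s * X t * K s t) + Y a * (\<Sum>s\<in>T. X s * K s a)
      + Y a * (\<Sum>t\<in>T. X t * K a t) + Y a * Y a * K a a"
    using T(1) aT by (simp add: Y sum.distrib sum_distrib_left algebra_simps)
  also have "\<dots> = (\<Sum>s\<in>T. \<Sum>t\<in>T. X s * X t * (K s t - K s a - K a t + K a a))"
    unfolding quadratic_form_border Ya by (simp add: power2_eq_square)
  finally show "0 \<le> (\<Sum>s\<in>T. \<Sum>t\<in>T. X s * X t * (K s t - K s a - K a t + K a a))" .
qed

text \<open>Nonnegativity of the 2 by 2 principal minor. For the kernel of \<open>f\<close> it
  bounds the squared secant slope by the product of the derivatives at the two nodes.\<close>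

lemma psd_on_two:
  assumes K: "psd_on n S K" and n: "2 \<le> n" and st: "s \<in> S" "t \<in> S" "s \<noteq> t"
    and sym: "K t s = K s t"
  shows "0 \<le> K s s" "(K s t)\<^sup>2 \<le> K s s * K t t"
proof -
  have q: "0 \<le> x\<^sup>2 * K s s + 2 * x * y * K s t + y\<^sup>2 * K t t" for x y
    using psd_onD[OF K, of "{s, t}" "\<lambda>r. if r = s then x else y"] n st sym
    by (simp add: power2_eq_square algebra_simps)
  show A: "0 \<le> K s s"
    using q[of 1 0] by simp
  show "(K s t)\<^sup>2 \<le> K s s * K t t"
  proof (cases "K s s = 0")
    case True
    have "K s t = 0"
    proof (rule ccontr)
      assume "K s t \<noteq> 0"
      \<comment> \<open>These weights give the form the value -1.\<close>
      then show False
        using q[of "- (K t t + 1) / (2 * K s t)" 1] True by (simp add: field_simps)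
    qed
    then show ?thesis
      using True by simp
  next
    case False
    have "0 \<le> K s s * (K s s * K t t - (K s t)\<^sup>2)"
      using q[of "- K s t" "K s s"] by (simp add: power2_eq_square algebra_simps)
    with A False show ?thesis
      by (simp add: zero_le_mult_iff)
  qed
qed

text \<open>The weights are 1 and -1. For the kernel of \<open>f\<close> this is a trapezoid
  inequality: the secant slope is at most the mean of the two end derivatives.\<close>

lemma cpd_on_two:
  assumes K: "cpd_on n S K" and n: "2 \<le> n" and st: "s \<in> S" "t \<in> S"
    and sym: "K t s = K s t"
  shows "2 * K s t \<le> K s s + K t t"
proof (cases "s = t")
  case False
  then show ?thesis
    using cpd_onD[OF K, of "{s, t}" "\<lambda>r. if r = s then 1 else - 1"] n st sym by simp
qed simp

section \<open>Divided differences of a differentiable function\<close>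

lemma divided_diff_commute: "divided_diff f s t = divided_diff f t s"
  using minus_divide_divide[of "f s - f t" "s - t"] by (simp add: divided_diff_def)

lemma divided_diff_self [simp]: "divided_diff f s s = deriv f s"
  by (simp add: divided_diff_def)

lemma mult_divided_diff: "(s - t) * divided_diff f s t = f s - f t"
  by (simp add: divided_diff_def)

lemma DERIV_deriv: "f differentiable (at x) \<Longrightarrow> (f has_real_derivative deriv f x) (at x)"
  for f :: "real \<Rightarrow> real"
  using DERIV_deriv_iff_real_differentiable by blast

lemma isCont_divided_diff:
  assumes "f differentiable (at s)" "f differentiable (at u)"
  shows "isCont (divided_diff f s) u"
proof (cases "u = s")
  case True
  have "((\<lambda>u. (f u - f s) / (u - s)) \<longlongrightarrow> deriv f s) (at s)"
    using DERIV_deriv[OF assms(1)] by (simp add: has_field_derivative_iff)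
  moreover have "(f u - f s) / (u - s) = divided_diff f s u" if "u \<noteq> s" for u
    using that minus_divide_divide[of "f u - f s" "u - s"] by (simp add: divided_diff_def)
  ultimately have "(divided_diff f s \<longlongrightarrow> deriv f s) (at s)"
    by (auto elim!: Lim_transform_eventually simp: eventually_at_filter)
  then show ?thesis
    using True by (simp add: isCont_def)
next
  case False
  have fu: "isCont f u"
    using assms(2) by (rule differentiable_imp_continuous_within)
  have "isCont (\<lambda>u. (f s - f u) / (s - u)) u"
    using False by (intro continuous_intros fu) auto
  moreover have "\<forall>\<^sub>F v in nhds u. (f s - f v) / (s - v) = divided_diff f s v"
    using t1_space_nhds[OF False] by eventually_elim (auto simp: divided_diff_def)
  ultimately show ?thesis
    by (rule iffD1[OF isCont_cong, rotated])
qed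

text \<open>Off \<open>u = s\<close> this is the second divided difference at s, s, u. At
  \<open>u = s\<close> it is 0 by division by zero, a value without meaning, so the statements about
  it keep \<open>u\<close> away from \<open>s\<close>.\<close>

definition taylor_quot :: "(real \<Rightarrow> real) \<Rightarrow> real \<Rightarrow> real \<Rightarrow> real" where
  "taylor_quot f s u = (f u - f s - deriv f s * (u - s)) / (u - s)\<^sup>2"

text \<open>The numerator is the trapezoid defect of \<open>cpd_on_two\<close>, equivalently the
  bordered kernel at \<open>s\<close> with both nodes equal to \<open>u\<close>; its sign therefore
  makes the quotient nondecreasing on each side of \<open>s\<close>.\<close>

lemma DERIV_taylor_quot:
  assumes "f differentiable (at u)" "u \<noteq> s"
  shows "(taylor_quot f s has_real_derivative
     (deriv f s + deriv f u - 2 * divided_diff f s u) / (u - s)\<^sup>2) (at u)"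
proof -
  have num: "((\<lambda>x. f x - f s - deriv f s * (x - s)) has_real_derivative deriv f u - deriv f s) (at u)"
    by (rule derivative_eq_intros DERIV_deriv[OF assms(1)] refl | simp)+
  have den: "((\<lambda>x. (x - s)\<^sup>2) has_real_derivative 2 * (u - s)) (at u)"
    by (auto intro!: derivative_eq_intros)
  have N: "f u - f s - deriv f s * (u - s) = (u - s) * (divided_diff f s u - deriv f s)"
    using mult_divided_diff[of s u f] by (simp add: algebra_simps)
  have alg: "(a * w\<^sup>2 - w * b * (2 * w)) / (w\<^sup>2 * w\<^sup>2) = (a - 2 * b) / w\<^sup>2" if "w \<noteq> 0" for a b w :: real
    using that by (simp add: field_simps power2_eq_square)
  have "(taylor_quot f s has_real_derivative
      ((deriv f u - deriv f s) * (u - s)\<^sup>2 - (f u - f s - deriv f s * (u - s)) * (2 * (u - s))) /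
      ((u - s)\<^sup>2 * (u - s)\<^sup>2)) (at u)"
    unfolding taylor_quot_def[abs_def] using assms(2) by (intro DERIV_divide num den) auto
  then show ?thesis
    unfolding N using assms(2) by (subst (asm) alg) (auto simp: algebra_simps)
qed

lemma taylor_quot_mono_side:
  assumes diff: "\<And>x. 0 < x \<Longrightarrow> f differentiable (at x)"
    and K: "cpd_on 2 {0<..} (divided_diff f)"
    and s: "0 < s" and uv: "0 < u" "u \<le> v" "s \<notin> {u..v}"
  shows "taylor_quot f s u \<le> taylor_quot f s v"
proof (rule DERIV_nonneg_imp_nondecreasing[OF uv(2)])
  fix x assume x: "u \<le> x" "x \<le> v"
  have "2 * divided_diff f s x \<le> deriv f s + deriv f x"
    using cpd_on_two[OF K, of s x] x s uv by (simp add: divided_diff_commute)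
  then have "0 \<le> (deriv f s + deriv f x - 2 * divided_diff f s x) / (x - s)\<^sup>2"
    by simp
  moreover have "(taylor_quot f s has_real_derivative
      (deriv f s + deriv f x - 2 * divided_diff f s x) / (x - s)\<^sup>2) (at x)"
    using x uv by (intro DERIV_taylor_quot diff) auto
  ultimately show "\<exists>y. (taylor_quot f s has_real_derivative y) (at x) \<and> 0 \<le> y"
    by blast
qed

text \<open>If monotonicity failed across \<open>s\<close>, then after subtracting a quadratic polynomial, which does not
  affect the trapezoid inequality \<open>trap\<close>, and a linear one, extremal points \<open>\<alpha> < s < \<beta>\<close> would
  violate it. No continuity of the derivative is needed.\<close>

lemma taylor_quot_mono:
  assumes diff: "\<And>x. 0 < x \<Longrightarrow> f differentiable (at x)"
    and K: "cpd_on 2 {0<..} (divided_diff f)"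
    and uv: "0 < u" "u \<le> v" "u \<noteq> s" "v \<noteq> s" "0 < s"
  shows "taylor_quot f s u \<le> taylor_quot f s v"
proof (cases "s \<in> {u..v}")
  case False
  then show ?thesis
    using taylor_quot_mono_side[OF diff K] uv by auto
next
  case True
  then have us: "u < s" "s < v"
    using uv by auto
  show ?thesis
  proof (rule ccontr)
    assume "\<not> ?thesis"
    then obtain m where m: "taylor_quot f s v < m" "m < taylor_quot f s u"
      using dense not_le by metis
    \<comment> \<open>Subtracting the parabola with second order coefficient \<open>m\<close> makes
      \<open>F\<close> vanish to first order at \<open>s\<close>; since \<open>m\<close> separates
      the two quotients, \<open>F\<close> is positive at \<open>u\<close> and negative at
      \<open>v\<close>.\<close>
    define F where "F x = f x - f s - deriv f s * (x - s) - m * (x - s)\<^sup>2" for x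
    have DF: "(F has_real_derivative deriv f x - deriv f s - 2 * m * (x - s)) (at x)" if "0 < x" for x
      unfolding F_def
      by (rule derivative_eq_intros DERIV_deriv diff that refl | simp)+
    define F' where "F' x = deriv f x - deriv f s - 2 * m * (x - s)" for x
    have DF: "(F has_real_derivative F' x) (at x)" if "0 < x" for x
      using DF[OF that] by (simp add: F'_def)
    have Fs: "F s = 0" "F' s = 0"
      by (simp_all add: F_def F'_def)
    have Fu: "F u > 0"
      using m(2) us by (simp add: F_def taylor_quot_def field_simps)
    have Fv: "F v < 0"
      using m(1) us by (simp add: F_def taylor_quot_def field_simps)
    have trap: "2 * (F b - F a) \<le> (b - a) * (F' a + F' b)" if "0 < a" "a < b" for a b
    proof -
      have "2 * divided_diff f b a \<le> deriv f b + deriv f a"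
        using cpd_on_two[OF K, of b a] that by (simp add: divided_diff_commute)
      then have "(b - a) * (2 * divided_diff f b a) \<le> (b - a) * (deriv f b + deriv f a)"
        using that by (intro mult_left_mono) auto
      then have "2 * (f b - f a) \<le> (b - a) * (deriv f b + deriv f a)"
        using mult_divided_diff[of b a f] by (simp add: algebra_simps)
      then show ?thesis
        by (simp add: F_def F'_def algebra_simps power2_eq_square)
    qed
    obtain p where p: "u < p" "p < s" "F s - F u = (s - u) * F' p"
      using MVT2[OF us(1), of F F'] DF uv by force
    obtain q where q: "s < q" "q < v" "F v - F s = (v - s) * F' q"
      using MVT2[OF us(2), of F F'] DF uv by force
    have "(s - u) * F' p < 0" "(v - s) * F' q < 0"
      using p(3) q(3) Fu Fv Fs by auto
    then have pq: "F' p < 0" "F' q < 0"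
      using us by (auto simp: mult_less_0_iff)
    define c where "c = max (F' p) (F' q)"
    have c: "c < 0" "F' p \<le> c" "F' q \<le> c"
      using pq by (auto simp: c_def)
    \<comment> \<open>The tilt by \<open>c\<close> gives \<open>E\<close> the slope
      \<open>- c > 0\<close> at \<open>s\<close> but slopes at most 0 at \<open>p\<close> and
      \<open>q\<close>. Hence the minimum over [p, s] and the maximum over [s, q] are attained off
      \<open>s\<close>.\<close>
    define E where "E x = F x - c * x" for x
    have DE: "(E has_real_derivative F' x - c) (at x)" if "0 < x" for x
      unfolding E_def by (rule derivative_eq_intros DF that refl | simp)+
    have contE: "continuous_on {x..y} E" if "0 < x" for x y
      using that by (intro continuous_at_imp_continuous_on ballI DERIV_isCont[OF DE]) auto
    have p0: "0 < p"
      using p uv by auto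
    obtain \<alpha> where \<alpha>: "\<alpha> \<in> {p..s}" "\<And>y. y \<in> {p..s} \<Longrightarrow> E \<alpha> \<le> E y"
      using continuous_attains_inf[of "{p..s}" E] contE[OF p0] p by (auto simp: less_imp_le)
    obtain \<beta> where \<beta>: "\<beta> \<in> {s..q}" "\<And>y. y \<in> {s..q} \<Longrightarrow> E y \<le> E \<beta>"
      using continuous_attains_sup[of "{s..q}" E] contE[of s q] q uv by (auto simp: less_imp_le)
    obtain d1 where d1: "d1 > 0" "\<And>h. 0 < h \<Longrightarrow> h < d1 \<Longrightarrow> E (s - h) < E s"
      using DERIV_pos_inc_left[OF DE[OF uv(5)]] c Fs by auto
    obtain d2 where d2: "d2 > 0" "\<And>h. 0 < h \<Longrightarrow> h < d2 \<Longrightarrow> E s < E (s + h)"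
      using DERIV_pos_inc_right[OF DE[OF uv(5)]] c Fs by auto
    have \<alpha>s: "E \<alpha> < E s"
    proof -
      obtain h where "0 < h" "h < d1" "h < s - p"
        using field_lbound_gt_zero[of d1 "s - p"] d1(1) p by auto
      then show ?thesis
        using d1(2)[of h] \<alpha>(2)[of "s - h"] by auto
    qed
    have \<beta>s: "E s < E \<beta>"
    proof -
      obtain h where "0 < h" "h < d2" "h < q - s"
        using field_lbound_gt_zero[of d2 "q - s"] d2(1) q by auto
      then show ?thesis
        using d2(2)[of h] \<beta>(2)[of "s + h"] by auto
    qed
    have \<alpha>0: "0 < \<alpha>" "\<alpha> < s"
      using \<alpha> \<alpha>s p0 by (auto simp: order_less_le)
    have \<beta>0: "s < \<beta>"
      using \<beta> \<beta>s by (auto simp: order_less_le)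
    \<comment> \<open>A minimum on [p, s] other than at \<open>p\<close> excludes a positive slope
      of \<open>E\<close>; at \<open>p\<close> itself the bound holds by the choice of
      \<open>c\<close>.\<close>
    have F\<alpha>: "F' \<alpha> \<le> c"
    proof (rule ccontr)
      assume "\<not> ?thesis"
      then have pos: "0 < F' \<alpha> - c" by simp
      then have "p < \<alpha>"
        using c(2) \<alpha> by (cases "p = \<alpha>") auto
      moreover obtain d where d: "d > 0" "\<And>h. 0 < h \<Longrightarrow> h < d \<Longrightarrow> E (\<alpha> - h) < E \<alpha>"
        using DERIV_pos_inc_left[OF DE[OF \<alpha>0(1)] pos] by auto
      moreover obtain h where "0 < h" "h < d" "h < \<alpha> - p"
        using field_lbound_gt_zero[of d "\<alpha> - p"] d(1) \<open>p < \<alpha>\<close> by auto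
      ultimately have "E (\<alpha> - h) < E \<alpha>" "E \<alpha> \<le> E (\<alpha> - h)"
        using \<alpha>0 by (blast, intro \<alpha>(2)) auto
      then show False by simp
    qed
    have F\<beta>: "F' \<beta> \<le> c"
    proof (rule ccontr)
      assume "\<not> ?thesis"
      then have pos: "0 < F' \<beta> - c" by simp
      then have "\<beta> < q"
        using c(3) \<beta> by (cases "q = \<beta>") auto
      moreover obtain d where d: "d > 0" "\<And>h. 0 < h \<Longrightarrow> h < d \<Longrightarrow> E \<beta> < E (\<beta> + h)"
        using DERIV_pos_inc_right[OF DE[of \<beta>] pos] \<beta>0 uv by auto
      moreover obtain h where "0 < h" "h < d" "h < q - \<beta>"
        using field_lbound_gt_zero[of d "q - \<beta>"] d(1) \<open>\<beta> < q\<close> by auto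
      ultimately have "E \<beta> < E (\<beta> + h)" "E (\<beta> + h) \<le> E \<beta>"
        using \<beta>0 by (blast, intro \<beta>(2)) auto
      then show False by simp
    qed
    \<comment> \<open>The trapezoid inequality bounds the mean slope of \<open>F\<close> on
      [\<alpha>, \<beta>] by \<open>c\<close>, so \<open>E\<close> cannot grow from \<alpha> to
      \<beta>.\<close>
    have "2 * (F \<beta> - F \<alpha>) \<le> (\<beta> - \<alpha>) * (F' \<alpha> + F' \<beta>)"
      using trap \<alpha>0 \<beta>0 by auto
    also have "\<dots> \<le> (\<beta> - \<alpha>) * (c + c)"
      using F\<alpha> F\<beta> \<alpha>0 \<beta>0 by (intro mult_left_mono) auto
    finally have "E \<beta> \<le> E \<alpha>"
      by (simp add: E_def algebra_simps)
    with \<alpha>s \<beta>s show False by simp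
  qed
qed


text \<open>Induction on the number of exceptional points between \<open>u\<close> and
  \<open>v\<close>: the largest one is crossed within a short interval at a loss of at most
  \<open>e\<close>, and \<open>e\<close> is arbitrary. The hypothesis \<open>cross\<close> excludes
  downward jumps without asking for one-sided limits.\<close>

lemma mono_glue:
  fixes G :: "real \<Rightarrow> real"
  assumes T: "finite T"
    and mono: "\<And>u v. a \<le> u \<Longrightarrow> u \<le> v \<Longrightarrow> {u..v} \<inter> T = {} \<Longrightarrow> G u \<le> G v"
    and cross: "\<And>\<tau> e. \<tau> \<in> T \<Longrightarrow> a < \<tau> \<Longrightarrow> 0 < e \<Longrightarrow>
       \<exists>d>0. \<forall>u v. a \<le> u \<longrightarrow> \<tau> - d < u \<longrightarrow> u < \<tau> \<longrightarrow> \<tau> < v \<longrightarrow> v < \<tau> + d \<longrightarrow> G u \<le> G v + e"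
  shows "a \<le> u \<Longrightarrow> u \<le> v \<Longrightarrow> u \<notin> T \<Longrightarrow> v \<notin> T \<Longrightarrow> G u \<le> G v"
proof (induction "card (T \<inter> {u..v})" arbitrary: v rule: less_induct)
  case less
  show ?case
  proof (cases "T \<inter> {u..v} = {}")
    case True
    then show ?thesis
      using mono[of u v] less.prems by (auto simp: Int_commute)
  next
    case False
    define \<tau> where "\<tau> = Max (T \<inter> {u..v})"
    have fin: "finite (T \<inter> {u..v})"
      using T by auto
    have "\<tau> \<in> T \<inter> {u..v}"
      unfolding \<tau>_def by (rule Max_in[OF fin False])
    then have \<tau>: "\<tau> \<in> T" "u < \<tau>" "\<tau> < v"
      using less.prems by (auto simp: order_less_le)
    have above: "x \<notin> T" if "\<tau> < x" "x \<le> v" for x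
      using Max_ge[OF fin, of x] that \<tau> by (force simp: \<tau>_def)
    show ?thesis
    proof (rule field_le_epsilon)
      fix e :: real assume "0 < e"
      then obtain d where d: "0 < d" "\<And>u v. a \<le> u \<Longrightarrow> \<tau> - d < u \<Longrightarrow> u < \<tau> \<Longrightarrow> \<tau> < v \<Longrightarrow> v < \<tau> + d \<Longrightarrow> G u \<le> G v + e"
        using cross[of \<tau> e] \<tau> less.prems by (metis le_less_trans)
      \<comment> \<open>The endpoint \<open>u'\<close> must avoid \<open>T\<close>, as the induction
        hypothesis requires; this matters only below \<tau>, since no point of \<open>T\<close> lies
        between \<tau> and \<open>v\<close>.\<close>
      have "infinite ({max u (\<tau> - d)<..<\<tau>} - T)"
        using T \<tau> d by (intro Diff_infinite_finite) auto
      then have "{max u (\<tau> - d)<..<\<tau>} - T \<noteq> {}"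
        by (metis finite.emptyI)
      then obtain u' where "u' \<in> {max u (\<tau> - d)<..<\<tau>} - T"
        by blast
      then have u': "u < u'" "\<tau> - d < u'" "u' < \<tau>" "u' \<notin> T"
        by auto
      obtain v' where v': "\<tau> < v'" "v' < min v (\<tau> + d)"
        using dense[of \<tau> "min v (\<tau> + d)"] \<tau> d by auto
      have "T \<inter> {u..u'} \<subseteq> T \<inter> {u..v}" "\<tau> \<in> T \<inter> {u..v}" "\<tau> \<notin> T \<inter> {u..u'}"
        using \<tau> u' by auto
      then have "T \<inter> {u..u'} \<subset> T \<inter> {u..v}"
        by blast
      then have "card (T \<inter> {u..u'}) < card (T \<inter> {u..v})"
        using fin by (rule psubset_card_mono[rotated])
      then have "G u \<le> G u'"
        by (rule less.hyps) (use less.prems u' in simp_all)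
      also have "G u' \<le> G v' + e"
        using d(2)[of u' v'] u' v' less.prems by auto
      also have "G v' \<le> G v"
        using mono[of v' v] v' above less.prems \<tau> by force
      finally show "G u \<le> G v + e" by simp
    qed
  qed
qed

section \<open>Growth of a function with positive kernel\<close>

lemma psd_on_one_deriv_nonneg: "psd_on n {0<..} (divided_diff f) \<Longrightarrow> 1 \<le> n \<Longrightarrow> 0 < x \<Longrightarrow> 0 \<le> deriv f x"
  using psd_onD[of n "{0<..}" "divided_diff f" "{x}" "\<lambda>_. 1"] by simp

lemma psd_on_one_mono:
  assumes "\<And>x. 0 < x \<Longrightarrow> f differentiable (at x)"
    and "psd_on n {0<..} (divided_diff f)" "1 \<le> n" "0 < x" "x \<le> y"
  shows "f x \<le> f y"
  using assms by (intro DERIV_nonneg_imp_nondecreasing[of x y f])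
    (auto intro!: exI[of _ "deriv f _"] DERIV_deriv psd_on_one_deriv_nonneg)

text \<open>The two-point inequality is a Riccati inequality for \<open>f x - f a\<close>; its integrated form
  \<open>mono\<psi>\<close> is global on the half-line, and letting its endpoint tend to infinity gives concavity.\<close>

lemma psd_on_two_tangent:
  assumes diff: "\<And>x. 0 < x \<Longrightarrow> f differentiable (at x)"
    and K: "psd_on 2 {0<..} (divided_diff f)"
    and au: "0 < a" "a < u"
  shows "f u \<le> f a + deriv f a * (u - a)"
proof -
  define c where "c = deriv f a"
  note pos = psd_on_one_deriv_nonneg[OF K]
  have quad: "(divided_diff f a x)\<^sup>2 \<le> c * deriv f x" if "a < x" for x
    using psd_on_two[OF K, of a x] that au by (simp add: divided_diff_commute c_def)
  note mono = psd_on_one_mono[OF diff K]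
  show ?thesis
  \<comment> \<open>The degenerate cases are settled separately so that both denominators in
    \<open>\<psi>\<close> are positive from \<open>u\<close> on.\<close>
  proof (cases "f u \<le> f a \<or> c = 0")
    case True
    then show ?thesis
    proof
      assume "f u \<le> f a"
      moreover have "0 \<le> deriv f a * (u - a)"
        using pos[of a] au by auto
      ultimately show ?thesis by simp
    next
      assume "c = 0"
      then have "divided_diff f a u = 0"
        using quad[of u] au by auto
      then show ?thesis
        using mult_divided_diff[of a u f] \<open>c = 0\<close> by (simp add: c_def)
    qed
  next
    case False
    then have c: "0 < c" and fu: "f a < f u"
      using pos[of a] au by (auto simp: c_def)
    \<comment> \<open>Dividing the two-point inequality by the square of \<open>f x - f a\<close>
      separates the variables; \<open>\<psi>\<close> is the difference of the primitives of the two
      sides.\<close>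
    define \<psi> where "\<psi> x = 1 / (c * (x - a)) - 1 / (f x - f a)" for x
    have mono\<psi>: "\<psi> u \<le> \<psi> v" if "u \<le> v" for v
    proof (rule DERIV_nonneg_imp_nondecreasing[OF that])
      fix x assume x: "u \<le> x" "x \<le> v"
      have ax: "a < x" "f a < f x"
        using x au fu mono[of u x] by auto
      have "(\<psi> has_real_derivative deriv f x / (f x - f a)\<^sup>2 - 1 / (c * (x - a)\<^sup>2)) (at x)"
        unfolding \<psi>_def using ax c au
        by (auto intro!: derivative_eq_intros DERIV_deriv diff simp: power2_eq_square)
      moreover have "1 / (c * (x - a)\<^sup>2) \<le> deriv f x / (f x - f a)\<^sup>2"
      proof -
        have "(f x - f a)\<^sup>2 = (x - a)\<^sup>2 * (divided_diff f a x)\<^sup>2"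
          using mult_divided_diff[of x a f] by (simp add: divided_diff_commute[of f a x] flip: power_mult_distrib)
        also have "\<dots> \<le> (x - a)\<^sup>2 * (c * deriv f x)"
          using quad[of x] ax by (intro mult_left_mono) auto
        finally show ?thesis
          using ax c by (simp add: divide_simps mult_ac)
      qed
      ultimately show "\<exists>y. (\<psi> has_real_derivative y) (at x) \<and> 0 \<le> y"
        by (intro exI conjI) auto
    qed
    have "filterlim (\<lambda>v. c * (- a + v)) at_top at_top"
      by (intro filterlim_tendsto_pos_mult_at_top[OF tendsto_const c]
          filterlim_tendsto_add_at_top[OF tendsto_const filterlim_ident])
    from tendsto_inverse_0_at_top[OF this] have "((\<lambda>v. 1 / (c * (v - a))) \<longlongrightarrow> 0) at_top"
      by (simp add: divide_inverse)
    \<comment> \<open>The second term of \<open>\<psi> v\<close> has a sign and is dropped, so the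
      bound needs no information on \<open>f\<close> at infinity beyond monotonicity.\<close>
    moreover have "\<forall>\<^sub>F v in at_top. \<psi> u \<le> 1 / (c * (v - a))"
      using eventually_ge_at_top[of u]
    proof eventually_elim
      case (elim v)
      have "f a < f v"
        using mono[of u v] au fu elim by auto
      then have "\<psi> v \<le> 1 / (c * (v - a))"
        by (simp add: \<psi>_def)
      with mono\<psi>[OF elim] show ?case by simp
    qed
    ultimately have "\<psi> u \<le> 0"
      by (intro tendsto_lowerbound[of _ 0]) auto
    then have "1 / (c * (u - a)) \<le> 1 / (f u - f a)"
      by (simp add: \<psi>_def)
    then have "f u - f a \<le> c * (u - a)"
      using c fu au by (simp add: divide_simps split: if_splits)
    then show ?thesis
      by (simp add: c_def)
  qed
qed


section \<open>Divided differences at infinity\<close>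

lemma tendsto_inverse_diff_at_top: "((\<lambda>v. inverse (v - s)) \<longlongrightarrow> (0::real)) at_top"
proof -
  have "filterlim (\<lambda>v. - s + v) at_top at_top"
    by (intro filterlim_tendsto_add_at_top[OF tendsto_const filterlim_ident])
  then show ?thesis
    using tendsto_inverse_0_at_top by fastforce
qed

text \<open>The difference equals \<open>(s * (f v / v) - f s) / (v - s)\<close>, a bounded
  numerator over a growing denominator. The quotient \<open>f v / v\<close> itself need not
  converge, but it does not depend on \<open>s\<close> and cancels between nodes.\<close>

lemma divided_diff_at_top:
  assumes B: "\<And>v. 1 \<le> v \<Longrightarrow> \<bar>f v\<bar> \<le> B * v"
  shows "((\<lambda>v. divided_diff f s v - f v / v) \<longlongrightarrow> 0) at_top"
proof -
  have "((\<lambda>v. inverse (v - s) * (s * (f v / v) - f s)) \<longlongrightarrow> 0) at_top"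
  proof (rule lim_null_mult_right_bounded[OF tendsto_inverse_diff_at_top])
    show "\<forall>\<^sub>F v in at_top. norm (s * (f v / v) - f s) \<le> \<bar>s\<bar> * B + \<bar>f s\<bar>"
      using eventually_ge_at_top[of 1]
    proof eventually_elim
      case (elim v)
      then have "\<bar>f v / v\<bar> \<le> B"
        using B[of v] by (simp add: abs_divide divide_le_eq)
      then have "\<bar>s * (f v / v)\<bar> \<le> \<bar>s\<bar> * B"
        unfolding abs_mult by (intro mult_left_mono) auto
      then show ?case
        unfolding real_norm_def by (rule order_trans[OF abs_triangle_ineq4 add_right_mono])
    qed
  qed
  moreover have "\<forall>\<^sub>F v in at_top. inverse (v - s) * (s * (f v / v) - f s) = divided_diff f s v - f v / v"
    using eventually_gt_at_top[of "max s 0"]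
  proof eventually_elim
    case (elim v)
    then show ?case
      by (simp add: divided_diff_def divide_simps) (simp add: algebra_simps)
  qed
  ultimately show ?thesis
    by (rule Lim_transform_eventually)
qed

lemma abs_le_linear:
  fixes f :: "real \<Rightarrow> real"
  assumes "1 \<le> v" "f 1 \<le> f v" "f v \<le> f 1 + c * (v - 1)" "0 \<le> c"
  shows "\<bar>f v\<bar> \<le> (\<bar>f 1\<bar> + c) * v"
proof -
  have "\<bar>f 1\<bar> \<le> \<bar>f 1\<bar> * v"
    using mult_left_mono[OF assms(1), of "\<bar>f 1\<bar>"] by simp
  moreover have "0 \<le> c * v"
    using assms by simp
  ultimately have "\<bar>f v\<bar> \<le> \<bar>f 1\<bar> * v + c * v"
    using assms unfolding right_diff_distrib abs_le_iff by linarith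
  then show ?thesis
    by (simp add: distrib_right)
qed

text \<open>Monotonicity bounds \<open>f\<close> below and the tangent at 1 bounds it above. Applied
  to \<open>- f (1 / t)\<close>, the same bound controls \<open>f\<close> near 0.\<close>

lemma psd_on_two_linear_bound:
  assumes diff: "\<And>x. 0 < x \<Longrightarrow> f differentiable (at x)"
    and K: "psd_on 2 {0<..} (divided_diff f)" and v: "1 \<le> v"
  shows "\<bar>f v\<bar> \<le> (\<bar>f 1\<bar> + deriv f 1) * v"
proof (rule abs_le_linear[where f = f, OF v])
  show "f 1 \<le> f v"
    using psd_on_one_mono[OF diff K] v by simp
  show "f v \<le> f 1 + deriv f 1 * (v - 1)"
    using psd_on_two_tangent[OF diff K, of 1 v] v by (cases "v = 1") auto
  show "0 \<le> deriv f 1"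
    using psd_on_one_deriv_nonneg[OF K] by simp
qed

section \<open>Second divided differences\<close>

lemma DERIV_divided_diff:
  assumes "f differentiable (at v)" "v \<noteq> s"
  shows "(divided_diff f s has_real_derivative (deriv f v - divided_diff f s v) / (v - s)) (at v)"
proof -
  have "((\<lambda>x. (f s - f x) / (s - x)) has_real_derivative
      ((0 - deriv f v) * (s - v) - (f s - f v) * (0 - 1)) / ((s - v) * (s - v))) (at v)"
    using assms(2) by (intro DERIV_divide DERIV_diff DERIV_const DERIV_ident DERIV_deriv assms(1)) auto
  also have "((0 - deriv f v) * (s - v) - (f s - f v) * (0 - 1)) / ((s - v) * (s - v))
      = (deriv f v - divided_diff f s v) / (v - s)"
    unfolding mult_divided_diff[symmetric] using assms(2)
    by (simp add: divide_simps) (simp add: algebra_simps)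
  finally show ?thesis
    by (rule has_field_derivative_transform_within_open[of _ _ _ "- {s}"])
      (use assms(2) in \<open>auto simp: divided_diff_def\<close>)
qed

lemma taylor_quot_eq:
  assumes "v \<noteq> s"
  shows "taylor_quot f s v = (deriv f s - divided_diff f s v) / (s - v)"
proof -
  have N: "f v - f s - deriv f s * (v - s) = (deriv f s - divided_diff f s v) * (s - v)"
    using mult_divided_diff[of s v f] by (simp add: algebra_simps)
  have "(v - s)\<^sup>2 = (s - v) * (s - v)"
    by (simp add: power2_eq_square algebra_simps)
  then show ?thesis
    unfolding taylor_quot_def N using assms by simp
qed

text \<open>\<open>second_diff f s t v\<close> is the second divided difference \<open>f\<^bsup>[2]\<^esup>(s, t, v)\<close>,
  written so that its only singularity is at \<open>s = t = v\<close>.\<close>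

definition second_diff :: "(real \<Rightarrow> real) \<Rightarrow> real \<Rightarrow> real \<Rightarrow> real \<Rightarrow> real" where
  "second_diff f s t v = (if s = t then taylor_quot f s v
     else (divided_diff f s v - divided_diff f t v) / (s - t))"

text \<open>Symmetry of the second divided difference in its nodes: here the last step runs over
  \<open>t\<close> and \<open>v\<close> instead of \<open>s\<close> and \<open>t\<close>, which
  removes the case distinction when \<open>v\<close> is off both nodes.\<close>

lemma second_diff_eq:
  assumes "v \<noteq> s" "v \<noteq> t"
  shows "second_diff f s t v = (divided_diff f s t - divided_diff f s v) / (t - v)"
proof (cases "s = t")
  case True
  then show ?thesis
    using assms by (simp add: second_diff_def taylor_quot_eq)
next
  case False
  have "(divided_diff f s v - divided_diff f t v) * (t - v) = (divided_diff f s t - divided_diff f s v) * (s - t)"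
    using mult_divided_diff[of s t f] mult_divided_diff[of s v f] mult_divided_diff[of t v f]
    by (simp add: algebra_simps)
  then show ?thesis
    using assms False by (simp add: second_diff_def frac_eq_eq)
qed

text \<open>The derivative in \<open>v\<close> is the third order divided difference at s, t, v, v.
  Its numerator is the bordered kernel with base point \<open>v\<close>, and its denominator splits
  into factors that go into the weights.\<close>

lemma DERIV_second_diff:
  assumes diff: "f differentiable (at v)" and v: "v \<noteq> s" "v \<noteq> t"
  shows "(second_diff f s t has_real_derivative
     (divided_diff f s t - divided_diff f s v - divided_diff f v t + deriv f v) / ((s - v) * (t - v))) (at v)"
proof (cases "s = t")
  case True
  have "(deriv f s + deriv f v - 2 * divided_diff f s v) / (v - s)\<^sup>2
      = (divided_diff f s t - divided_diff f s v - divided_diff f v t + deriv f v) / ((s - v) * (t - v))"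
    using True by (simp add: divided_diff_commute[of f v] power2_eq_square algebra_simps)
  then show ?thesis
    using DERIV_taylor_quot[OF diff v(1)] True by (simp add: second_diff_def[abs_def])
next
  case False
  have "(second_diff f s t has_real_derivative
     ((deriv f v - divided_diff f s v) / (v - s) - (deriv f v - divided_diff f t v) / (v - t)) / (s - t)) (at v)"
    unfolding second_diff_def[abs_def] using False v
    by (auto intro!: DERIV_cdivide DERIV_diff DERIV_divided_diff diff)
  also have "((deriv f v - divided_diff f s v) / (v - s) - (deriv f v - divided_diff f t v) / (v - t)) / (s - t)
     = (divided_diff f s t - divided_diff f s v - divided_diff f v t + deriv f v) / ((s - v) * (t - v))"
  proof -
    have alg: "((d - a) / (v - s) - (d - b) / (v - t)) / (s - t) = (c - a - b + d) / ((s - v) * (t - v))"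
      if "(s - t) * c = (s - v) * a - (t - v) * b" for a b c d
    proof -
      have "((d - a) / (v - s) - (d - b) / (v - t)) = ((d - a) * (v - t) - (d - b) * (v - s)) / ((s - v) * (t - v))"
        using v by (simp add: divide_simps) (simp add: algebra_simps)
      also have "(d - a) * (v - t) - (d - b) * (v - s) = (s - t) * (c - a - b + d)"
        using that by (simp add: algebra_simps)
      finally show ?thesis
        using False by simp
    qed
    show ?thesis
      unfolding divided_diff_commute[of f v t]
      by (rule alg) (simp add: mult_divided_diff)
  qed
  finally show ?thesis .
qed

lemma isCont_second_diff:
  assumes diff: "f differentiable (at s)" "f differentiable (at t)" "f differentiable (at v)"
    and "\<not> (s = v \<and> t = v)"
  shows "isCont (second_diff f s t) v"
proof (cases "s = t")
  case True
  then show ?thesis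
    using DERIV_second_diff[of f v s t] assms by (auto intro: DERIV_isCont)
next
  case False
  have "isCont (\<lambda>v. (divided_diff f s v - divided_diff f t v) / (s - t)) v"
    using False by (intro continuous_intros isCont_divided_diff diff) auto
  then show ?thesis
    using False by (simp add: second_diff_def[abs_def])
qed

text \<open>For distinct nodes the common drift \<open>f v / v\<close> cancels; for
  \<open>s = t\<close> a bounded quantity is divided by \<open>v - s\<close>.\<close>

lemma second_diff_at_top:
  assumes B: "\<And>v. 1 \<le> v \<Longrightarrow> \<bar>f v\<bar> \<le> B * v"
  shows "(second_diff f s t \<longlongrightarrow> 0) at_top"
proof (cases "s = t")
  case False
  have "((\<lambda>v. ((divided_diff f s v - f v / v) - (divided_diff f t v - f v / v)) / (s - t)) \<longlongrightarrow> (0 - 0) / (s - t)) at_top"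
    using False by (intro tendsto_intros divided_diff_at_top[OF B]) auto
  then show ?thesis
    using False by (simp add: second_diff_def[abs_def])
next
  case True
  have "((\<lambda>v. inverse (v - s) * (divided_diff f s v - deriv f s)) \<longlongrightarrow> 0) at_top"
  proof (rule lim_null_mult_right_bounded[OF tendsto_inverse_diff_at_top])
    have "\<forall>\<^sub>F v in at_top. dist (divided_diff f s v - f v / v) 0 < 1"
      by (rule tendstoD[OF divided_diff_at_top[OF B]]) auto
    then show "\<forall>\<^sub>F v in at_top. norm (divided_diff f s v - deriv f s) \<le> 1 + B + \<bar>deriv f s\<bar>"
      using eventually_ge_at_top[of 1]
    proof eventually_elim
      case (elim v)
      then have "\<bar>f v / v\<bar> \<le> B"
        using B[of v] by (simp add: abs_divide divide_le_eq)
      then show ?case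
        using elim(1) unfolding dist_norm real_norm_def by linarith
    qed
  qed
  moreover have "\<forall>\<^sub>F v in at_top. inverse (v - s) * (divided_diff f s v - deriv f s) = second_diff f s t v"
    using eventually_gt_at_top[of s]
  proof eventually_elim
    case (elim v)
    have "(deriv f s - divided_diff f s v) / (s - v) = (divided_diff f s v - deriv f s) / (v - s)"
      using minus_divide_divide[of "deriv f s - divided_diff f s v" "s - v"] by simp
    then show ?case
      using elim True by (simp add: second_diff_def taylor_quot_eq divide_inverse mult_ac)
  qed
  ultimately show ?thesis
    by (rule Lim_transform_eventually)
qed

text \<open>The form is increasing in \<open>u\<close>: its derivative is a bordered form of the kernel, and at the points
  of \<open>T\<close> it can only jump upwards. At infinity it vanishes.\<close>

lemma second_diff_form_nonpos:
  assumes diff: "\<And>x. 0 < x \<Longrightarrow> f differentiable (at x)"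
    and K: "psd_on (Suc n) {0<..} (divided_diff f)"
    and T: "finite T" "card T \<le> n" "T \<subseteq> {u<..}" and u: "0 < u"
  shows "(\<Sum>s\<in>T. \<Sum>t\<in>T. X s * X t * ((divided_diff f s t - divided_diff f s u) / (t - u))) \<le> 0"
proof (cases "T = {}")
  case nonempty: False
  then have n: "1 \<le> n"
    using T by (metis One_nat_def Suc_leI card_gt_0_iff order_less_le_trans)
  have K2: "psd_on 2 {0<..} (divided_diff f)"
    using K by (rule psd_on_mono) (use n in auto)
  have pos: "0 < s" if "s \<in> T" for s
    using that T(3) u by force
  define G where "G v = (\<Sum>s\<in>T. \<Sum>t\<in>T. X s * X t * second_diff f s t v)" for v
  have mono: "G a \<le> G b" if ab: "u \<le> a" "a \<le> b" "{a..b} \<inter> T = {}" for a b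
  proof (rule DERIV_nonneg_imp_nondecreasing[OF ab(2)])
    fix v assume v: "a \<le> v" "v \<le> b"
    then have vT: "0 < v" "v \<notin> T"
      using ab u by auto
    let ?K = "\<lambda>s t. divided_diff f s t - divided_diff f s v - divided_diff f v t + divided_diff f v v"
    have "(G has_real_derivative (\<Sum>s\<in>T. \<Sum>t\<in>T. X s * X t * (?K s t / ((s - v) * (t - v))))) (at v)"
      unfolding G_def divided_diff_self
      using vT by (intro DERIV_sum DERIV_cmult DERIV_second_diff diff) auto
    \<comment> \<open>Here the additional point of the hypothesis is spent: the border needs
      \<open>v\<close> besides the at most \<open>n\<close> points of \<open>T\<close>.\<close>
    moreover have "0 \<le> (\<Sum>s\<in>T. \<Sum>t\<in>T. X s / (s - v) * (X t / (t - v)) * ?K s t)"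
      using T(1,2) pos vT
      by (intro psd_onD[OF cpd_on_border[OF psd_on_imp_cpd_on[OF K], of v]]) auto
    moreover have "X s / (s - v) * (X t / (t - v)) * ?K s t = X s * X t * (?K s t / ((s - v) * (t - v)))" for s t
      by simp
    ultimately show "\<exists>y. (G has_real_derivative y) (at v) \<and> 0 \<le> y"
      by (simp only:) blast
  qed
  have cross: "\<exists>d>0. \<forall>a b. u \<le> a \<longrightarrow> \<tau> - d < a \<longrightarrow> a < \<tau> \<longrightarrow> \<tau> < b \<longrightarrow> b < \<tau> + d \<longrightarrow> G a \<le> G b + e"
    if \<tau>: "\<tau> \<in> T" and e: "0 < e" for \<tau> e
  proof -
    \<comment> \<open>Only the pair (\<tau>, \<tau>) can be discontinuous at \<tau>. Its coefficient
      is a square and its Taylor quotient is nondecreasing across \<tau>, so the rest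
      \<open>C\<close> is split off and treated by continuity.\<close>
    define C where "C v = (\<Sum>s\<in>T. \<Sum>t\<in>T. if s = \<tau> \<and> t = \<tau> then 0 else X s * X t * second_diff f s t v)" for v
    have G: "G v = X \<tau> * X \<tau> * taylor_quot f \<tau> v + C v" for v
    proof -
      have "G v = (\<Sum>s\<in>T. \<Sum>t\<in>T. (if s = \<tau> then if t = \<tau> then X \<tau> * X \<tau> * taylor_quot f \<tau> v else 0 else 0)
         + (if s = \<tau> \<and> t = \<tau> then 0 else X s * X t * second_diff f s t v))"
        unfolding G_def by (intro sum.cong refl) (auto simp: second_diff_def)
      also have "\<dots> = (\<Sum>s\<in>T. \<Sum>t\<in>T. if s = \<tau> then if t = \<tau> then X \<tau> * X \<tau> * taylor_quot f \<tau> v else 0 else 0) + C v"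
        unfolding sum.distrib C_def ..
      also have "(\<Sum>s\<in>T. \<Sum>t\<in>T. if s = \<tau> then if t = \<tau> then X \<tau> * X \<tau> * taylor_quot f \<tau> v else 0 else 0)
         = (\<Sum>s\<in>T. if s = \<tau> then X \<tau> * X \<tau> * taylor_quot f \<tau> v else 0)"
        using T(1) \<tau> by (intro sum.cong refl) simp
      also have "\<dots> = X \<tau> * X \<tau> * taylor_quot f \<tau> v"
        using T(1) \<tau> by simp
      finally show ?thesis .
    qed
    have "isCont (\<lambda>v. if s = \<tau> \<and> t = \<tau> then 0 else X s * X t * second_diff f s t v) \<tau>" if "s \<in> T" "t \<in> T" for s t
    proof (cases "s = \<tau> \<and> t = \<tau>")
      case False
      then show ?thesis
        using that \<tau> pos by (simp only: if_False) (intro continuous_intros isCont_second_diff diff; auto)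
    qed simp
    note cont = this
    have "isCont C \<tau>"
      unfolding C_def by (intro continuous_sum cont)
    then obtain d where d: "0 < d" "\<And>v. \<bar>v - \<tau>\<bar> < d \<Longrightarrow> \<bar>C v - C \<tau>\<bar> < e / 2"
      using continuous_at_eps_delta[THEN iffD1, rule_format, of \<tau> C "e / 2"] e
      by (auto simp: dist_real_def)
    show ?thesis
    proof (intro exI[of _ d] conjI allI impI d(1))
      fix a b assume ab: "u \<le> a" "\<tau> - d < a" "a < \<tau>" "\<tau> < b" "b < \<tau> + d"
      have "taylor_quot f \<tau> a \<le> taylor_quot f \<tau> b"
        using ab u pos[OF \<tau>] by (intro taylor_quot_mono[OF diff psd_on_imp_cpd_on[OF K2]]) auto
      then have "X \<tau> * X \<tau> * taylor_quot f \<tau> a \<le> X \<tau> * X \<tau> * taylor_quot f \<tau> b"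
        by (intro mult_left_mono) auto
      moreover have "\<bar>C a - C \<tau>\<bar> < e / 2" "\<bar>C b - C \<tau>\<bar> < e / 2"
        using d(2)[of a] d(2)[of b] ab by auto
      ultimately show "G a \<le> G b + e"
        unfolding G by (simp add: abs_if split: if_splits)
    qed
  qed
  have "(G \<longlongrightarrow> (\<Sum>s\<in>T. \<Sum>t\<in>T. X s * X t * 0)) at_top"
    unfolding G_def by (intro tendsto_intros second_diff_at_top[OF psd_on_two_linear_bound[OF diff K2]])
  then have "(G \<longlongrightarrow> 0) at_top"
    by simp
  moreover have "\<forall>\<^sub>F v in at_top. G u \<le> G v"
    using eventually_gt_at_top[of "Max T"]
  proof eventually_elim
    case (elim v)
    then have "v \<notin> T"
      using T(1) by (auto dest: Max_ge)
    moreover have "u < v"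
      using Max_in[OF T(1) nonempty] T(3) elim by force
    moreover have "u \<notin> T"
      using T(3) by auto
    ultimately show ?case
      by - (rule mono_glue[where a = u and G = G, OF T(1) mono cross], auto)
  qed
  ultimately have "G u \<le> 0"
    by (intro tendsto_lowerbound[of G 0 at_top "G u"]) auto
  moreover have "G u = (\<Sum>s\<in>T. \<Sum>t\<in>T. X s * X t * ((divided_diff f s t - divided_diff f s u) / (t - u)))"
  proof -
    have "second_diff f s t u = (divided_diff f s t - divided_diff f s u) / (t - u)" if "s \<in> T" "t \<in> T" for s t
      using that T(3) by (intro second_diff_eq) auto
    then show ?thesis
      unfolding G_def by (intro sum.cong refl) simp
  qed
  ultimately show ?thesis
    by (simp only:)
qed simp


section \<open>Sending a point to the boundary\<close>

lemma quadratic_eventually_pos: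
  fixes k b c :: real
  assumes "0 < k"
  shows "\<exists>N. \<forall>x>N. 0 < k * x\<^sup>2 + b * x + c"
proof (intro exI allI impI)
  fix x :: real assume x: "1 + (\<bar>b\<bar> + \<bar>c\<bar>) / k < x"
  have "0 \<le> (\<bar>b\<bar> + \<bar>c\<bar>) / k"
    using assms by simp
  then have x1: "1 < x"
    using x by linarith
  have "(\<bar>b\<bar> + \<bar>c\<bar>) / k < x"
    using x by linarith
  then have "\<bar>b\<bar> + \<bar>c\<bar> < k * x"
    using assms by (simp add: divide_less_eq mult.commute)
  then have "(\<bar>b\<bar> + \<bar>c\<bar>) * x < k * x * x"
    using x1 by (intro mult_strict_right_mono) auto
  moreover have "\<bar>c\<bar> \<le> \<bar>c\<bar> * x"
    using x1 mult_left_mono[of 1 x "\<bar>c\<bar>"] by simp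
  moreover have "- (b * x) \<le> \<bar>b\<bar> * x"
    using x1 abs_ge_minus_self[of "b * x"] by (simp add: abs_mult)
  ultimately show "0 < k * x\<^sup>2 + b * x + c"
    unfolding power2_eq_square distrib_right mult.assoc[symmetric] by linarith
qed

text \<open>A positive value at \<open>t\<close> would persist for all larger arguments by
  monotonicity and force quadratic growth, while \<open>upper\<close> allows less than that at
  arbitrarily large arguments. The conclusion says that to the right of \<open>a\<close> the graph
  lies below the tangent at \<open>a\<close>.\<close>

lemma taylor_quot_nonpos:
  assumes diff: "\<And>x. 0 < x \<Longrightarrow> f differentiable (at x)"
    and K: "cpd_on 2 {0<..} (divided_diff f)"
    and upper: "\<And>e N. 0 < e \<Longrightarrow> \<exists>t>N. f t \<le> e * t\<^sup>2"
    and at: "0 < a" "a < t"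
  shows "taylor_quot f a t \<le> 0"
proof (rule ccontr)
  define \<eta> where "\<eta> = taylor_quot f a t"
  assume "\<not> ?thesis"
  then have \<eta>: "0 < \<eta>"
    by (simp add: \<eta>_def)
  \<comment> \<open>The polynomial is \<open>\<eta> * (x - a)^2\<close> plus the tangent at
    \<open>a\<close>, minus the allowed \<open>\<eta> / 2 * x^2\<close>.\<close>
  obtain N where N: "\<And>x. N < x \<Longrightarrow> 0 < \<eta> / 2 * x\<^sup>2 + (deriv f a - 2 * \<eta> * a) * x + (f a - deriv f a * a + \<eta> * a\<^sup>2)"
    using quadratic_eventually_pos[of "\<eta> / 2"] \<eta> by force
  obtain x where x: "max N t < x" "f x \<le> \<eta> / 2 * x\<^sup>2"
    using upper[of "\<eta> / 2" "max N t"] \<eta> by auto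
  have "\<eta> \<le> taylor_quot f a x"
    unfolding \<eta>_def using x at by (intro taylor_quot_mono[OF diff K]) auto
  then have "\<eta> * (x - a)\<^sup>2 \<le> f x - f a - deriv f a * (x - a)"
    using x at by (simp add: taylor_quot_def pos_le_divide_eq)
  with x N[of x] show False
    by (simp add: algebra_simps power2_diff)
qed

text \<open>Weights \<open>X\<close> on \<open>T\<close> and \<open>- S\<close> at a far point
  \<open>a\<close> give Q - S^2 (2 f(a)/a - f'(a)) up to a vanishing error, because every secant
  slope to \<open>a\<close> is close to f(a)/a. It remains to find far points at which 2 f(a)/a -
  f'(a) is at least a small negative number; this is \<open>slope\<close>.\<close>

lemma cpd_on_imp_psd_on:
  assumes diff: "\<And>x. 0 < x \<Longrightarrow> f differentiable (at x)"
    and K: "cpd_on (Suc n) {0<..} (divided_diff f)" and n: "1 \<le> n"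
    and upper: "\<And>e N. 0 < e \<Longrightarrow> \<exists>t>N. f t \<le> e * t\<^sup>2"
    and lower: "\<And>e N. 0 < e \<Longrightarrow> \<exists>t>N. - (e * t) \<le> f t"
  shows "psd_on n {0<..} (divided_diff f)"
proof -
  have K2: "cpd_on 2 {0<..} (divided_diff f)"
    using K by (rule cpd_on_mono) (use n in auto)
  have tangent: "f t \<le> f a + deriv f a * (t - a)" if "0 < a" "a < t" for a t
    using taylor_quot_nonpos[OF diff K2 upper that] that
    by (simp add: taylor_quot_def divide_le_0_iff not_less algebra_simps)
  have deriv_nonneg: "0 \<le> deriv f a" if a: "0 < a" for a
  proof (rule ccontr)
    \<comment> \<open>The tangent at \<open>a\<close> has slope \<open>- 2 * e\<close>, so it drops
      below \<open>- (e * t)\<close> for large \<open>t\<close>, against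
      \<open>lower\<close>.\<close>
    define e where "e = - deriv f a / 2"
    assume "\<not> ?thesis"
    then have e: "0 < e"
      by (simp add: e_def)
    obtain t where t: "max a ((f a + 2 * e * a) / e) < t" "- (e * t) \<le> f t"
      using lower[OF e] by blast
    have "f t \<le> f a - 2 * e * (t - a)"
      using tangent[OF a, of t] t by (simp add: e_def)
    moreover have "f a + 2 * e * a < e * t"
      using t e by (simp add: divide_less_eq mult.commute)
    ultimately show False
      using t(2) by (simp add: algebra_simps)
  qed
  have mono: "f x \<le> f y" if "0 < x" "x \<le> y" for x y
    using that by (intro DERIV_nonneg_imp_nondecreasing[of x y f])
      (auto intro!: exI[of _ "deriv f _"] DERIV_deriv diff deriv_nonneg)
  define B where "B = \<bar>f 1\<bar> + deriv f 1"
  have B: "\<bar>f v\<bar> \<le> B * v" if "1 \<le> v" for v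
    unfolding B_def
    using mono[of 1 v] tangent[of 1 v] deriv_nonneg[of 1] that
    by (intro abs_le_linear[where f = f]) (cases "v = 1"; auto)+
  \<comment> \<open>If this failed, \<open>f\<close> would satisfy f' > 2 f/a + e beyond
    \<open>N\<close>; with the linear bound on \<open>f\<close> this makes \<open>f\<close> too
    negative for \<open>lower\<close>.\<close>
  have slope: "\<exists>a>N. - e \<le> 2 * f a / a - deriv f a" if e: "0 < e" for e N
  proof (rule ccontr)
    assume "\<not> ?thesis"
    then have steep: "2 * f a / a + e < deriv f a" if "N < a" for a
      using that by (auto simp: not_le)
    obtain x where x: "max N 1 < x" "- (e / 2 * x) \<le> f x"
      using lower[of "e / 2" "max N 1"] e by auto
    \<comment> \<open>The integrating factor of f' - 2 f / y is 1 / y^2, and \<open>- e / y\<close>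
      is a primitive of \<open>e / y^2\<close>.\<close>
    define \<psi> where "\<psi> y = f y / y\<^sup>2 + e / y" for y
    have mono\<psi>: "\<psi> x \<le> \<psi> y" if "x \<le> y" for y
    proof (rule DERIV_nonneg_imp_nondecreasing[OF that])
      fix z assume z: "x \<le> z" "z \<le> y"
      then have z0: "0 < z" "N < z"
        using x by auto
      have "(\<psi> has_real_derivative (deriv f z * z\<^sup>2 - f z * (2 * z)) / (z\<^sup>2 * z\<^sup>2) + - e / z\<^sup>2) (at z)"
        unfolding \<psi>_def using z0
        by (auto intro!: derivative_eq_intros DERIV_deriv diff simp: power2_eq_square)
      moreover have "(deriv f z * z\<^sup>2 - f z * (2 * z)) / (z\<^sup>2 * z\<^sup>2) + - e / z\<^sup>2 = (deriv f z - (2 * f z / z + e)) / z\<^sup>2"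
        using z0 by (simp add: field_simps power2_eq_square)
      moreover have "0 \<le> (deriv f z - (2 * f z / z + e)) / z\<^sup>2"
        using steep[OF z0(2)] by simp
      ultimately show "\<exists>d. (\<psi> has_real_derivative d) (at z) \<and> 0 \<le> d"
        by (simp only:) blast
    qed
    have "((\<lambda>y. inverse (y - 0) * (B + e)) \<longlongrightarrow> 0 * (B + e)) at_top"
      by (intro tendsto_mult tendsto_inverse_diff_at_top tendsto_const)
    moreover have "\<forall>\<^sub>F y in at_top. \<psi> x \<le> inverse (y - 0) * (B + e)"
      using eventually_ge_at_top[of x]
    proof eventually_elim
      case (elim y)
      have y: "1 \<le> y"
        using x elim by auto
      then have "f y / y\<^sup>2 \<le> B * y / y\<^sup>2"
        using B[of y] by (intro divide_right_mono) auto
      then have "\<psi> y \<le> inverse (y - 0) * (B + e)"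
        using y by (simp add: \<psi>_def power2_eq_square field_simps)
      with mono\<psi>[OF elim] show ?case by simp
    qed
    ultimately have "\<psi> x \<le> 0"
      by (intro tendsto_lowerbound[of _ 0]) auto
    then have "f x + e * x \<le> 0"
      using x by (simp add: \<psi>_def field_simps power2_eq_square)
    moreover have "0 < e * x"
      using e x by auto
    ultimately show False
      using x(2) by simp
  qed
  show ?thesis
    unfolding psd_on_def
  proof (intro allI impI, elim conjE)
    fix T :: "real set" and X :: "real \<Rightarrow> real"
    assume T: "finite T" "T \<subseteq> {0<..}" "card T \<le> n"
    define Q where "Q = (\<Sum>s\<in>T. \<Sum>t\<in>T. X s * X t * divided_diff f s t)"
    define S where "S = sum X T"
    define R where "R a = 2 * S * (\<Sum>s\<in>T. X s * (divided_diff f s a - f a / a))" for a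
    have "0 \<le> Q"
    proof (rule ccontr)
      assume "\<not> 0 \<le> Q"
      then have Q: "Q < 0" by simp
      have "(R \<longlongrightarrow> 2 * S * (\<Sum>s\<in>T. X s * 0)) at_top"
        unfolding R_def by (intro tendsto_intros divided_diff_at_top[OF B])
      then have "(R \<longlongrightarrow> 0) at_top" by simp
      from tendstoD[OF this, of "- Q / 2"] Q
      have "\<forall>\<^sub>F a in at_top. \<bar>R a\<bar> < - Q / 2"
        by simp
      then obtain N where N: "\<And>a. N \<le> a \<Longrightarrow> \<bar>R a\<bar> < - Q / 2"
        by (auto simp: eventually_at_top_linorder)
      \<comment> \<open>The error \<open>R a\<close> and the slope term each use up less than half
        of \<open>- Q\<close>; the summand 1 covers \<open>S = 0\<close>.\<close>
      define e where "e = - Q / (2 * (S\<^sup>2 + 1))"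
      have S1: "0 < S\<^sup>2 + 1"
        by (simp add: add_nonneg_pos)
      have e: "0 < e" "S\<^sup>2 * e < - Q / 2"
        using Q S1 by (auto simp: e_def field_simps)
      obtain a where a: "max N (Max (insert 0 T)) < a" "- e \<le> 2 * f a / a - deriv f a"
        using slope[OF e(1)] by blast
      have "Max (insert 0 T) < a"
        using a by simp
      then have aT: "0 < a" "a \<notin> T"
        using T(1) by auto
      have "0 \<le> (\<Sum>s\<in>T. \<Sum>t\<in>T. X s * X t *
          (divided_diff f s t - divided_diff f s a - divided_diff f a t + divided_diff f a a))"
        using T aT by (intro psd_onD[OF cpd_on_border[OF K, of a]]) auto
      also have "\<dots> = Q - 2 * S * (\<Sum>s\<in>T. X s * divided_diff f s a) + S\<^sup>2 * deriv f a"
        unfolding quadratic_form_border Q_def S_def by (simp add: divided_diff_commute[of f a])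
      finally have "0 \<le> Q - 2 * S * (\<Sum>s\<in>T. X s * divided_diff f s a) + S\<^sup>2 * deriv f a" .
      moreover have "2 * S * (\<Sum>s\<in>T. X s * divided_diff f s a) = R a + S\<^sup>2 * (2 * f a / a)"
      proof -
        have eq: "(\<Sum>s\<in>T. X s * (divided_diff f s a - f a / a)) = (\<Sum>s\<in>T. X s * divided_diff f s a) - S * (f a / a)"
          by (simp add: S_def right_diff_distrib sum_subtractf sum_distrib_right sum_divide_distrib)
        show ?thesis
          unfolding R_def eq by (simp add: algebra_simps power2_eq_square)
      qed
      ultimately have "0 \<le> Q - R a - S\<^sup>2 * (2 * f a / a - deriv f a)"
        by (simp add: algebra_simps)
      moreover have "S\<^sup>2 * (- e) \<le> S\<^sup>2 * (2 * f a / a - deriv f a)"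
        using a by (intro mult_left_mono) auto
      ultimately show False
        using N[of a] a e(2) by simp
    qed
    then show "0 \<le> (\<Sum>s\<in>T. \<Sum>t\<in>T. X s * X t * divided_diff f s t)"
      by (simp add: Q_def)
  qed
qed


section \<open>Inversion and multiplication by the variable\<close>

lemma divided_diff_uminus:
  assumes "f differentiable (at s)"
  shows "divided_diff (\<lambda>t. - f t) s t = - divided_diff f s t"
proof -
  have "deriv (\<lambda>t. - f t) s = - deriv f s"
    by (rule DERIV_imp_deriv DERIV_minus DERIV_deriv assms)+
  then show ?thesis
    by (cases "s = t") (simp_all add: divided_diff_def minus_divide_left)
qed

lemma DERIV_shift_inverse:
  assumes "h differentiable (at (a + 1 / \<tau>))" "\<tau> \<noteq> 0"
  shows "((\<lambda>\<tau>. h (a + 1 / \<tau>)) has_real_derivative - (deriv h (a + 1 / \<tau>) / \<tau>\<^sup>2)) (at \<tau>)"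
proof -
  have "((\<lambda>\<tau>. a + 1 / \<tau>) has_real_derivative - (1 / \<tau>\<^sup>2)) (at \<tau>)"
    using assms(2) by (auto intro!: derivative_eq_intros simp: power2_eq_square)
  from DERIV_chain2[OF DERIV_deriv[OF assms(1)] this] show ?thesis
    by simp
qed

text \<open>The increment of \<open>a + 1 / \<tau>\<close> is
  \<open>- (\<sigma> - \<tau>) / (\<sigma> * \<tau>)\<close>. Its denominator is a product over the
  two nodes, so up to sign the substitution is a congruence of kernels; the minus sign is why
  inverted functions are negated below.\<close>

lemma divided_diff_shift_inverse:
  assumes "h differentiable (at (a + 1 / \<sigma>))" "\<sigma> \<noteq> 0" "\<tau> \<noteq> 0"
  shows "divided_diff (\<lambda>\<tau>. h (a + 1 / \<tau>)) \<sigma> \<tau> = - (1 / \<sigma> * (1 / \<tau>) * divided_diff h (a + 1 / \<sigma>) (a + 1 / \<tau>))"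
proof (cases "\<sigma> = \<tau>")
  case True
  then show ?thesis
    using DERIV_imp_deriv[OF DERIV_shift_inverse[OF assms(1,2)]] assms
    by (simp add: power2_eq_square)
next
  case False
  have *: "(a + 1 / \<sigma>) - (a + 1 / \<tau>) = - (\<sigma> - \<tau>) * (1 / \<sigma> * (1 / \<tau>))"
    using assms by (simp add: diff_frac_eq)
  have alg: "d / p = - (k * (d / (- p * k)))" if "k \<noteq> 0" for d p k :: real
    using that by simp
  have ne: "a + 1 / \<sigma> \<noteq> a + 1 / \<tau>"
    using assms False by simp
  have nz: "1 / \<sigma> * (1 / \<tau>) \<noteq> 0"
    using assms by simp
  show ?thesis
    unfolding divided_diff_def if_not_P[OF False] if_not_P[OF ne] * by (rule alg[OF nz])
qed

lemma DERIV_mult_id: "f differentiable (at s) \<Longrightarrow>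
    ((\<lambda>t. t * f t) has_real_derivative f s + s * deriv f s) (at s)"
  for f :: "real \<Rightarrow> real"
  using DERIV_mult[OF DERIV_ident DERIV_deriv] by (fastforce simp: algebra_simps)

text \<open>Leibniz rule. The term \<open>f t\<close> depends on one variable, so for weights of
  zero sum only \<open>s * divided_diff f s t\<close> counts.\<close>

lemma divided_diff_mult_id:
  assumes "f differentiable (at s)"
  shows "divided_diff (\<lambda>t. t * f t) s t = s * divided_diff f s t + f t"
proof (cases "s = t")
  case True
  then show ?thesis
    using DERIV_imp_deriv[OF DERIV_mult_id[OF assms]] by simp
next
  case False
  then show ?thesis
    by (simp add: divided_diff_def divide_simps) (simp add: algebra_simps)
qed

text \<open>Leibniz rule twice. For weights \<open>X\<close> of zero sum the form is that of
  \<open>f\<close> with weights \<open>t * X t\<close>, so positivity of the kernel of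
  \<open>f\<close> is inherited.\<close>

lemma divided_diff_mult_square:
  assumes "f differentiable (at s)"
  shows "divided_diff (\<lambda>t. t\<^sup>2 * f t) s t = s * t * divided_diff f s t + s * f s + t * f t"
proof -
  have "(\<lambda>t. t * f t) differentiable (at s)"
    using DERIV_mult_id[OF assms] real_differentiable_def by blast
  then have "divided_diff (\<lambda>t. t * (t * f t)) s t = s * divided_diff (\<lambda>t. t * f t) s t + t * f t"
    by (rule divided_diff_mult_id)
  moreover have "divided_diff (\<lambda>t. t * f t) s t = t * divided_diff f s t + f s"
    using divided_diff_mult_id[OF assms, of t] mult_divided_diff[of s t f] by (simp add: algebra_simps)
  ultimately show ?thesis
    by (simp add: power2_eq_square mult.assoc distrib_left)
qed


text \<open>Unlike in \<open>psd_on_transform\<close> no factor is allowed, since it would spoil the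
  zero sum; in exchange, terms in one variable are free.\<close>

lemma cpd_on_transform:
  assumes K': "cpd_on n S' K'" and inj: "inj_on m S" and im: "m ` S \<subseteq> S'"
    and eq: "\<And>s t. s \<in> S \<Longrightarrow> t \<in> S \<Longrightarrow> K s t = K' (m s) (m t) + \<alpha> s + \<alpha> t"
  shows "cpd_on n S K"
  unfolding cpd_on_def
proof (intro allI impI, elim conjE)
  fix T and X :: "real \<Rightarrow> real"
  assume T: "finite T" "T \<subseteq> S" "card T \<le> n" and X: "sum X T = 0"
  have injT: "inj_on m T"
    using inj T(2) by (rule inj_on_subset)
  define Y where "Y u = X (the_inv_into T m u)" for u
  have Y: "Y (m s) = X s" if "s \<in> T" for s
    using the_inv_into_f_f[OF injT that] by (simp add: Y_def)
  have "sum Y (m ` T) = 0"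
    using X by (simp add: sum.reindex[OF injT] Y)
  then have "0 \<le> (\<Sum>u\<in>m ` T. \<Sum>v\<in>m ` T. Y u * Y v * K' u v)"
    using T im card_image_le[OF T(1), of m] by (intro cpd_onD[OF K']) auto
  also have "\<dots> = (\<Sum>s\<in>T. \<Sum>t\<in>T. X s * X t * K' (m s) (m t))"
    by (simp add: sum.reindex[OF injT] Y)
  also have "\<dots> = (\<Sum>s\<in>T. \<Sum>t\<in>T. X s * X t * (K' (m s) (m t) - - \<alpha> s - - \<alpha> t + 0))"
    unfolding quadratic_form_border X by simp
  also have "\<dots> = (\<Sum>s\<in>T. \<Sum>t\<in>T. X s * X t * K s t)"
    using T(2) by (intro sum.cong refl) (auto simp: eq subset_iff)
  finally show "0 \<le> (\<Sum>s\<in>T. \<Sum>t\<in>T. X s * X t * K s t)" .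
qed

lemma psd_on_mult_square:
  assumes diff: "\<And>x. 0 < x \<Longrightarrow> f differentiable (at x)"
    and K: "psd_on n {0<..} (divided_diff f)"
  shows "cpd_on n {0<..} (divided_diff (\<lambda>t. t\<^sup>2 * f t))"
proof (rule cpd_on_transform[where m = "\<lambda>t. t" and \<alpha> = "\<lambda>t. t * f t", OF psd_on_imp_cpd_on])
  show "psd_on n {0<..} (\<lambda>s t. s * t * divided_diff f s t)"
    using K by (rule psd_on_transform[where m = "\<lambda>t. t" and c = "\<lambda>t. t"]) auto
qed (auto simp: divided_diff_mult_square diff)

lemma less_inverse_of_less_reciprocal:
  fixes t N :: real
  assumes "0 < t" "t < 1 / (\<bar>N\<bar> + 1)"
  shows "N < 1 / t"
proof -
  have "0 < \<bar>N\<bar> + 1"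
    by simp
  with assms have "(\<bar>N\<bar> + 1) * t < 1"
    by (simp add: pos_less_divide_eq mult.commute)
  then have "\<bar>N\<bar> + 1 < 1 / t"
    using assms(1) by (simp add: pos_less_divide_eq)
  then show ?thesis
    by simp
qed

lemma inversion_differentiable:
  fixes f :: "real \<Rightarrow> real"
  assumes "\<And>x. 0 < x \<Longrightarrow> f differentiable (at x)" "0 < x"
  shows "(\<lambda>t. - f (1 / t)) differentiable (at x)"
  using DERIV_shift_inverse[of f 0 x] assms
  by (intro differentiable_minus) (auto simp: real_differentiable_def)

text \<open>Passing from \<open>f\<close> to \<open>- f (1 / t)\<close> is an involution on
  functions on the half-line. Its effect on the kernel is a congruence, so it preserves positivity
  while exchanging the ends 0 and infinity.\<close>

lemma divided_diff_inversion:
  assumes diff: "\<And>x. 0 < x \<Longrightarrow> f differentiable (at x)" and "0 < s" "0 < t"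
  shows "divided_diff (\<lambda>t. - f (1 / t)) s t = 1 / s * (1 / t) * divided_diff f (1 / s) (1 / t)"
proof -
  have "(\<lambda>t. f (1 / t)) differentiable (at s)"
    using DERIV_shift_inverse[of f 0 s] assms by (auto simp: real_differentiable_def)
  then show ?thesis
    using divided_diff_shift_inverse[of f 0 s t] assms by (simp add: divided_diff_uminus)
qed

lemma inj_on_reciprocal: "inj_on (\<lambda>t. 1 / t) S" for S :: "real set"
  by (rule inj_onI) simp

lemma psd_on_inversion:
  assumes diff: "\<And>x. 0 < x \<Longrightarrow> f differentiable (at x)"
    and K: "psd_on n {0<..} (divided_diff (\<lambda>t. - f (1 / t)))"
  shows "psd_on n {0<..} (divided_diff f)"
proof (rule psd_on_transform[OF K inj_on_reciprocal, where c = "\<lambda>t. 1 / t"])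
  fix s t :: real assume "s \<in> {0<..}" "t \<in> {0<..}"
  then have st: "0 < s" "0 < t" by auto
  have "divided_diff (\<lambda>t. - f (1 / t)) (1 / s) (1 / t) = s * t * divided_diff f s t"
    using divided_diff_inversion[OF diff, of "1 / s" "1 / t"] st by simp
  then show "divided_diff f s t = 1 / s * (1 / t) * divided_diff (\<lambda>t. - f (1 / t)) (1 / s) (1 / t)"
    using st by simp
qed auto

lemma psd_on_inversion':
  assumes diff: "\<And>x. 0 < x \<Longrightarrow> f differentiable (at x)"
    and K: "psd_on n {0<..} (divided_diff f)"
  shows "psd_on n {0<..} (divided_diff (\<lambda>t. - f (1 / t)))"
proof (rule psd_on_transform[OF K inj_on_reciprocal, where c = "\<lambda>t. 1 / t"])
  fix s t :: real assume "s \<in> {0<..}" "t \<in> {0<..}"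
  then show "divided_diff (\<lambda>t. - f (1 / t)) s t = 1 / s * (1 / t) * divided_diff f (1 / s) (1 / t)"
    by (intro divided_diff_inversion diff) auto
qed auto

text \<open>On weights of zero sum the kernel of t^2 f(t) at the reciprocal nodes is the kernel of
  \<open>- f (1 / t)\<close>. The boundary conditions swap roles under inversion:
  \<open>lower\<close> here becomes the quadratic upper bound at infinity and \<open>upper\<close>
  the linear lower bound.\<close>

lemma cpd_on_mult_square_imp_psd_on:
  assumes diff: "\<And>x. 0 < x \<Longrightarrow> f differentiable (at x)"
    and K: "cpd_on (Suc n) {0<..} (divided_diff (\<lambda>t. t\<^sup>2 * f t))" and n: "1 \<le> n"
    and upper: "\<And>e d. 0 < e \<Longrightarrow> 0 < d \<Longrightarrow> \<exists>t. 0 < t \<and> t < d \<and> t * f t \<le> e"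
    and lower: "\<And>e d. 0 < e \<Longrightarrow> 0 < d \<Longrightarrow> \<exists>t. 0 < t \<and> t < d \<and> - e \<le> t\<^sup>2 * f t"
  shows "psd_on n {0<..} (divided_diff f)"
proof -
  have K': "cpd_on (Suc n) {0<..} (divided_diff (\<lambda>t. - f (1 / t)))"
  proof (rule cpd_on_transform[OF K inj_on_reciprocal, where \<alpha> = "\<lambda>t. - (1 / t * f (1 / t))"])
    fix s t :: real assume "s \<in> {0<..}" "t \<in> {0<..}"
    then have st: "0 < s" "0 < t" by auto
    show "divided_diff (\<lambda>t. - f (1 / t)) s t
       = divided_diff (\<lambda>t. t\<^sup>2 * f t) (1 / s) (1 / t) + - (1 / s * f (1 / s)) + - (1 / t * f (1 / t))"
      using st divided_diff_inversion[OF diff st] divided_diff_mult_square[OF diff, of "1 / s" "1 / t"] by simp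
  qed auto
  have "psd_on n {0<..} (divided_diff (\<lambda>t. - f (1 / t)))"
  proof (rule cpd_on_imp_psd_on[OF inversion_differentiable[OF diff] K' n])
    fix e N :: real assume e: "0 < e"
    obtain t where t: "0 < t" "t < 1 / (\<bar>N\<bar> + 1)" "- e \<le> t\<^sup>2 * f t"
      using lower[OF e, of "1 / (\<bar>N\<bar> + 1)"] by (auto simp: add_nonneg_pos)
    have "N < 1 / t"
      using less_inverse_of_less_reciprocal t(1,2) by blast
    moreover have "- f t \<le> e * (1 / t)\<^sup>2"
      using t(1,3) by (simp add: field_simps)
    ultimately show "\<exists>t>N. - f (1 / t) \<le> e * t\<^sup>2"
      by (intro exI[of _ "1 / t"]) simp
  next
    fix e N :: real assume e: "0 < e"
    obtain t where t: "0 < t" "t < 1 / (\<bar>N\<bar> + 1)" "t * f t \<le> e"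
      using upper[OF e, of "1 / (\<bar>N\<bar> + 1)"] by (auto simp: add_nonneg_pos)
    have "N < 1 / t"
      using less_inverse_of_less_reciprocal t(1,2) by blast
    moreover have "- (e * (1 / t)) \<le> - f t"
      using t(1,3) by (simp add: field_simps)
    ultimately show "\<exists>t>N. - (e * t) \<le> - f (1 / t)"
      by (intro exI[of _ "1 / t"]) simp
  qed
  then show ?thesis
    using psd_on_inversion[of f n] diff by blast
qed

text \<open>With weights \<open>X s * (s - u)\<close> the form of
  \<open>second_diff_form_nonpos\<close> has kernel \<open>(s - u)\<close> times
  \<open>divided_diff f s t - divided_diff f s u\<close>. The subtracted part is
  \<open>f s - f u\<close>, invisible to weights of zero sum, and at u = 0 the Leibniz kernel of t
  f(t) remains.\<close>

lemma psd_on_imp_cpd_on_mult_id: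
  assumes diff: "\<And>x. 0 < x \<Longrightarrow> f differentiable (at x)"
    and K: "psd_on (Suc n) {0<..} (divided_diff f)"
  shows "cpd_on n {0<..} (\<lambda>s t. - divided_diff (\<lambda>t. t * f t) s t)"
  unfolding cpd_on_def
proof (intro allI impI, elim conjE)
  fix T :: "real set" and X :: "real \<Rightarrow> real"
  assume T: "finite T" "T \<subseteq> {0<..}" "card T \<le> n" and X: "sum X T = 0"
  \<comment> \<open>\<open>\<Phi>\<close> is affine in \<open>u\<close>, so it passes to 0 although
    \<open>f\<close> may be unbounded there.\<close>
  define \<Phi> where "\<Phi> u = (\<Sum>s\<in>T. \<Sum>t\<in>T. X s * X t * ((s - u) * divided_diff f s t))" for u
  have "(\<Phi> \<longlongrightarrow> (\<Sum>s\<in>T. \<Sum>t\<in>T. X s * X t * ((s - 0) * divided_diff f s t))) (at_right 0)"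
    unfolding \<Phi>_def by (intro tendsto_intros)
  moreover have "\<forall>\<^sub>F u in at_right 0. \<Phi> u \<le> 0"
  proof (cases "T = {}")
    case True
    then show ?thesis
      by (simp add: \<Phi>_def)
  next
    case nonempty: False
    then have "Min T \<in> {0<..}"
      using Min_in[OF T(1)] T(2) by auto
    then have "\<forall>\<^sub>F u in at_right 0. u \<in> {0<..<Min T}"
      by (intro eventually_at_right_real) auto
    then show ?thesis
    proof eventually_elim
      case (elim u)
      have uT: "u < t" if "t \<in> T" for t
        using elim Min_le[OF T(1) that] by auto
      have "(\<Sum>s\<in>T. \<Sum>t\<in>T. X s * (s - u) * (X t * (t - u)) * ((divided_diff f s t - divided_diff f s u) / (t - u))) \<le> 0"
        using T elim uT by (intro second_diff_form_nonpos[OF diff K]) auto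
      \<comment> \<open>The summands \<open>- 0 + 0\<close> only give the kernel the shape of
        \<open>quadratic_form_border\<close>.\<close>
      also have "(\<Sum>s\<in>T. \<Sum>t\<in>T. X s * (s - u) * (X t * (t - u)) * ((divided_diff f s t - divided_diff f s u) / (t - u)))
        = (\<Sum>s\<in>T. \<Sum>t\<in>T. X s * X t * ((s - u) * divided_diff f s t - (f s - f u) - 0 + 0))"
      proof (intro sum.cong refl)
        fix s t assume "s \<in> T" "t \<in> T"
        then have "t - u \<noteq> 0"
          using uT by force
        moreover have "a * b * (c * d) * (k / d) = a * c * (b * k)" if "d \<noteq> 0" for a b c d k :: real
          using that by simp
        ultimately have "X s * (s - u) * (X t * (t - u)) * ((divided_diff f s t - divided_diff f s u) / (t - u))
           = X s * X t * ((s - u) * (divided_diff f s t - divided_diff f s u))"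
          by blast
        also have "(s - u) * (divided_diff f s t - divided_diff f s u) = (s - u) * divided_diff f s t - (f s - f u) - 0 + 0"
          by (simp add: right_diff_distrib mult_divided_diff)
        finally show "X s * (s - u) * (X t * (t - u)) * ((divided_diff f s t - divided_diff f s u) / (t - u))
           = X s * X t * ((s - u) * divided_diff f s t - (f s - f u) - 0 + 0)" .
      qed
      also have "\<dots> = \<Phi> u"
        unfolding quadratic_form_border X \<Phi>_def by simp
      finally show ?case .
    qed
  qed
  ultimately have "(\<Sum>s\<in>T. \<Sum>t\<in>T. X s * X t * ((s - 0) * divided_diff f s t)) \<le> 0"
    by (intro tendsto_upperbound[of \<Phi> _ "at_right 0" 0]) auto
  then have "0 \<le> (\<Sum>s\<in>T. \<Sum>t\<in>T. X s * X t * (- (s * divided_diff f s t) - 0 - 0 + 0))"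
    by (simp add: sum_negf)
  also have "\<dots> = (\<Sum>s\<in>T. \<Sum>t\<in>T. X s * X t * (- (s * divided_diff f s t) - 0 - f t + 0))"
    unfolding quadratic_form_border X by simp
  also have "\<dots> = (\<Sum>s\<in>T. \<Sum>t\<in>T. X s * X t * - divided_diff (\<lambda>t. t * f t) s t)"
    using T(2) by (intro sum.cong refl) (auto simp: divided_diff_mult_id diff subset_iff)
  finally show "0 \<le> (\<Sum>s\<in>T. \<Sum>t\<in>T. X s * X t * - divided_diff (\<lambda>t. t * f t) s t)" .
qed


lemma quadratic_form_rank_one:
  fixes c :: real
  shows "(\<Sum>s\<in>T. \<Sum>t\<in>T. c * A s * A t) = c * (sum A T)\<^sup>2"
  unfolding power2_eq_square sum_product unfolding sum_distrib_left mult.assoc ..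

text \<open>The kernel is the divided difference of -p(t)/t. For -p(t)/(t - u) with \<open>u\<close>
  below all nodes, it is a rank one kernel with coefficient \<open>p u\<close> minus the second
  divided differences at \<open>u\<close>, whose form is nonpositive; then u tends to 0.\<close>

lemma psd_on_divide_id:
  assumes diff: "\<And>x. 0 < x \<Longrightarrow> p differentiable (at x)"
    and K: "psd_on (Suc n) {0<..} (divided_diff p)"
    and nonneg: "\<And>x. 0 < x \<Longrightarrow> 0 \<le> p x"
  shows "psd_on n {0<..} (\<lambda>s t. p s / (s * t) - divided_diff p s t / t)"
  unfolding psd_on_def
proof (intro allI impI, elim conjE)
  fix T :: "real set" and X :: "real \<Rightarrow> real"
  assume T: "finite T" "T \<subseteq> {0<..}" "card T \<le> n"
  define \<Phi> where "\<Phi> u = (\<Sum>s\<in>T. \<Sum>t\<in>T. X s * X t * (p s / ((s - u) * (t - u)) - divided_diff p s t / (t - u)))" for u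
  have "(\<Phi> \<longlongrightarrow> (\<Sum>s\<in>T. \<Sum>t\<in>T. X s * X t * (p s / ((s - 0) * (t - 0)) - divided_diff p s t / (t - 0)))) (at_right 0)"
    unfolding \<Phi>_def using T(2) by (intro tendsto_intros) auto
  moreover have "\<forall>\<^sub>F u in at_right 0. 0 \<le> \<Phi> u"
  proof (cases "T = {}")
    case True
    then show ?thesis
      by (simp add: \<Phi>_def)
  next
    case nonempty: False
    then have "Min T \<in> {0<..}"
      using Min_in[OF T(1)] T(2) by auto
    then have "\<forall>\<^sub>F u in at_right 0. u \<in> {0<..<Min T}"
      by (intro eventually_at_right_real) auto
    then show ?thesis
    proof eventually_elim
      case (elim u)
      have uT: "u < t" if "t \<in> T" for t
        using elim Min_le[OF T(1) that] by auto
      have "X s * X t * (p s / ((s - u) * (t - u)) - divided_diff p s t / (t - u))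
          = p u * (X s / (s - u)) * (X t / (t - u)) - X s * X t * ((divided_diff p s t - divided_diff p s u) / (t - u))"
        if "s \<in> T" "t \<in> T" for s t
      proof -
        have "p s = p u + (s - u) * divided_diff p s u"
          by (simp add: mult_divided_diff)
        moreover have "s - u \<noteq> 0" "t - u \<noteq> 0"
          using uT that by force+
        moreover have "x * y * ((q + a * d) / (a * b) - c / b) = q * (x / a) * (y / b) - x * y * ((c - d) / b)"
          if "a \<noteq> 0" "b \<noteq> 0" for x y q a b c d :: real
          using that by (simp add: field_simps)
        ultimately show ?thesis
          by metis
      qed
      then have "\<Phi> u = (\<Sum>s\<in>T. \<Sum>t\<in>T. p u * (X s / (s - u)) * (X t / (t - u)))
          - (\<Sum>s\<in>T. \<Sum>t\<in>T. X s * X t * ((divided_diff p s t - divided_diff p s u) / (t - u)))"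
        by (simp add: \<Phi>_def sum_subtractf)
      moreover have "(\<Sum>s\<in>T. \<Sum>t\<in>T. p u * (X s / (s - u)) * (X t / (t - u))) = p u * (\<Sum>s\<in>T. X s / (s - u))\<^sup>2"
        by (rule quadratic_form_rank_one)
      moreover have "0 \<le> p u * (\<Sum>s\<in>T. X s / (s - u))\<^sup>2"
        using nonneg[of u] elim by simp
      moreover have "(\<Sum>s\<in>T. \<Sum>t\<in>T. X s * X t * ((divided_diff p s t - divided_diff p s u) / (t - u))) \<le> 0"
        using T elim uT by (intro second_diff_form_nonpos[OF diff K]) auto
      ultimately show ?case
        by linarith
    qed
  qed
  ultimately have "0 \<le> (\<Sum>s\<in>T. \<Sum>t\<in>T. X s * X t * (p s / ((s - 0) * (t - 0)) - divided_diff p s t / (t - 0)))"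
    by (intro tendsto_lowerbound[of \<Phi> _ "at_right 0" 0]) auto
  then show "0 \<le> (\<Sum>s\<in>T. \<Sum>t\<in>T. X s * X t * (p s / (s * t) - divided_diff p s t / t))"
    by simp
qed

text \<open>A first divided difference of the second divided difference at a, a is of third order
  with nodes s, t, a, a, hence the bordered kernel over \<open>(s - a) * (t - a)\<close>.\<close>

lemma divided_diff_taylor_quot:
  assumes diff: "f differentiable (at s)" and st: "s \<noteq> a" "t \<noteq> a"
  shows "divided_diff (taylor_quot f a) s t
    = (divided_diff f s t - divided_diff f s a - divided_diff f a t + deriv f a) / ((s - a) * (t - a))"
proof (cases "s = t")
  case True
  have "divided_diff (taylor_quot f a) s t = (deriv f a + deriv f s - 2 * divided_diff f a s) / (s - a)\<^sup>2"
    using DERIV_imp_deriv[OF DERIV_taylor_quot[OF diff st(1)]] True by simp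
  then show ?thesis
    using True by (simp add: divided_diff_commute[of f t a] power2_eq_square)
next
  case False
  have alg: "((c - p) / (a - s) - (c - q) / (a - t)) / (s - t) = (k - p - q + c) / ((s - a) * (t - a))"
    if "(s - t) * k = (s - a) * p - (t - a) * q" for c p q k
  proof -
    have "(c - p) / (a - s) - (c - q) / (a - t) = ((c - p) * (a - t) - (c - q) * (a - s)) / ((a - s) * (a - t))"
      using st by (simp add: diff_frac_eq)
    moreover have "(c - p) * (a - t) - (c - q) * (a - s) = (s - t) * (k - p - q + c)"
      using that by (simp add: algebra_simps)
    moreover have "(a - s) * (a - t) = (s - a) * (t - a)"
      by (simp add: algebra_simps)
    ultimately show ?thesis
      using False by simp
  qed
  have "divided_diff (taylor_quot f a) s t =
      ((deriv f a - divided_diff f s a) / (a - s) - (deriv f a - divided_diff f a t) / (a - t)) / (s - t)"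
    using False st by (simp add: divided_diff_def[of "taylor_quot f a"] taylor_quot_eq divided_diff_commute[of f s a])
  also have "\<dots> = (divided_diff f s t - divided_diff f s a - divided_diff f a t + deriv f a) / ((s - a) * (t - a))"
    by (rule alg) (simp add: mult_divided_diff divided_diff_commute[of f a t])
  finally show ?thesis .
qed

lemma mult_id_differentiable: "f differentiable (at s) \<Longrightarrow> (\<lambda>t. - (t * f t)) differentiable (at s)"
  for f :: "real \<Rightarrow> real"
  by (intro differentiable_minus) (use DERIV_mult_id real_differentiable_def in blast)

lemma divided_diff_neg_mult_id:
  "f differentiable (at s) \<Longrightarrow> divided_diff (\<lambda>t. - (t * f t)) s t = - (s * divided_diff f s t + f t)"
  using DERIV_mult_id[of f s] divided_diff_uminus[of "\<lambda>t. t * f t" s t]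
  by (auto simp: divided_diff_mult_id real_differentiable_def)

text \<open>The kernel is the divided difference of the secant slope \<open>t \<mapsto> (t f(t) - a f(a)) / (t - a)\<close>.\<close>

lemma cpd_on_mult_id_secant:
  assumes diff: "\<And>x. 0 < x \<Longrightarrow> f differentiable (at x)"
    and K: "cpd_on (Suc (Suc n)) {0<..} (divided_diff (\<lambda>t. - (t * f t)))"
    and lower: "\<And>e N. 0 < e \<Longrightarrow> \<exists>t>N. - (e * t) \<le> f t"
    and a: "0 < a"
  shows "psd_on n {a<..} (\<lambda>s t. s * divided_diff f s t / (s - a)
    - a * f t / ((s - a) * (t - a)) + a * f a / ((s - a) * (t - a)))"
proof -
  define k where "k = (\<lambda>t. - (t * f t))"
  define h where "h = taylor_quot k a"
  \<comment> \<open>In the variable 1 / (t - a) the congruence factor cancels the denominator of the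
    Taylor quotient's kernel, so the kernel of \<open>p\<close> is exactly the bordered kernel of
    \<open>k\<close>. The sign compensates for the reversal of order.\<close>
  define p where "p = (\<lambda>\<tau>. - h (a + 1 / \<tau>))"
  have diffk: "k differentiable (at x)" if "0 < x" for x
    unfolding k_def using diff[OF that] by (rule mult_id_differentiable)
  have ddk: "divided_diff k s t = - (s * divided_diff f s t + f t)" if "0 < s" for s t
    unfolding k_def using diff[OF that] by (rule divided_diff_neg_mult_id)
  have diffh: "h differentiable (at x)" if "a < x" for x
    unfolding h_def using DERIV_taylor_quot[of k x a] diffk[of x] that a by (auto simp: real_differentiable_def)
  have ddh: "divided_diff h s t = (divided_diff k s t - divided_diff k s a - divided_diff k a t + divided_diff k a a) / ((s - a) * (t - a))"
    if "a < s" "a < t" for s t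
    unfolding h_def using divided_diff_taylor_quot[of k s a t] diffk[of s] that a by simp
  have diffp: "p differentiable (at \<tau>)" if "0 < \<tau>" for \<tau>
    unfolding p_def using DERIV_shift_inverse[of h a \<tau>] diffh[of "a + 1 / \<tau>"] that
    by (intro differentiable_minus) (auto simp: real_differentiable_def)
  have ddp: "divided_diff p \<sigma> \<tau> = 1 / \<sigma> * (1 / \<tau>) * divided_diff h (a + 1 / \<sigma>) (a + 1 / \<tau>)"
    if "0 < \<sigma>" "0 < \<tau>" for \<sigma> \<tau>
  proof -
    have "(\<lambda>\<tau>. h (a + 1 / \<tau>)) differentiable (at \<sigma>)"
      using DERIV_shift_inverse[of h a \<sigma>] diffh[of "a + 1 / \<sigma>"] that by (auto simp: real_differentiable_def)
    then show ?thesis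
      unfolding p_def using divided_diff_shift_inverse[of h a \<sigma> \<tau>] diffh[of "a + 1 / \<sigma>"] that
      by (simp add: divided_diff_uminus)
  qed
  \<comment> \<open>One of the two additional points is used up by the border here, the other by
    \<open>psd_on_divide_id\<close>.\<close>
  have "psd_on (Suc n) ({0<..} - {a}) (\<lambda>s t. divided_diff k s t - divided_diff k s a - divided_diff k a t + divided_diff k a a)"
    using K a unfolding k_def by (intro cpd_on_border) auto
  then have "psd_on (Suc n) {0<..} (divided_diff p)"
  proof (rule psd_on_transform[where m = "\<lambda>\<tau>. a + 1 / \<tau>" and c = "\<lambda>_. 1"])
    fix \<sigma> \<tau> :: real assume "\<sigma> \<in> {0<..}" "\<tau> \<in> {0<..}"
    then have st: "0 < \<sigma>" "0 < \<tau>" by auto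
    then show "divided_diff p \<sigma> \<tau> = 1 * 1 * (divided_diff k (a + 1 / \<sigma>) (a + 1 / \<tau>) - divided_diff k (a + 1 / \<sigma>) a
        - divided_diff k a (a + 1 / \<tau>) + divided_diff k a a)"
      by (subst ddp[OF st], subst ddh) auto
  qed (use a in \<open>auto intro: inj_onI simp: add_pos_pos\<close>)
  moreover have "0 \<le> p \<tau>" if "0 < \<tau>" for \<tau>
  proof -
    have K2: "cpd_on 2 {0<..} (divided_diff k)"
      using K unfolding k_def by (rule cpd_on_mono) auto
    \<comment> \<open>A linear lower bound for \<open>f\<close> is a quadratic upper bound for
      \<open>k\<close>, as \<open>taylor_quot_nonpos\<close> requires.\<close>
    have "\<exists>t>N. k t \<le> e * t\<^sup>2" if e: "0 < e" for e N
    proof -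
      obtain t where t: "max N 0 < t" "- (e * t) \<le> f t"
        using lower[OF e] by blast
      then have "t * - (e * t) \<le> t * f t"
        by (intro mult_left_mono) auto
      then show ?thesis
        using t by (intro exI[of _ t]) (simp add: k_def power2_eq_square mult_ac)
    qed
    then have "h (a + 1 / \<tau>) \<le> 0"
      unfolding h_def using a that by (intro taylor_quot_nonpos[OF diffk K2]) auto
    then show ?thesis
      by (simp add: p_def)
  qed
  ultimately have P: "psd_on n {0<..} (\<lambda>\<sigma> \<tau>. p \<sigma> / (\<sigma> * \<tau>) - divided_diff p \<sigma> \<tau> / \<tau>)"
    by (intro psd_on_divide_id diffp)
  \<comment> \<open>In the variable \<open>t\<close> the function -p(\<tau>)/\<tau> is
    \<open>(t - a) * h t\<close>, the secant slope of \<open>k\<close> at \<open>a\<close> up to a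
    constant. Returning to \<open>t\<close> reverses the order once more, which turns
    \<open>k\<close> back into t f(t).\<close>
  show ?thesis
  proof (rule psd_on_transform[OF P, where m = "\<lambda>t. 1 / (t - a)" and c = "\<lambda>t. 1 / (t - a)"])
    fix s t assume "s \<in> {a<..}" "t \<in> {a<..}"
    then have st: "a < s" "a < t" by auto
    define A where "A = s - a"
    define B where "B = t - a"
    have AB: "0 < A" "0 < B" "A \<noteq> 0" "B \<noteq> 0"
      using st by (auto simp: A_def B_def)
    have "divided_diff k t a = (k t - k a) / (t - a)"
      using st by (simp add: divided_diff_def)
    also have "\<dots> = (a * f a - t * f t) / B"
      by (simp add: k_def B_def)
    finally have kat: "divided_diff k a t = (a * f a - t * f t) / B"
      by (simp add: divided_diff_commute[of k a])
    have kst: "divided_diff k s t = - (s * divided_diff f s t + f t)"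
      using st a by (intro ddk) auto
    have hs: "h s = (divided_diff k s a - deriv k a) / A"
    proof -
      have "(deriv k a - divided_diff k a s) / (a - s) = (divided_diff k a s - deriv k a) / (s - a)"
        using minus_divide_divide[of "deriv k a - divided_diff k a s" "a - s"] by simp
      then show ?thesis
        using st by (simp add: h_def A_def taylor_quot_eq divided_diff_commute[of k s a])
    qed
    have "divided_diff p (1 / A) (1 / B) = A * B * divided_diff h s t"
      using AB by (subst ddp) (auto simp: A_def B_def)
    also have "\<dots> = divided_diff k s t - divided_diff k s a - divided_diff k a t + deriv k a"
      using AB st by (simp add: ddh A_def B_def)
    finally have pst: "divided_diff p (1 / A) (1 / B) = divided_diff k s t - divided_diff k s a - divided_diff k a t + deriv k a" .
    have "1 / A * (1 / B) * (p (1 / A) / (1 / A * (1 / B)) - divided_diff p (1 / A) (1 / B) / (1 / B))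
       = p (1 / A) - divided_diff p (1 / A) (1 / B) / A"
      using AB by (simp add: right_diff_distrib)
    also have "\<dots> = - h s - divided_diff p (1 / A) (1 / B) / A"
      by (simp add: p_def A_def)
    also have "\<dots> = (divided_diff k a t - divided_diff k s t) / A"
      unfolding hs pst by (simp add: diff_divide_distrib add_divide_distrib)
    also have "\<dots> = s * divided_diff f s t / A - a * f t / (A * B) + a * f a / (A * B)"
    proof -
      have "(x - (a + B) * y) / B - - (z + y) = z - a * y / B + x / B" for x y z
        using AB by (simp add: field_simps)
      moreover have "t = a + B"
        by (simp add: B_def)
      ultimately have eq: "(a * f a - t * f t) / B - - (s * divided_diff f s t + f t) = s * divided_diff f s t - a * f t / B + a * f a / B"
        by metis
      show ?thesis
        unfolding kat kst eq by (simp add: diff_divide_distrib add_divide_distrib mult.commute)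
    qed
    finally show "s * divided_diff f s t / (s - a) - a * f t / ((s - a) * (t - a)) + a * f a / ((s - a) * (t - a))
       = 1 / (s - a) * (1 / (t - a)) * (p (1 / (s - a)) / (1 / (s - a) * (1 / (t - a)))
          - divided_diff p (1 / (s - a)) (1 / (t - a)) / (1 / (t - a)))"
      unfolding A_def B_def by (rule sym)
  qed (auto intro!: inj_onI)
qed

text \<open>As \<open>a\<close> tends to 0 the secant kernel tends to that of \<open>f\<close>,
  except for the rank one term with coefficient \<open>a * f a\<close>. This coefficient need not
  converge, but by \<open>upper\<close> it is at most \<open>e\<close> at arbitrarily small
  \<open>a\<close>.\<close>

lemma cpd_on_mult_id_imp_psd_on:
  assumes diff: "\<And>x. 0 < x \<Longrightarrow> f differentiable (at x)"
    and K: "cpd_on (Suc (Suc n)) {0<..} (divided_diff (\<lambda>t. - (t * f t)))"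
    and upper: "\<And>e d. 0 < e \<Longrightarrow> 0 < d \<Longrightarrow> \<exists>t. 0 < t \<and> t < d \<and> t * f t \<le> e"
    and lower: "\<And>e N. 0 < e \<Longrightarrow> \<exists>t>N. - (e * t) \<le> f t"
  shows "psd_on n {0<..} (divided_diff f)"
  unfolding psd_on_def
proof (intro allI impI, elim conjE)
  fix T :: "real set" and X :: "real \<Rightarrow> real"
  assume T: "finite T" "T \<subseteq> {0<..}" "card T \<le> n"
  define Q where "Q = (\<Sum>s\<in>T. \<Sum>t\<in>T. X s * X t * divided_diff f s t)"
  define \<Phi> where "\<Phi> a = (\<Sum>s\<in>T. \<Sum>t\<in>T. X s * X t * (s * divided_diff f s t / (s - a) - a * f t / ((s - a) * (t - a))))" for a
  define \<Psi> where "\<Psi> a = (\<Sum>s\<in>T. X s / (s - a))\<^sup>2" for a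
  have "0 \<le> Q"
  proof (rule ccontr)
    assume "\<not> 0 \<le> Q"
    then have Q: "Q < 0" and "T \<noteq> {}"
      by (auto simp: Q_def)
    then have "Min T \<in> {0<..}"
      using Min_in[OF T(1)] T(2) by auto
    then have small: "\<forall>\<^sub>F a in at_right 0. a \<in> {0<..<Min T}"
      by (intro eventually_at_right_real) auto
    have "(\<Phi> \<longlongrightarrow> (\<Sum>s\<in>T. \<Sum>t\<in>T. X s * X t * (s * divided_diff f s t / (s - 0) - 0 * f t / ((s - 0) * (t - 0))))) (at_right 0)"
      unfolding \<Phi>_def using T(2) by (intro tendsto_intros) auto
    also have "(\<Sum>s\<in>T. \<Sum>t\<in>T. X s * X t * (s * divided_diff f s t / (s - 0) - 0 * f t / ((s - 0) * (t - 0)))) = Q"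
      unfolding Q_def using T(2) by (intro sum.cong refl) auto
    finally have \<Phi>: "\<forall>\<^sub>F a in at_right 0. \<Phi> a < Q / 2"
      by (rule order_tendstoD) (use Q in simp)
    have "(\<Psi> \<longlongrightarrow> (\<Sum>s\<in>T. X s / (s - 0))\<^sup>2) (at_right 0)"
      unfolding \<Psi>_def using T(2) by (intro tendsto_intros) auto
    then have \<Psi>: "\<forall>\<^sub>F a in at_right 0. \<Psi> a < \<Psi> 0 + 1"
      unfolding \<Psi>_def by (rule order_tendstoD) simp
    obtain d where d: "0 < d" "\<And>a. 0 < a \<Longrightarrow> a < d \<Longrightarrow> a \<in> {0<..<Min T} \<and> \<Phi> a < Q / 2 \<and> \<Psi> a < \<Psi> 0 + 1"
      using eventually_conj[OF small eventually_conj[OF \<Phi> \<Psi>]] unfolding eventually_at_right_field by auto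
    have \<Psi>0: "0 < \<Psi> 0 + 1"
      by (simp add: \<Psi>_def add_nonneg_pos)
    \<comment> \<open>Chosen so that the rank one term stays below \<open>- Q / 2\<close>, which
      \<open>\<Phi> a < Q / 2\<close> then outweighs.\<close>
    define e where "e = - Q / (2 * (\<Psi> 0 + 1))"
    have e: "0 < e"
      unfolding e_def using Q \<Psi>0 by (intro divide_pos_pos) auto
    obtain a where a: "0 < a" "a < d" "a * f a \<le> e"
      using upper[OF e d(1)] by auto
    have aT: "T \<subseteq> {a<..}"
    proof
      fix t assume "t \<in> T"
      then show "t \<in> {a<..}"
        using d(2)[OF a(1,2)] Min_le[OF T(1), of t] by auto
    qed
    have "0 \<le> (\<Sum>s\<in>T. \<Sum>t\<in>T. X s * X t * (s * divided_diff f s t / (s - a)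
        - a * f t / ((s - a) * (t - a)) + a * f a / ((s - a) * (t - a))))"
      using T aT by (intro psd_onD[OF cpd_on_mult_id_secant[OF diff K lower a(1)]]) auto
    also have "\<dots> = \<Phi> a + (\<Sum>s\<in>T. \<Sum>t\<in>T. X s * X t * (a * f a / ((s - a) * (t - a))))"
      unfolding \<Phi>_def distrib_left sum.distrib ..
    also have "(\<Sum>s\<in>T. \<Sum>t\<in>T. X s * X t * (a * f a / ((s - a) * (t - a)))) = a * f a * \<Psi> a"
      unfolding \<Psi>_def quadratic_form_rank_one[symmetric] by (intro sum.cong refl) simp
    finally have "0 \<le> \<Phi> a + a * f a * \<Psi> a" .
    moreover have "a * f a * \<Psi> a \<le> e * \<Psi> a"
      using a(3) by (intro mult_right_mono) (simp_all add: \<Psi>_def)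
    moreover have "e * \<Psi> a \<le> e * (\<Psi> 0 + 1)"
      using d(2)[OF a(1,2)] e by (intro mult_left_mono) auto
    moreover have "e * (\<Psi> 0 + 1) = - Q / 2"
    proof -
      have "- Q / (2 * p) * p = - Q / 2" if "0 < p" for p
        using that by simp
      then show ?thesis
        unfolding e_def using \<Psi>0 by blast
    qed
    ultimately show False
      using d(2)[OF a(1,2)] by linarith
  qed
  then show "0 \<le> (\<Sum>s\<in>T. \<Sum>t\<in>T. X s * X t * divided_diff f s t)"
    by (simp add: Q_def)
qed


section \<open>Hermitian matrices\<close>

lemma mat_adjoint_carrier [simp]: "A \<in> carrier_mat n m \<Longrightarrow> mat_adjoint A \<in> carrier_mat m n"
  unfolding mat_adjoint_def by auto

lemma dim_mat_adjoint [simp]: "dim_row (mat_adjoint A) = dim_col A" "dim_col (mat_adjoint A) = dim_row A"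
  unfolding mat_adjoint_def by auto

lemma mat_adjoint_index:
  fixes A :: "complex mat"
  assumes "A \<in> carrier_mat n m" "i < m" "j < n"
  shows "mat_adjoint A $$ (i, j) = cnj (A $$ (j, i))"
  using assms by (simp add: mat_adjoint_def mat_of_rows_index conjugate_complex_def)

lemma mult_mat_index:
  assumes "A \<in> carrier_mat n m" "B \<in> carrier_mat m k" "i < n" "j < k"
  shows "(A * B) $$ (i, j) = (\<Sum>l<m. A $$ (i, l) * B $$ (l, j))"
  using assms by (simp add: scalar_prod_def atLeast0LessThan)

lemma mult_vec_index:
  assumes "A \<in> carrier_mat n m" "x \<in> carrier_vec m" "i < n"
  shows "(A *\<^sub>v x) $ i = (\<Sum>l<m. A $$ (i, l) * x $ l)"
  using assms by (simp add: scalar_prod_def atLeast0LessThan)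

lemma cscalar_prod_index:
  fixes x y :: "complex vec"
  assumes "x \<in> carrier_vec n" "y \<in> carrier_vec n"
  shows "x \<bullet>c y = (\<Sum>l<n. x $ l * cnj (y $ l))"
  using assms by (simp add: scalar_prod_def atLeast0LessThan conjugate_complex_def)

lemma mat_adjoint_mult:
  fixes A B :: "complex mat"
  assumes "A \<in> carrier_mat n m" "B \<in> carrier_mat m k"
  shows "mat_adjoint (A * B) = mat_adjoint B * mat_adjoint A"
proof (rule eq_matI)
  have AB: "A * B \<in> carrier_mat n k"
    using assms by simp
  fix i j assume "i < dim_row (mat_adjoint B * mat_adjoint A)" "j < dim_col (mat_adjoint B * mat_adjoint A)"
  then have ij: "i < k" "j < n"
    using assms mat_adjoint_carrier[OF assms(1)] mat_adjoint_carrier[OF assms(2)] by auto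
  have "mat_adjoint (A * B) $$ (i, j) = (\<Sum>l<m. cnj (A $$ (j, l)) * cnj (B $$ (l, i)))"
    using mat_adjoint_index[OF AB ij] mult_mat_index[OF assms ij(2,1)] by simp
  also have "\<dots> = (mat_adjoint B * mat_adjoint A) $$ (i, j)"
    using ij mult_mat_index[OF mat_adjoint_carrier[OF assms(2)] mat_adjoint_carrier[OF assms(1)] ij]
    by (simp add: mat_adjoint_index[OF assms(1)] mat_adjoint_index[OF assms(2)] mult.commute)
  finally show "mat_adjoint (A * B) $$ (i, j) = (mat_adjoint B * mat_adjoint A) $$ (i, j)" .
qed (use assms in auto)

lemma mat_adjoint_adjoint:
  fixes A :: "complex mat"
  assumes "A \<in> carrier_mat n m"
  shows "mat_adjoint (mat_adjoint A) = A"
  by (rule eq_matI) (use assms in \<open>auto simp: mat_adjoint_index[of _ m n] mat_adjoint_index[of _ n m]\<close>)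

lemma hermitian_index:
  assumes "hermitian_mat n A" "i < n" "j < n"
  shows "A $$ (i, j) = cnj (A $$ (j, i))"
  using assms mat_adjoint_index[of A n n i j] by (auto simp: hermitian_mat_def)

lemma hermitianI:
  assumes A: "A \<in> carrier_mat n n" and "\<And>i j. i < n \<Longrightarrow> j < n \<Longrightarrow> A $$ (i, j) = cnj (A $$ (j, i))"
  shows "hermitian_mat n A"
  unfolding hermitian_mat_def
proof (intro conjI A eq_matI)
  fix i j assume "i < dim_row A" "j < dim_col A"
  then have ij: "i < n" "j < n"
    using A by auto
  show "mat_adjoint A $$ (i, j) = A $$ (i, j)"
    using mat_adjoint_index[OF A ij] assms(2)[OF ij] by simp
qed (use A in auto)

text \<open>Orthonormal columns suffice because a left inverse of a square matrix is also a right
  inverse.\<close>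

lemma unitaryI:
  assumes "U \<in> carrier_mat n n"
    and "\<And>i j. i < n \<Longrightarrow> j < n \<Longrightarrow> (\<Sum>k<n. cnj (U $$ (k, i)) * U $$ (k, j)) = (if i = j then 1 else 0)"
  shows "unitary_mat n U"
proof -
  have "mat_adjoint U * U = 1\<^sub>m n"
  proof (rule eq_matI)
    fix i j assume "i < dim_row (1\<^sub>m n :: complex mat)" "j < dim_col (1\<^sub>m n :: complex mat)"
    then have ij: "i < n" "j < n"
      by auto
    show "(mat_adjoint U * U) $$ (i, j) = 1\<^sub>m n $$ (i, j)"
      using mult_mat_index[OF mat_adjoint_carrier[OF assms(1)] assms(1) ij] assms(2)[OF ij] ij
      by (simp add: mat_adjoint_index[OF assms(1)])
  qed (use assms(1) in auto)
  then show ?thesis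
    using assms(1) mat_mult_left_right_inverse[OF mat_adjoint_carrier[OF assms(1)] assms(1)]
    by (simp add: unitary_mat_def)
qed

lemma unitary_cols:
  assumes "unitary_mat n U" "i < n" "j < n"
  shows "(\<Sum>k<n. cnj (U $$ (k, i)) * U $$ (k, j)) = (if i = j then 1 else 0)"
proof -
  have U: "U \<in> carrier_mat n n" and "mat_adjoint U * U = 1\<^sub>m n"
    using assms by (auto simp: unitary_mat_def)
  then have "(mat_adjoint U * U) $$ (i, j) = (if i = j then 1 else 0)"
    using assms by simp
  then show ?thesis
    using mult_mat_index[OF mat_adjoint_carrier[OF U] U assms(2,3)] assms(2)
    by (simp add: mat_adjoint_index[OF U])
qed

lemma unitary_rows:
  assumes "unitary_mat n U" "i < n" "j < n"
  shows "(\<Sum>k<n. U $$ (i, k) * cnj (U $$ (j, k))) = (if i = j then 1 else 0)"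
proof -
  have U: "U \<in> carrier_mat n n" and "U * mat_adjoint U = 1\<^sub>m n"
    using assms by (auto simp: unitary_mat_def)
  then have "(U * mat_adjoint U) $$ (i, j) = (if i = j then 1 else 0)"
    using assms by simp
  then show ?thesis
    using mult_mat_index[OF U mat_adjoint_carrier[OF U] assms(2,3)] assms(3)
    by (simp add: mat_adjoint_index[OF U])
qed

lemma unitary_mult:
  assumes U: "unitary_mat n U" and V: "unitary_mat n V"
  shows "unitary_mat n (U * V)"
proof -
  have c: "U \<in> carrier_mat n n" "V \<in> carrier_mat n n"
    "mat_adjoint U \<in> carrier_mat n n" "mat_adjoint V \<in> carrier_mat n n"
    using U V by (auto simp: unitary_mat_def)
  have uv: "mat_adjoint U * U = 1\<^sub>m n" "U * mat_adjoint U = 1\<^sub>m n"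
    "mat_adjoint V * V = 1\<^sub>m n" "V * mat_adjoint V = 1\<^sub>m n"
    using U V by (auto simp: unitary_mat_def)
  have "mat_adjoint (U * V) * (U * V) = mat_adjoint V * (mat_adjoint U * U) * V"
    using c by (simp add: mat_adjoint_mult[of U n n V n] assoc_mult_mat[of _ n n _ n _ n] mult_carrier_mat[of _ n n _ n])
  moreover have "U * V * mat_adjoint (U * V) = U * (V * mat_adjoint V) * mat_adjoint U"
    using c by (simp add: mat_adjoint_mult[of U n n V n] assoc_mult_mat[of _ n n _ n _ n] mult_carrier_mat[of _ n n _ n])
  ultimately show ?thesis
    using c by (simp add: unitary_mat_def uv)
qed

lemma unitary_adjoint:
  assumes U: "unitary_mat n U"
  shows "unitary_mat n (mat_adjoint U)"
  using assms by (auto simp: unitary_mat_def mat_adjoint_adjoint)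

lemma dim_mat_diag [simp]: "dim_row (mat_diag n d) = n" "dim_col (mat_diag n d) = n"
  by (simp_all add: mat_diag_def)

lemma diag_mult_index:
  assumes "U \<in> carrier_mat n n" "i < n" "j < n"
  shows "(U * mat_diag n d) $$ (i, j) = U $$ (i, j) * d j"
  using assms by (simp add: mat_diag_mult_right[of U n n])

text \<open>The right-hand form involves no adjoint and can be verified column by column as an
  eigenvector equation.\<close>

lemma diagonalization_iff:
  assumes U: "unitary_mat n U" and A: "A \<in> carrier_mat n n"
  shows "A = U * mat_diag n d * mat_adjoint U \<longleftrightarrow> A * U = U * mat_diag n d"
proof -
  have c: "U \<in> carrier_mat n n" "mat_adjoint U \<in> carrier_mat n n" "mat_diag n d \<in> carrier_mat n n"
    and u: "mat_adjoint U * U = 1\<^sub>m n" "U * mat_adjoint U = 1\<^sub>m n"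
    using U by (auto simp: unitary_mat_def)
  show ?thesis
  proof
    assume "A = U * mat_diag n d * mat_adjoint U"
    then have "A * U = U * mat_diag n d * (mat_adjoint U * U)"
      using c by (simp add: assoc_mult_mat[of _ n n _ n _ n] mult_carrier_mat[of _ n n _ n])
    then show "A * U = U * mat_diag n d"
      using c by (simp add: u mult_carrier_mat[of _ n n _ n])
  next
    assume "A * U = U * mat_diag n d"
    then have "U * mat_diag n d * mat_adjoint U = A * (U * mat_adjoint U)"
      using c A by (metis assoc_mult_mat)
    then show "A = U * mat_diag n d * mat_adjoint U"
      using A by (simp add: u)
  qed
qed

text \<open>Gram-Schmidt on a basis that starts with \<open>v\<close> keeps \<open>v\<close> in
  front and yields orthogonal vectors that are not normalized; dividing by their lengths
  \<open>r j\<close> gives the columns, whence the factor \<open>c\<close>.\<close>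

lemma exists_unitary_first_col:
  fixes v :: "complex vec"
  assumes v: "v \<in> carrier_vec n" "v \<noteq> 0\<^sub>v n"
  shows "\<exists>U c. unitary_mat n U \<and> (\<forall>i<n. U $$ (i, 0) = c * v $ i)"
proof -
  interpret cof_vec_space n "TYPE(complex)" .
  have n: "0 < n"
    using v by (cases n) auto
  define ws where "ws = gram_schmidt n (basis_completion v)"
  note bc = basis_completion[OF v]
  have ws: "set ws \<subseteq> carrier_vec n" "corthogonal ws" "length ws = n"
    using gram_schmidt_result[OF bc(2,4,5) refl] bc(6) by (auto simp: ws_def)
  obtain vs where "basis_completion v = v # vs"
    using bc(6,7) n by (cases "basis_completion v") auto
  then have "hd ws = v"
    using gram_schmidt_hd[OF v(1), of vs] by (simp add: ws_def)
  then have ws0: "ws ! 0 = v"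
    using ws(3) n by (metis hd_conv_nth length_greater_0_conv)
  have wsc: "ws ! j \<in> carrier_vec n" if "j < n" for j
    using ws that by auto
  define r where "r j = sqrt (\<Sum>k<n. (cmod (ws ! j $ k))\<^sup>2)" for j
  have nrm: "(\<Sum>k<n. ws ! j $ k * cnj (ws ! j $ k)) = complex_of_real ((r j)\<^sup>2)" if "j < n" for j
    by (simp add: r_def sum_nonneg complex_norm_square del: of_real_power)
  have orth: "(\<Sum>k<n. ws ! i $ k * cnj (ws ! j $ k)) = 0 \<longleftrightarrow> i \<noteq> j" if "i < n" "j < n" for i j
    using corthogonalD[OF ws(2), of i j] cscalar_prod_index[OF wsc wsc] that ws(3) by simp
  have r: "r j \<noteq> 0" if "j < n" for j
    using orth[OF that that] nrm[OF that] by auto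
  define U where "U = Matrix.mat n n (\<lambda>(i, j). ws ! j $ i / complex_of_real (r j))"
  have U: "U $$ (i, j) = ws ! j $ i / complex_of_real (r j)" if "i < n" "j < n" for i j
    using that by (simp add: U_def)
  have "unitary_mat n U"
  proof (rule unitaryI)
    fix i j assume ij: "i < n" "j < n"
    have "(\<Sum>k<n. cnj (U $$ (k, i)) * U $$ (k, j)) = (\<Sum>k<n. ws ! j $ k * cnj (ws ! i $ k)) / complex_of_real (r i * r j)"
      unfolding sum_divide_distrib using ij by (intro sum.cong) (auto simp: U mult.commute)
    also have "\<dots> = (if i = j then 1 else 0)"
    proof (cases "i = j")
      case True
      then show ?thesis
        using nrm[OF ij(1)] r[OF ij(1)] by (simp add: power2_eq_square)
    next
      case False
      then show ?thesis
        using orth[OF ij(2,1)] by simp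
    qed
    finally show "(\<Sum>k<n. cnj (U $$ (k, i)) * U $$ (k, j)) = (if i = j then 1 else 0)" .
  qed (simp add: U_def)
  moreover have "\<forall>i<n. U $$ (i, 0) = 1 / complex_of_real (r 0) * v $ i"
    using n by (simp add: U ws0)
  ultimately show ?thesis
    by blast
qed

lemma hermitian_conj:
  assumes A: "hermitian_mat n A" and U: "U \<in> carrier_mat n n"
  shows "hermitian_mat n (mat_adjoint U * A * U)"
proof -
  have c: "A \<in> carrier_mat n n" "mat_adjoint U \<in> carrier_mat n n" and a: "mat_adjoint A = A"
    using A U by (auto simp: hermitian_mat_def)
  have "mat_adjoint (mat_adjoint U * A * U) = mat_adjoint U * A * U"
    using c U a
    by (simp add: mat_adjoint_mult[of _ n n _ n] mat_adjoint_adjoint mult_carrier_mat[of _ n n _ n]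
        assoc_mult_mat[of _ n n _ n _ n])
  moreover have "mat_adjoint U * A * U \<in> carrier_mat n n"
    using c U by (simp add: mult_carrier_mat[of _ n n _ n])
  ultimately show ?thesis
    by (simp only: hermitian_mat_def)
qed

text \<open>Deflation: with an eigenvector as first column of \<open>U\<close>, the first column of
  \<open>B\<close> is a multiple of the first unit vector. Hermitian symmetry clears the first row
  too and makes the eigenvalue real, so the induction hypothesis applies to the remaining block
  \<open>C\<close>.\<close>

lemma hermitian_diagonalizable:
  "hermitian_mat n A \<Longrightarrow> \<exists>U d. unitary_mat n U \<and> A = U * mat_diag n (\<lambda>i. complex_of_real (d i)) * mat_adjoint U"
proof (induction n arbitrary: A)
  case 0
  then have "A = 1\<^sub>m 0 * mat_diag 0 (\<lambda>i. complex_of_real 0) * mat_adjoint (1\<^sub>m 0)"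
    by (intro eq_matI) (auto simp: hermitian_mat_def)
  moreover have "unitary_mat 0 (1\<^sub>m 0)"
    by (rule unitaryI) auto
  ultimately show ?case
    by (intro exI[of _ "1\<^sub>m 0"] exI[of _ "\<lambda>_. 0"] conjI)
next
  case (Suc n)
  have A: "A \<in> carrier_mat (Suc n) (Suc n)"
    using Suc.prems by (simp add: hermitian_mat_def)
  obtain e v where ev: "v \<in> carrier_vec (Suc n)" "v \<noteq> 0\<^sub>v (Suc n)" "A *\<^sub>v v = e \<cdot>\<^sub>v v"
    using spectrum_non_empty[OF A] A by (auto simp: spectrum_def eigenvalue_def eigenvector_def)
  obtain U c where U: "unitary_mat (Suc n) U" and U0: "\<And>i. i < Suc n \<Longrightarrow> U $$ (i, 0) = c * v $ i"
    using exists_unitary_first_col[OF ev(1,2)] by blast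
  have Uc: "U \<in> carrier_mat (Suc n) (Suc n)" "mat_adjoint U \<in> carrier_mat (Suc n) (Suc n)"
    and Uu: "mat_adjoint U * U = 1\<^sub>m (Suc n)" "U * mat_adjoint U = 1\<^sub>m (Suc n)"
    using U by (auto simp: unitary_mat_def)
  define B where "B = mat_adjoint U * (A * U)"
  have B: "B \<in> carrier_mat (Suc n) (Suc n)"
    using Uc A by (simp add: B_def mult_carrier_mat[of _ "Suc n" "Suc n" _ "Suc n"])
  have Bherm: "hermitian_mat (Suc n) B"
    using hermitian_conj[OF Suc.prems Uc(1)] A Uc
    by (simp add: B_def assoc_mult_mat[of _ "Suc n" "Suc n" _ "Suc n" _ "Suc n"])
  have AU: "A * U = U * B"
    using Uc A Uu by (simp add: B_def assoc_mult_mat[symmetric, of _ "Suc n" "Suc n" _ "Suc n" _ "Suc n"] mult_carrier_mat[of _ "Suc n" "Suc n" _ "Suc n"])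
  have col0: "B $$ (i, 0) = (if i = 0 then e else 0)" if "i < Suc n" for i
  proof -
    have AU0: "(A * U) $$ (k, 0) = e * U $$ (k, 0)" if k: "k < Suc n" for k
    proof -
      have "(A * U) $$ (k, 0) = c * (A *\<^sub>v v) $ k"
        using mult_mat_index[OF A Uc(1) k, of 0] mult_vec_index[OF A ev(1) k]
        by (simp add: U0 sum_distrib_left mult_ac del: sum.lessThan_Suc)
      then show ?thesis
        using k ev(1) by (simp add: ev(3) U0)
    qed
    have "B $$ (i, 0) = (\<Sum>k<Suc n. cnj (U $$ (k, i)) * (e * U $$ (k, 0)))"
      unfolding B_def using mult_mat_index[OF Uc(2) mult_carrier_mat[OF A Uc(1)] that, of 0] that
      by (simp add: AU0 mat_adjoint_index[OF Uc(1)] del: sum.lessThan_Suc)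
    also have "\<dots> = e * (\<Sum>k<Suc n. cnj (U $$ (k, i)) * U $$ (k, 0))"
      by (simp add: sum_distrib_left mult_ac del: sum.lessThan_Suc)
    also have "\<dots> = (if i = 0 then e else 0)"
      using unitary_cols[OF U that, of 0] by simp
    finally show ?thesis .
  qed
  have row0: "B $$ (0, j) = (if j = 0 then e else 0)" if "j < Suc n" for j
    using hermitian_index[OF Bherm, of 0 j] hermitian_index[OF Bherm, of 0 0] col0[OF that] col0[of 0] that by auto
  have e: "complex_of_real (Re e) = e"
    using hermitian_index[OF Bherm, of 0 0] col0[of 0] by (simp add: complex_eq_iff)
  define C where "C = Matrix.mat n n (\<lambda>(i, j). B $$ (Suc i, Suc j))"
  have "hermitian_mat n C"
    by (rule hermitianI) (auto simp: C_def intro!: hermitian_index[OF Bherm])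
  from Suc.IH[OF this] obtain V d where V: "unitary_mat n V"
    and CV: "C = V * mat_diag n (\<lambda>i. complex_of_real (d i)) * mat_adjoint V"
    by blast
  have Vc: "V \<in> carrier_mat n n"
    using V by (simp add: unitary_mat_def)
  have CV: "C * V = V * mat_diag n (\<lambda>i. complex_of_real (d i))"
    using diagonalization_iff[OF V] CV by (simp add: C_def)
  have CVe: "(\<Sum>k<n. B $$ (Suc i, Suc k) * V $$ (k, j)) = V $$ (i, j) * complex_of_real (d j)" if "i < n" "j < n" for i j
    using arg_cong[OF CV, of "\<lambda>M. M $$ (i, j)"] mult_mat_index[of C n n V n i j] diag_mult_index[OF Vc that] Vc that
    by (simp add: C_def)
  \<comment> \<open>The direct sum of the 1 by 1 identity and \<open>V\<close>.\<close>
  define W where "W = Matrix.mat (Suc n) (Suc n) (\<lambda>(i, j). case i of 0 \<Rightarrow> if j = 0 then 1 else 0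
     | Suc i' \<Rightarrow> (case j of 0 \<Rightarrow> 0 | Suc j' \<Rightarrow> V $$ (i', j')))"
  have Wc: "W \<in> carrier_mat (Suc n) (Suc n)"
    by (simp add: W_def)
  have W: "W $$ (0, 0) = 1" "j < n \<Longrightarrow> W $$ (0, Suc j) = 0" "i < n \<Longrightarrow> W $$ (Suc i, 0) = 0"
    "i < n \<Longrightarrow> j < n \<Longrightarrow> W $$ (Suc i, Suc j) = V $$ (i, j)" for i j
    by (auto simp: W_def)
  have Wu: "unitary_mat (Suc n) W"
  proof (rule unitaryI[OF Wc])
    fix i j assume "i < Suc n" "j < Suc n"
    then show "(\<Sum>k<Suc n. cnj (W $$ (k, i)) * W $$ (k, j)) = (if i = j then 1 else 0)"
      unfolding sum.lessThan_Suc_shift using unitary_cols[OF V]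
      by (cases i; cases j) (auto simp: W)
  qed
  define d' where "d' j = (case j of 0 \<Rightarrow> Re e | Suc j' \<Rightarrow> d j')" for j
  have BW: "B * W = W * mat_diag (Suc n) (\<lambda>i. complex_of_real (d' i))"
  proof (rule eq_matI)
    fix i j assume "i < dim_row (W * mat_diag (Suc n) (\<lambda>i. complex_of_real (d' i)))"
      "j < dim_col (W * mat_diag (Suc n) (\<lambda>i. complex_of_real (d' i)))"
    then have ij: "i < Suc n" "j < Suc n"
      using Wc by auto
    then show "(B * W) $$ (i, j) = (W * mat_diag (Suc n) (\<lambda>i. complex_of_real (d' i))) $$ (i, j)"
      unfolding mult_mat_index[OF B Wc ij] diag_mult_index[OF Wc ij] sum.lessThan_Suc_shift
      by (cases i; cases j) (auto simp: W d'_def col0 row0 CVe e)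
  qed (use B Wc in auto)
  have Wc': "mat_adjoint W \<in> carrier_mat (Suc n) (Suc n)"
    using Wc by simp
  have "A * (U * W) = (U * W) * mat_diag (Suc n) (\<lambda>i. complex_of_real (d' i))"
  proof -
    have "A * (U * W) = (A * U) * W"
      using A Uc Wc by (simp add: assoc_mult_mat[of _ "Suc n" "Suc n" _ "Suc n" _ "Suc n"])
    also have "\<dots> = U * (B * W)"
      unfolding AU using B Uc Wc by (simp add: assoc_mult_mat[of _ "Suc n" "Suc n" _ "Suc n" _ "Suc n"])
    also have "\<dots> = (U * W) * mat_diag (Suc n) (\<lambda>i. complex_of_real (d' i))"
      unfolding BW using Uc Wc by (simp add: assoc_mult_mat[of _ "Suc n" "Suc n" _ "Suc n" _ "Suc n"])
    finally show ?thesis .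
  qed
  then show ?case
    using unitary_mult[OF U Wu] diagonalization_iff[OF unitary_mult[OF U Wu] A] by blast
qed


section \<open>Perturbation of the functional calculus\<close>

lemma unitary_entry_le_1:
  fixes R :: "nat \<Rightarrow> complex"
  assumes "(\<Sum>i<n. R i * cnj (R i)) = 1" "i < n"
  shows "cmod (R i) \<le> 1"
proof -
  have "complex_of_real (\<Sum>i<n. (cmod (R i))\<^sup>2) = 1"
    using assms(1) by (simp add: complex_norm_square del: of_real_power)
  then have s: "(\<Sum>i<n. (cmod (R i))\<^sup>2) = 1"
    using of_real_eq_1_iff by blast
  have "(cmod (R i))\<^sup>2 \<le> (\<Sum>i<n. (cmod (R i))\<^sup>2)"
    using assms(2) by (intro member_le_sum) auto
  then show ?thesis
    unfolding s by (simp add: power_le_one_iff abs_square_le_1)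
qed

text \<open>Entries of a unit vector have modulus at most 1, so their squares do not exceed their
  moduli; moduli all below 1/n would make the squares sum to less than 1.\<close>

lemma unitary_exists_large_entry:
  fixes R :: "nat \<Rightarrow> complex"
  assumes "(\<Sum>i<n. R i * cnj (R i)) = 1"
  shows "\<exists>i<n. 1 \<le> real n * cmod (R i)"
proof (rule ccontr)
  assume "\<not> ?thesis"
  then have small: "real n * cmod (R i) < 1" if "i < n" for i
    using that by (auto simp: not_le)
  have "complex_of_real (\<Sum>i<n. (cmod (R i))\<^sup>2) = 1"
    using assms(1) by (simp add: complex_norm_square del: of_real_power)
  then have s: "(\<Sum>i<n. (cmod (R i))\<^sup>2) = 1"
    using of_real_eq_1_iff by blast
  then have n: "0 < n"
    by (cases n) auto
  have "(cmod (R i))\<^sup>2 < 1 / real n" if "i < n" for i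
  proof -
    have "(cmod (R i))\<^sup>2 \<le> cmod (R i)"
      using unitary_entry_le_1[OF assms that] by (simp add: power2_eq_square mult_left_le)
    also have "\<dots> < 1 / real n"
      using small[OF that] n by (simp add: field_simps)
    finally show ?thesis .
  qed
  then have "(\<Sum>i<n. (cmod (R i))\<^sup>2) < (\<Sum>i<n. 1 / real n)"
    using n by (intro sum_strict_mono) auto
  with s n show False
    by simp
qed

text \<open>The matrices \<open>R s\<close> are the transition matrices between an eigenbasis of the unperturbed matrix,
  with eigenvalues \<open>c\<close>, and one of the perturbed matrix, with eigenvalues \<open>b s\<close>; \<open>H\<close> is the
  perturbation in the first basis. An entry \<open>R s l j\<close> can only be large if \<open>b s j\<close> is close
  to \<open>c l\<close>, so no continuity of the eigenbases is needed.\<close>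

locale perturbation =
  fixes n :: nat and R :: "real \<Rightarrow> nat \<Rightarrow> nat \<Rightarrow> complex" and b :: "real \<Rightarrow> nat \<Rightarrow> real"
    and c :: "nat \<Rightarrow> real" and H :: "nat \<Rightarrow> nat \<Rightarrow> complex"
  assumes rows: "i < n \<Longrightarrow> l < n \<Longrightarrow> (\<Sum>j<n. R s i j * cnj (R s l j)) = (if i = l then 1 else 0)"
    and cols: "j < n \<Longrightarrow> (\<Sum>i<n. R s i j * cnj (R s i j)) = 1"
    and eig: "i < n \<Longrightarrow> j < n \<Longrightarrow>
      complex_of_real (b s j - c i) * R s i j = complex_of_real s * (\<Sum>m<n. H i m * R s m j)"
    and c_pos: "i < n \<Longrightarrow> 0 < c i"
begin

text \<open>The right side of \<open>eig\<close> without the factor \<open>s\<close>. It is bounded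
  uniformly in \<open>s\<close>, so \<open>eig\<close> shows that eigenvalue distance times overlap
  is of order \<open>s\<close>.\<close>

definition M :: "real \<Rightarrow> nat \<Rightarrow> nat \<Rightarrow> complex" where
  "M s i j = (\<Sum>m<n. H i m * R s m j)"

definition K :: real where
  "K = (\<Sum>i<n. \<Sum>m<n. cmod (H i m))"

lemma R_le_1: "i < n \<Longrightarrow> j < n \<Longrightarrow> cmod (R s i j) \<le> 1"
  using unitary_entry_le_1[of "\<lambda>i. R s i j" n i] cols[of j s] by simp

lemma M_le: assumes "i < n" "j < n" shows "cmod (M s i j) \<le> K"
proof -
  have "cmod (M s i j) \<le> (\<Sum>m<n. cmod (H i m * R s m j))"
    unfolding M_def by (rule norm_sum)
  also have "\<dots> \<le> (\<Sum>m<n. cmod (H i m))"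
    using R_le_1 assms by (intro sum_mono) (simp add: norm_mult mult_left_le)
  also have "\<dots> \<le> K"
    unfolding K_def using assms by (intro member_le_sum[of i _ "\<lambda>i. \<Sum>m<n. cmod (H i m)"]) (auto intro: sum_nonneg)
  finally show ?thesis .
qed

lemma gap: assumes "i < n" "j < n" shows "\<bar>b s j - c i\<bar> * cmod (R s i j) \<le> \<bar>s\<bar> * K"
proof -
  have "\<bar>b s j - c i\<bar> * cmod (R s i j) = cmod (complex_of_real (b s j - c i) * R s i j)"
    by (simp only: norm_mult norm_of_real)
  also have "\<dots> = \<bar>s\<bar> * cmod (M s i j)"
    unfolding eig[OF assms] M_def[symmetric] by (simp only: norm_mult norm_of_real)
  also have "\<dots> \<le> \<bar>s\<bar> * K"
    using M_le[OF assms] by (intro mult_left_mono) auto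
  finally show ?thesis .
qed

text \<open>Column \<open>j\<close> of \<open>R s\<close> has an entry of modulus at least 1/n, and
  for that row \<open>gap\<close> bounds the distance of the eigenvalues.\<close>

lemma near: assumes "j < n" shows "\<exists>i<n. \<bar>b s j - c i\<bar> \<le> \<bar>s\<bar> * (real n * K)"
proof -
  obtain i where i: "i < n" "1 \<le> real n * cmod (R s i j)"
    using unitary_exists_large_entry[of "\<lambda>i. R s i j" n] cols[OF assms] by auto
  have "\<bar>b s j - c i\<bar> * 1 \<le> \<bar>b s j - c i\<bar> * (real n * cmod (R s i j))"
    using i by (intro mult_left_mono) auto
  also have "\<dots> \<le> real n * (\<bar>s\<bar> * K)"
    using mult_left_mono[OF gap[OF i(1) assms], of "real n"] by (simp add: mult_ac)
  finally show ?thesis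
    using i by (auto simp: mult_ac)
qed

lemma eventually_small: assumes "0 < e" shows "\<forall>\<^sub>F s in at 0. \<bar>s\<bar> * a < (e::real)"
proof -
  have "((\<lambda>s. \<bar>s\<bar> * a) \<longlongrightarrow> \<bar>0\<bar> * a) (at 0)"
    by (intro tendsto_intros)
  then show ?thesis
    by (rule order_tendstoD) (use assms in simp)
qed

lemma eigenvalues_compact:
  obtains r q where "0 < r" "\<forall>\<^sub>F s in at 0. \<forall>j<n. b s j \<in> {r..q}"
proof (cases "n = 0")
  case True
  then show ?thesis
    using that[of 1 1] by simp
next
  case False
  \<comment> \<open>Half the least unperturbed eigenvalue: a shift by less than \<open>r\<close>
    leaves every eigenvalue above \<open>r\<close>.\<close>
  define r where "r = Min (c ` {..<n}) / 2"
  define q where "q = Max (c ` {..<n}) + r"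
  have r: "0 < r"
  proof -
    have "Min (c ` {..<n}) \<in> c ` {..<n}"
      using False by (intro Min_in) auto
    then show ?thesis
      using c_pos by (auto simp: r_def)
  qed
  have lo: "2 * r \<le> c i" if "i < n" for i
    using that by (simp add: r_def)
  have hi: "c i \<le> q - r" if "i < n" for i
    using that by (simp add: q_def)
  have "\<forall>\<^sub>F s in at 0. \<forall>j<n. b s j \<in> {r..q}"
    using eventually_small[OF r, of "real n * K"]
  proof eventually_elim
    case (elim s)
    show ?case
    proof (intro allI impI)
      fix j assume "j < n"
      then obtain i where "i < n" "\<bar>b s j - c i\<bar> \<le> \<bar>s\<bar> * (real n * K)"
        using near by blast
      with elim lo[of i] hi[of i] show "b s j \<in> {r..q}"
        by auto
    qed
  qed
  then show ?thesis
    using that[of r q] r by blast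
qed

lemma eigenvalues_pos: "\<forall>\<^sub>F s in at 0. \<forall>j<n. 0 < b s j"
proof -
  obtain r q where "0 < r" "\<forall>\<^sub>F s in at 0. \<forall>j<n. b s j \<in> {r..q}"
    by (rule eigenvalues_compact)
  then show ?thesis
    by (auto elim!: eventually_mono)
qed

text \<open>Either \<open>b s j\<close> is close to \<open>c l\<close>, where \<open>\<phi>\<close>
  varies little, or \<open>gap\<close> makes the entry of order \<open>s\<close> while
  \<open>\<phi>\<close> stays bounded on a compact interval containing all
  \<open>b s j\<close>.\<close>

lemma concentration:
  assumes cont: "continuous_on {0<..} \<phi>" and l: "l < n" "j < n"
  shows "((\<lambda>s. (\<phi> (b s j) - \<phi> (c l)) * cmod (R s l j)) \<longlongrightarrow> (0::real)) (at 0)"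
proof (rule tendstoI)
  fix e :: real assume e: "0 < e"
  obtain r q where rq: "0 < r" "\<forall>\<^sub>F s in at 0. \<forall>j<n. b s j \<in> {r..q}"
    by (rule eigenvalues_compact)
  have "compact (\<phi> ` {r..q})"
    using rq(1) by (intro compact_continuous_image continuous_on_subset[OF cont]) auto
  then obtain B where "\<forall>y\<in>\<phi> ` {r..q}. \<bar>y\<bar> \<le> B"
    using compact_imp_bounded bounded_real by metis
  then have B: "\<bar>\<phi> x\<bar> \<le> B" if "x \<in> {r..q}" for x
    using that by blast
  define D where "D = \<bar>B\<bar> + \<bar>\<phi> (c l)\<bar>"
  have "isCont \<phi> (c l)"
    using cont c_pos[OF l(1)] by (simp add: continuous_on_eq_continuous_at)
  then obtain d where d: "0 < d" "\<And>x. \<bar>x - c l\<bar> < d \<Longrightarrow> \<bar>\<phi> x - \<phi> (c l)\<bar> < e"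
    using continuous_at_eps_delta[THEN iffD1, rule_format, of "c l" \<phi> e] e by (auto simp: dist_real_def)
  show "\<forall>\<^sub>F s in at 0. dist ((\<phi> (b s j) - \<phi> (c l)) * cmod (R s l j)) 0 < e"
    using rq(2) eventually_small[OF e, of "D * K / d"]
  proof eventually_elim
    case (elim s)
    have R1: "0 \<le> cmod (R s l j)" "cmod (R s l j) \<le> 1"
      using R_le_1 l by auto
    have "\<bar>\<phi> (b s j) - \<phi> (c l)\<bar> * cmod (R s l j) < e"
    proof (cases "\<bar>b s j - c l\<bar> < d")
      case True
      have "\<bar>\<phi> (b s j) - \<phi> (c l)\<bar> * cmod (R s l j) \<le> \<bar>\<phi> (b s j) - \<phi> (c l)\<bar>"
        using R1 by (intro mult_left_le) auto
      with d(2)[OF True] show ?thesis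
        by linarith
    next
      case False
      then have "d * cmod (R s l j) \<le> \<bar>b s j - c l\<bar> * cmod (R s l j)"
        using R1 by (intro mult_right_mono) auto
      also have "\<dots> \<le> \<bar>s\<bar> * K"
        using gap l by blast
      finally have "cmod (R s l j) \<le> \<bar>s\<bar> * K / d"
        using d by (simp add: field_simps)
      moreover have "\<bar>\<phi> (b s j) - \<phi> (c l)\<bar> \<le> D"
        using B[of "b s j"] elim(1) l(2) unfolding D_def by (intro order_trans[OF abs_triangle_ineq4] add_mono) force+
      ultimately have "\<bar>\<phi> (b s j) - \<phi> (c l)\<bar> * cmod (R s l j) \<le> D * (\<bar>s\<bar> * K / d)"
        using R1 by (intro mult_mono) (auto simp: D_def)
      also have "\<dots> < e"
        using elim(2) by (simp add: mult_ac)
      finally show ?thesis .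
    qed
    then show ?case
      by (simp add: abs_mult)
  qed
qed

text \<open>Daleckii-Krein formula, entry by entry in the unperturbed eigenbasis. By
  \<open>eig\<close> the quotient is the sum over \<open>j\<close> of \<phi>(b s j) times
  \<open>M s i j * cnj (R s l j)\<close>; by \<open>concentration\<close> \<phi>(b s j) may be
  replaced by \<phi>(c l), and the remaining sum is \<open>H i l\<close>.\<close>

lemma difference_quotient:
  assumes diff: "\<And>x. 0 < x \<Longrightarrow> f differentiable (at x)" and il: "i < n" "l < n"
  shows "((\<lambda>s. ((\<Sum>j<n. complex_of_real (f (b s j)) * R s i j * cnj (R s l j))
      - (if i = l then complex_of_real (f (c i)) else 0)) / complex_of_real s)
    \<longlongrightarrow> complex_of_real (divided_diff f (c i) (c l)) * H i l) (at 0)"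
proof -
  define \<phi> where "\<phi> = divided_diff f (c i)"
  have cont: "continuous_on {0<..} \<phi>"
    unfolding \<phi>_def using c_pos[OF il(1)]
    by (intro continuous_at_imp_continuous_on ballI isCont_divided_diff diff) auto
  have "((\<lambda>s. complex_of_real (\<phi> (b s j) - \<phi> (c l)) * cnj (R s l j) * M s i j) \<longlongrightarrow> 0) (at 0)" if j: "j < n" for j
  proof (rule lim_null_mult_left_bounded[where B = K, THEN tendsto_cong[THEN iffD1, rotated]])
    show "((\<lambda>s. complex_of_real (\<phi> (b s j) - \<phi> (c l)) * cnj (R s l j)) \<longlongrightarrow> 0) (at 0)"
    proof (rule tendsto_norm_zero_cancel)
      have "((\<lambda>s. \<bar>(\<phi> (b s j) - \<phi> (c l)) * cmod (R s l j)\<bar>) \<longlongrightarrow> 0) (at 0)"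
        using concentration[OF cont il(2) j] by (rule tendsto_rabs_zero)
      then show "((\<lambda>s. cmod (complex_of_real (\<phi> (b s j) - \<phi> (c l)) * cnj (R s l j))) \<longlongrightarrow> 0) (at 0)"
        by (simp only: norm_mult norm_of_real complex_mod_cnj abs_mult abs_norm_cancel)
    qed
    show "\<forall>\<^sub>F s in at 0. cmod (M s i j) \<le> K"
      using M_le il j by simp
  qed (simp add: mult_ac)
  then have lim: "((\<lambda>s. complex_of_real (\<phi> (c l)) * H i l + (\<Sum>j<n. complex_of_real (\<phi> (b s j) - \<phi> (c l)) * cnj (R s l j) * M s i j))
      \<longlongrightarrow> complex_of_real (\<phi> (c l)) * H i l + (\<Sum>j<n. 0)) (at 0)"
    by (intro tendsto_intros) auto
  \<comment> \<open>The rows of \<open>R s\<close> are orthonormal, so multiplying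
    \<open>M s\<close> by the adjoint of \<open>R s\<close> recovers \<open>H\<close> for every
    \<open>s\<close>.\<close>
  have MR: "(\<Sum>j<n. M s i j * cnj (R s l j)) = H i l" for s
  proof -
    have "(\<Sum>j<n. M s i j * cnj (R s l j)) = (\<Sum>j<n. \<Sum>m<n. H i m * (R s m j * cnj (R s l j)))"
      by (simp add: M_def sum_distrib_right mult.assoc)
    also have "\<dots> = (\<Sum>m<n. \<Sum>j<n. H i m * (R s m j * cnj (R s l j)))"
      by (rule sum.swap)
    also have "\<dots> = (\<Sum>m<n. H i m * (\<Sum>j<n. R s m j * cnj (R s l j)))"
      by (simp add: sum_distrib_left)
    also have "\<dots> = (\<Sum>m<n. if m = l then H i m else 0)"
      using il by (intro sum.cong refl) (simp add: rows)
    also have "\<dots> = H i l"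
      using il by simp
    finally show ?thesis .
  qed
  have "((\<Sum>j<n. complex_of_real (f (b s j)) * R s i j * cnj (R s l j))
      - (if i = l then complex_of_real (f (c i)) else 0)) / complex_of_real s
    = complex_of_real (\<phi> (c l)) * H i l + (\<Sum>j<n. complex_of_real (\<phi> (b s j) - \<phi> (c l)) * cnj (R s l j) * M s i j)"
    if s: "s \<noteq> 0" for s
  proof -
    have step: "complex_of_real (f (b s j)) * R s i j - complex_of_real (f (c i)) * R s i j
        = complex_of_real s * (complex_of_real (\<phi> (b s j)) * M s i j)" if j: "j < n" for j
    proof -
      have "f (b s j) - f (c i) = \<phi> (b s j) * (b s j - c i)"
        using mult_divided_diff[of "c i" "b s j" f] by (simp add: \<phi>_def algebra_simps)
      then have "complex_of_real (f (b s j)) * R s i j - complex_of_real (f (c i)) * R s i j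
          = complex_of_real (\<phi> (b s j)) * (complex_of_real (b s j - c i) * R s i j)"
        by (metis left_diff_distrib mult.assoc of_real_diff of_real_mult)
      then show ?thesis
        unfolding eig[OF il(1) j] M_def by simp
    qed
    have "(if i = l then complex_of_real (f (c i)) else 0) = (\<Sum>j<n. complex_of_real (f (c i)) * R s i j * cnj (R s l j))"
      using rows[OF il, of s] by (simp add: mult.assoc flip: sum_distrib_left)
    then have "(\<Sum>j<n. complex_of_real (f (b s j)) * R s i j * cnj (R s l j)) - (if i = l then complex_of_real (f (c i)) else 0)
        = (\<Sum>j<n. (complex_of_real (f (b s j)) * R s i j - complex_of_real (f (c i)) * R s i j) * cnj (R s l j))"
      by (simp add: left_diff_distrib sum_subtractf)
    also have "\<dots> = complex_of_real s * (\<Sum>j<n. complex_of_real (\<phi> (b s j)) * M s i j * cnj (R s l j))"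
      unfolding sum_distrib_left by (intro sum.cong refl) (simp add: step)
    finally have "((\<Sum>j<n. complex_of_real (f (b s j)) * R s i j * cnj (R s l j))
      - (if i = l then complex_of_real (f (c i)) else 0)) / complex_of_real s
      = (\<Sum>j<n. complex_of_real (\<phi> (b s j)) * M s i j * cnj (R s l j))"
      using s by simp
    also have "\<dots> = (\<Sum>j<n. complex_of_real (\<phi> (c l)) * (M s i j * cnj (R s l j)) + complex_of_real (\<phi> (b s j) - \<phi> (c l)) * cnj (R s l j) * M s i j)"
      by (intro sum.cong refl) (simp add: algebra_simps)
    also have "\<dots> = complex_of_real (\<phi> (c l)) * H i l + (\<Sum>j<n. complex_of_real (\<phi> (b s j) - \<phi> (c l)) * cnj (R s l j) * M s i j)"
      unfolding sum.distrib sum_distrib_left[symmetric] MR ..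
    finally show ?thesis .
  qed
  then have "\<forall>\<^sub>F s in at 0. complex_of_real (\<phi> (c l)) * H i l + (\<Sum>j<n. complex_of_real (\<phi> (b s j) - \<phi> (c l)) * cnj (R s l j) * M s i j)
     = ((\<Sum>j<n. complex_of_real (f (b s j)) * R s i j * cnj (R s l j))
      - (if i = l then complex_of_real (f (c i)) else 0)) / complex_of_real s"
    by (simp add: eventually_at_filter)
  from Lim_transform_eventually[OF lim this] show ?thesis
    by (simp add: \<phi>_def)
qed

end


section \<open>Quadratic forms and spectra of diagonalized matrices\<close>

lemma conj_diag_index:
  assumes U: "U \<in> carrier_mat n n" and "i < n" "l < n"
  shows "(U * mat_diag n d * mat_adjoint U) $$ (i, l) = (\<Sum>j<n. d j * U $$ (i, j) * cnj (U $$ (l, j)))"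
proof -
  have UD: "U * mat_diag n d \<in> carrier_mat n n"
    using U by (simp add: mult_carrier_mat[of _ n n _ n])
  show ?thesis
    unfolding mult_mat_index[OF UD mat_adjoint_carrier[OF U] assms(2,3)]
    using assms by (intro sum.cong refl)
      (simp add: diag_mult_index[OF U] mat_adjoint_index[OF U] del: index_mult_mat(1))
qed

lemma conj_diag_carrier:
  "U \<in> carrier_mat n n \<Longrightarrow> U * mat_diag n d * mat_adjoint U \<in> carrier_mat n n"
  by (simp add: mult_carrier_mat[of _ n n _ n])

lemma conj_diag_hermitian:
  assumes "U \<in> carrier_mat n n"
  shows "hermitian_mat n (U * mat_diag n (\<lambda>i. complex_of_real (d i)) * mat_adjoint U)"
  using assms by (intro hermitianI conj_diag_carrier) (auto simp: conj_diag_index mult_ac simp del: index_mult_mat(1))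

lemma quadratic_form_index:
  fixes A :: "complex mat"
  assumes "A \<in> carrier_mat n n" "x \<in> carrier_vec n"
  shows "(A *\<^sub>v x) \<bullet>c x = (\<Sum>i<n. \<Sum>l<n. A $$ (i, l) * x $ l * cnj (x $ i))"
  using cscalar_prod_index[of "A *\<^sub>v x" n x] mult_vec_index[OF assms] assms
  by (simp add: sum_distrib_right)

lemma quadratic_form_conj_diag:
  assumes U: "U \<in> carrier_mat n n" and x: "x \<in> carrier_vec n"
  shows "((U * mat_diag n (\<lambda>i. complex_of_real (d i)) * mat_adjoint U) *\<^sub>v x) \<bullet>c x
    = complex_of_real (\<Sum>j<n. d j * (cmod ((mat_adjoint U *\<^sub>v x) $ j))\<^sup>2)"
proof -
  define y where "y j = (\<Sum>l<n. cnj (U $$ (l, j)) * x $ l)" for j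
  have y: "(mat_adjoint U *\<^sub>v x) $ j = y j" if "j < n" for j
    unfolding y_def mult_vec_index[OF mat_adjoint_carrier[OF U] x that]
    using that by (intro sum.cong refl) (simp add: mat_adjoint_index[OF U])
  have "((U * mat_diag n (\<lambda>i. complex_of_real (d i)) * mat_adjoint U) *\<^sub>v x) \<bullet>c x
     = (\<Sum>i<n. \<Sum>l<n. \<Sum>j<n. complex_of_real (d j) * (cnj (U $$ (l, j)) * x $ l * (U $$ (i, j) * cnj (x $ i))))"
    unfolding quadratic_form_index[OF conj_diag_carrier[OF U] x]
    by (intro sum.cong refl) (simp add: conj_diag_index[OF U] sum_distrib_right sum_distrib_left mult_ac)
  also have "\<dots> = (\<Sum>i<n. \<Sum>j<n. \<Sum>l<n. complex_of_real (d j) * (cnj (U $$ (l, j)) * x $ l * (U $$ (i, j) * cnj (x $ i))))"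
    by (intro sum.cong refl sum.swap)
  also have "\<dots> = (\<Sum>j<n. \<Sum>i<n. \<Sum>l<n. complex_of_real (d j) * (cnj (U $$ (l, j)) * x $ l * (U $$ (i, j) * cnj (x $ i))))"
    by (rule sum.swap)
  also have "\<dots> = (\<Sum>j<n. complex_of_real (d j) * (y j * cnj (y j)))"
  proof (intro sum.cong refl)
    fix j
    have "y j * cnj (y j) = (\<Sum>l<n. \<Sum>i<n. cnj (U $$ (l, j)) * x $ l * (U $$ (i, j) * cnj (x $ i)))"
      by (simp add: y_def sum_product)
    also have "\<dots> = (\<Sum>i<n. \<Sum>l<n. cnj (U $$ (l, j)) * x $ l * (U $$ (i, j) * cnj (x $ i)))"
      by (rule sum.swap)
    finally show "(\<Sum>i<n. \<Sum>l<n. complex_of_real (d j) * (cnj (U $$ (l, j)) * x $ l * (U $$ (i, j) * cnj (x $ i))))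
      = complex_of_real (d j) * (y j * cnj (y j))"
      by (simp add: sum_distrib_left)
  qed
  also have "\<dots> = complex_of_real (\<Sum>j<n. d j * (cmod (y j))\<^sup>2)"
    by (simp add: complex_norm_square del: of_real_power)
  finally show ?thesis
    by (simp add: y)
qed

lemma unitary_adjoint_mult_vec:
  assumes U: "unitary_mat n U" and y: "y \<in> carrier_vec n"
  shows "mat_adjoint U *\<^sub>v (U *\<^sub>v y) = y"
proof -
  have c: "U \<in> carrier_mat n n" "mat_adjoint U \<in> carrier_mat n n" and u: "mat_adjoint U * U = 1\<^sub>m n"
    using U by (auto simp: unitary_mat_def)
  show ?thesis
    using assoc_mult_mat_vec[OF c(2,1) y] y by (simp add: u)
qed

lemma pos_semidef_eigenvalues:
  assumes U: "unitary_mat n U"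
    and A: "\<And>x. x \<in> carrier_vec n \<Longrightarrow>
      0 \<le> Re (((U * mat_diag n (\<lambda>i. complex_of_real (d i)) * mat_adjoint U) *\<^sub>v x) \<bullet>c x)"
    and i: "i < n"
  shows "0 \<le> d i"
proof -
  have c: "U \<in> carrier_mat n n"
    using U by (simp add: unitary_mat_def)
  define x where "x = U *\<^sub>v unit_vec n i"
  have x: "x \<in> carrier_vec n"
    using c by (simp add: x_def)
  have "mat_adjoint U *\<^sub>v x = unit_vec n i"
    unfolding x_def by (rule unitary_adjoint_mult_vec[OF U]) simp
  then have "0 \<le> (\<Sum>j<n. d j * (cmod (unit_vec n i $ j))\<^sup>2)"
    using A[OF x] unfolding quadratic_form_conj_diag[OF c x] by simp
  also have "\<dots> = (\<Sum>j<n. if j = i then d i else 0)"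
    using i by (intro sum.cong refl) simp
  also have "\<dots> = d i"
    using i by simp
  finally show ?thesis .
qed

lemma spectrum_conj_diag:
  assumes U: "unitary_mat n U"
  shows "spectrum (U * mat_diag n d * mat_adjoint U) = d ` {..<n}"
proof -
  have c: "U \<in> carrier_mat n n" "mat_adjoint U \<in> carrier_mat n n" and u: "mat_adjoint U * U = 1\<^sub>m n" "U * mat_adjoint U = 1\<^sub>m n"
    using U by (auto simp: unitary_mat_def)
  have "similar_mat_wit (U * mat_diag n d * mat_adjoint U) (mat_diag n d) U (mat_adjoint U)"
    by (rule similar_mat_witI[of _ _ n]) (use c u in \<open>auto simp: conj_diag_carrier\<close>)
  then have sim: "char_poly (U * mat_diag n d * mat_adjoint U) = char_poly (mat_diag n d)"
    by (intro char_poly_similar) (auto simp: similar_mat_def)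
  have "upper_triangular (mat_diag n d)"
    by (auto simp: mat_diag_def)
  moreover have "diag_mat (mat_diag n d) = map d [0..<n]"
    by (rule nth_equalityI) (auto simp: diag_mat_def mat_diag_def)
  ultimately have "char_poly (mat_diag n d) = (\<Prod>a\<leftarrow>map d [0..<n]. [:- a, 1:])"
    using char_poly_upper_triangular[OF mat_diag_dim] by metis
  then have "poly (char_poly (mat_diag n d)) k = 0 \<longleftrightarrow> k \<in> d ` {..<n}" for k
    by (auto simp: poly_prod_list prod_list_zero_iff image_iff)
  then show ?thesis
    unfolding spectrum_root_char_poly[OF conj_diag_carrier[OF c(1)]] sim by auto
qed

lemma mat_fun_hermitian:
  assumes "hermitian_mat n A"
  shows "hermitian_mat n (mat_fun f A)"
proof -
  obtain U d where U: "unitary_mat n U" and A: "A = U * mat_diag n (\<lambda>i. complex_of_real (d i)) * mat_adjoint U"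
    using hermitian_diagonalizable[OF assms] by blast
  show ?thesis
    unfolding mat_fun_eqI[OF U A] using U by (intro conj_diag_hermitian) (simp add: unitary_mat_def)
qed

lemma hermitian_add_smult:
  assumes "hermitian_mat n A" "hermitian_mat n B"
  shows "hermitian_mat n (A + complex_of_real s \<cdot>\<^sub>m B)"
proof (rule hermitianI)
  show "A + complex_of_real s \<cdot>\<^sub>m B \<in> carrier_mat n n"
    using assms by (simp add: hermitian_mat_def)
  fix i j assume ij: "i < n" "j < n"
  have d: "dim_row A = n" "dim_col A = n" "dim_row B = n" "dim_col B = n"
    using assms by (auto simp: hermitian_mat_def)
  show "(A + complex_of_real s \<cdot>\<^sub>m B) $$ (i, j) = cnj ((A + complex_of_real s \<cdot>\<^sub>m B) $$ (j, i))"
    using ij d hermitian_index[OF assms(1) ij] hermitian_index[OF assms(2) ij] by simp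
qed

section \<open>From matrices with indexed points to kernels\<close>

lemma quadratic_form_unitary:
  assumes V: "unitary_mat n V" and E: "E \<in> carrier_mat n n" and x: "x \<in> carrier_vec n"
  shows "(E *\<^sub>v x) \<bullet>c x = ((mat_adjoint V * E * V) *\<^sub>v (mat_adjoint V *\<^sub>v x)) \<bullet>c (mat_adjoint V *\<^sub>v x)"
proof -
  have c: "V \<in> carrier_mat n n" "mat_adjoint V \<in> carrier_mat n n" and u: "V * mat_adjoint V = 1\<^sub>m n"
    using V by (auto simp: unitary_mat_def)
  define z where "z = mat_adjoint V *\<^sub>v x"
  have z: "z \<in> carrier_vec n"
    unfolding z_def by (rule mult_mat_vec_carrier[OF c(2) x])
  have Vz: "V *\<^sub>v z = x"
    using assoc_mult_mat_vec[OF c(1,2) x] x by (simp add: z_def u)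
  have adj: "w \<bullet>c (V *\<^sub>v z) = (mat_adjoint V *\<^sub>v w) \<bullet>c z" if w: "w \<in> carrier_vec n" for w
  proof -
    have "w \<bullet>c (V *\<^sub>v z) = (\<Sum>l<n. \<Sum>k<n. w $ l * cnj (V $$ (l, k)) * cnj (z $ k))"
      using cscalar_prod_index[OF w, of "V *\<^sub>v z"] c z
      by (simp add: mult_vec_index[OF c(1) z] sum_distrib_left mult.assoc del: index_mult_mat_vec)
    also have "\<dots> = (\<Sum>k<n. \<Sum>l<n. w $ l * cnj (V $$ (l, k)) * cnj (z $ k))"
      by (rule sum.swap)
    also have "\<dots> = (mat_adjoint V *\<^sub>v w) \<bullet>c z"
      using cscalar_prod_index[OF _ z, of "mat_adjoint V *\<^sub>v w"] c w
      by (simp add: mult_vec_index[OF c(2) w] mat_adjoint_index[OF c(1)] sum_distrib_left sum_distrib_right mult_ac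
          mult_mat_vec_carrier[OF c(2) w] del: index_mult_mat_vec)
    finally show ?thesis .
  qed
  have Ex: "E *\<^sub>v x \<in> carrier_vec n"
    using E x by simp
  have "(E *\<^sub>v x) \<bullet>c x = (mat_adjoint V *\<^sub>v (E *\<^sub>v x)) \<bullet>c z"
    using adj[OF Ex] by (simp add: Vz)
  also have "mat_adjoint V *\<^sub>v (E *\<^sub>v x) = (mat_adjoint V * E * V) *\<^sub>v z"
    using c E z x by (simp add: assoc_mult_mat_vec[of _ n n _ n] mult_carrier_mat[of _ n n _ n] Vz)
  finally show ?thesis
    by (simp add: z_def)
qed

text \<open>A set of at most \<open>n\<close> points is padded to exactly \<open>n\<close> indices:
  the surplus ones sit at 1, a point of the half-line, with weight 0.\<close>

lemma sum_reindex_index: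
  assumes "finite T" "card T \<le> n"
  obtains t x where "\<And>i. i < n \<Longrightarrow> t i \<in> insert 1 T"
    "\<And>g :: real \<Rightarrow> real. (\<Sum>i<n. x i * g (t i)) = (\<Sum>s\<in>T. X s * g s)"
proof -
  obtain h where h: "bij_betw h {0..<card T} T"
    using ex_bij_betw_nat_finite[OF assms(1)] by blast
  define t where "t i = (if i < card T then h i else 1)" for i
  define x where "x i = (if i < card T then X (h i) else 0)" for i
  have "(\<Sum>i<n. x i * g (t i)) = (\<Sum>s\<in>T. X s * g s)" for g
  proof -
    have "(\<Sum>i<n. x i * g (t i)) = (\<Sum>i\<in>{0..<card T}. X (h i) * g (h i))"
      using assms(2) by (intro sum.mono_neutral_cong_right) (auto simp: x_def t_def)
    also have "\<dots> = (\<Sum>s\<in>T. X s * g s)"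
      by (rule sum.reindex_bij_betw[OF h])
    finally show ?thesis .
  qed
  moreover have "t i \<in> insert 1 T" for i
    using h by (auto simp: t_def bij_betw_def)
  ultimately show ?thesis
    using that by blast
qed

lemma quadratic_form_reindex_index:
  assumes "finite T" "card T \<le> n"
  obtains t x where "\<And>i. i < n \<Longrightarrow> t i \<in> insert 1 T" "(\<Sum>i<n. x i) = sum X T"
    "\<And>K :: real \<Rightarrow> real \<Rightarrow> real. (\<Sum>i<n. \<Sum>j<n. x i * x j * K (t i) (t j)) = (\<Sum>s\<in>T. \<Sum>r\<in>T. X s * X r * K s r)"
proof -
  obtain t x where t: "\<And>i. i < n \<Longrightarrow> t i \<in> insert 1 T"
    and x: "\<And>g :: real \<Rightarrow> real. (\<Sum>i<n. x i * g (t i)) = (\<Sum>s\<in>T. X s * g s)"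
    by (rule sum_reindex_index[OF assms, where X = X]) blast
  have "(\<Sum>i<n. x i) = sum X T"
    using x[of "\<lambda>_. 1"] by simp
  moreover have "(\<Sum>i<n. \<Sum>j<n. x i * x j * K (t i) (t j)) = (\<Sum>s\<in>T. \<Sum>r\<in>T. X s * X r * K s r)"
    for K :: "real \<Rightarrow> real \<Rightarrow> real"
  proof -
    have "(\<Sum>i<n. \<Sum>j<n. x i * x j * K (t i) (t j)) = (\<Sum>i<n. x i * (\<Sum>j<n. x j * K (t i) (t j)))"
      by (simp add: sum_distrib_left mult.assoc)
    also have "\<dots> = (\<Sum>i<n. x i * (\<Sum>r\<in>T. X r * K (t i) r))"
      by (simp only: x)
    also have "\<dots> = (\<Sum>s\<in>T. X s * (\<Sum>r\<in>T. X r * K s r))"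
      by (rule x)
    also have "\<dots> = (\<Sum>s\<in>T. \<Sum>r\<in>T. X s * X r * K s r)"
      by (simp add: sum_distrib_left mult.assoc)
    finally show ?thesis .
  qed
  ultimately show ?thesis
    using that[of t x] t by blast
qed

text \<open>Equal points are merged and their weights added. This reconciles the repeated points of
  Loewner matrices with the sets of nodes in \<open>psd_on\<close> and
  \<open>cpd_on\<close>.\<close>

lemma quadratic_form_merge:
  fixes x t :: "nat \<Rightarrow> real" and K :: "real \<Rightarrow> real \<Rightarrow> real"
  obtains X where "sum X (t ` {..<n}) = (\<Sum>i<n. x i)"
    "(\<Sum>s\<in>t ` {..<n}. \<Sum>r\<in>t ` {..<n}. X s * X r * K s r) = (\<Sum>i<n. \<Sum>j<n. x i * x j * K (t i) (t j))"
proof -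
  define X where "X s = sum x {i \<in> {..<n}. t i = s}" for s
  have X: "(\<Sum>i<n. x i * g (t i)) = (\<Sum>s\<in>t ` {..<n}. X s * g s)" for g :: "real \<Rightarrow> real"
  proof -
    have "(\<Sum>i<n. x i * g (t i)) = (\<Sum>s\<in>t ` {..<n}. sum (\<lambda>i. x i * g (t i)) {i \<in> {..<n}. t i = s})"
      by (rule sum.image_gen) simp
    also have "\<dots> = (\<Sum>s\<in>t ` {..<n}. X s * g s)"
      unfolding X_def sum_distrib_right by (intro sum.cong refl) auto
    finally show ?thesis .
  qed
  have "(\<Sum>s\<in>t ` {..<n}. \<Sum>r\<in>t ` {..<n}. X s * X r * K s r) = (\<Sum>s\<in>t ` {..<n}. X s * (\<Sum>r\<in>t ` {..<n}. X r * K s r))"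
    by (simp add: sum_distrib_left mult.assoc)
  also have "\<dots> = (\<Sum>s\<in>t ` {..<n}. X s * (\<Sum>j<n. x j * K s (t j)))"
    by (simp only: X)
  also have "\<dots> = (\<Sum>i<n. x i * (\<Sum>j<n. x j * K (t i) (t j)))"
    by (rule X[symmetric])
  also have "\<dots> = (\<Sum>i<n. \<Sum>j<n. x i * x j * K (t i) (t j))"
    by (simp add: sum_distrib_left mult.assoc)
  finally show ?thesis
    using that[of X] X[of "\<lambda>_. 1"] by simp
qed

lemma psd_on_index:
  assumes K: "psd_on n S K" and t: "\<And>i. i < n \<Longrightarrow> t i \<in> S"
  shows "0 \<le> (\<Sum>i<n. \<Sum>j<n. x i * x j * K (t i) (t j))"
proof -
  obtain X where "sum X (t ` {..<n}) = (\<Sum>i<n. x i)"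
    and X: "(\<Sum>s\<in>t ` {..<n}. \<Sum>r\<in>t ` {..<n}. X s * X r * K s r) = (\<Sum>i<n. \<Sum>j<n. x i * x j * K (t i) (t j))"
    by (rule quadratic_form_merge[where t = t and n = n and x = x and K = K])
  have "card (t ` {..<n}) \<le> n"
    using card_image_le[of "{..<n}" t] by simp
  then show ?thesis
    unfolding X[symmetric] using t by (intro psd_onD[OF K]) auto
qed

lemma cpd_on_index:
  assumes K: "cpd_on n S K" and t: "\<And>i. i < n \<Longrightarrow> t i \<in> S" and x: "(\<Sum>i<n. x i) = 0"
  shows "0 \<le> (\<Sum>i<n. \<Sum>j<n. x i * x j * K (t i) (t j))"
proof -
  obtain X where X0: "sum X (t ` {..<n}) = (\<Sum>i<n. x i)"
    and X: "(\<Sum>s\<in>t ` {..<n}. \<Sum>r\<in>t ` {..<n}. X s * X r * K s r) = (\<Sum>i<n. \<Sum>j<n. x i * x j * K (t i) (t j))"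
    by (rule quadratic_form_merge[where t = t and n = n and x = x and K = K])
  have "card (t ` {..<n}) \<le> n"
    using card_image_le[of "{..<n}" t] by simp
  then show ?thesis
    unfolding X[symmetric] using t x X0 by (intro cpd_onD[OF K]) auto
qed

text \<open>For a symmetric real kernel the mixed terms of real and imaginary parts cancel, so
  complex weights amount to two families of real ones.\<close>

lemma complex_quadratic_form:
  fixes K :: "nat \<Rightarrow> nat \<Rightarrow> real" and w :: "nat \<Rightarrow> complex"
  assumes sym: "\<And>i j. K i j = K j i"
  shows "(\<Sum>i<n. \<Sum>l<n. complex_of_real (K i l) * (w i * cnj (w l)))
    = complex_of_real ((\<Sum>i<n. \<Sum>l<n. Re (w i) * Re (w l) * K i l) + (\<Sum>i<n. \<Sum>l<n. Im (w i) * Im (w l) * K i l))"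
proof (rule complex_eqI)
  show "Re (\<Sum>i<n. \<Sum>l<n. complex_of_real (K i l) * (w i * cnj (w l))) =
    Re (complex_of_real ((\<Sum>i<n. \<Sum>l<n. Re (w i) * Re (w l) * K i l) + (\<Sum>i<n. \<Sum>l<n. Im (w i) * Im (w l) * K i l)))"
    by (simp add: Re_sum algebra_simps sum.distrib)
  have "(\<Sum>i<n. \<Sum>l<n. K i l * (Re (w i) * Im (w l))) = (\<Sum>l<n. \<Sum>i<n. K i l * (Re (w i) * Im (w l)))"
    by (rule sum.swap)
  also have "\<dots> = (\<Sum>i<n. \<Sum>l<n. K i l * (Im (w i) * Re (w l)))"
    by (intro sum.cong refl) (subst sym, simp)
  finally show "Im (\<Sum>i<n. \<Sum>l<n. complex_of_real (K i l) * (w i * cnj (w l))) =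
    Im (complex_of_real ((\<Sum>i<n. \<Sum>l<n. Re (w i) * Re (w l) * K i l) + (\<Sum>i<n. \<Sum>l<n. Im (w i) * Im (w l) * K i l)))"
    by (simp add: Im_sum right_diff_distrib sum_subtractf)
qed

lemma kernel_mat_quadratic_form:
  fixes K :: "real \<Rightarrow> real \<Rightarrow> real"
  assumes sym: "\<And>s t. K s t = K t s" and x: "x \<in> carrier_vec n"
  shows "(Matrix.mat n n (\<lambda>(i, j). complex_of_real (K (t i) (t j))) *\<^sub>v x) \<bullet>c x
    = complex_of_real ((\<Sum>i<n. \<Sum>l<n. Re (x $ i) * Re (x $ l) * K (t i) (t l)) + (\<Sum>i<n. \<Sum>l<n. Im (x $ i) * Im (x $ l) * K (t i) (t l)))"
proof -
  have "(Matrix.mat n n (\<lambda>(i, j). complex_of_real (K (t i) (t j))) *\<^sub>v x) \<bullet>c x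
    = (\<Sum>i<n. \<Sum>l<n. complex_of_real (K (t i) (t l)) * (x $ l * cnj (x $ i)))"
    using quadratic_form_index[OF _ x, of "Matrix.mat n n (\<lambda>(i, j). complex_of_real (K (t i) (t j)))"]
    by (simp add: mult.assoc)
  also have "\<dots> = (\<Sum>l<n. \<Sum>i<n. complex_of_real (K (t i) (t l)) * (x $ l * cnj (x $ i)))"
    by (rule sum.swap)
  also have "\<dots> = (\<Sum>i<n. \<Sum>l<n. complex_of_real (K (t i) (t l)) * (x $ i * cnj (x $ l)))"
    by (intro sum.cong refl) (subst sym, simp)
  finally show ?thesis
    using complex_quadratic_form[where K = "\<lambda>i j. K (t i) (t j)" and w = "\<lambda>i. x $ i" and n = n] sym by simp
qed

lemma kernel_mat_hermitian:
  assumes sym: "\<And>s t. K s t = K t s"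
  shows "hermitian_mat n (Matrix.mat n n (\<lambda>(i, j). complex_of_real (K (t i) (t j))))"
proof (rule hermitianI)
  fix i j assume "i < n" "j < n"
  then show "Matrix.mat n n (\<lambda>(i, j). complex_of_real (K (t i) (t j))) $$ (i, j)
    = cnj (Matrix.mat n n (\<lambda>(i, j). complex_of_real (K (t i) (t j))) $$ (j, i))"
    by (simp add: sym[of "t i" "t j"])
qed simp

lemma cond_pos_def_kernel_mat:
  assumes sym: "\<And>s t. K s t = K t s" and K: "cpd_on n S K" and t: "\<And>i. i < n \<Longrightarrow> t i \<in> S"
  shows "cond_pos_def n (Matrix.mat n n (\<lambda>(i, j). complex_of_real (K (t i) (t j))))"
  unfolding cond_pos_def_def
proof (intro conjI ballI impI kernel_mat_hermitian sym)
  fix x :: "complex vec" assume x: "x \<in> carrier_vec n" and "(\<Sum>i<n. x $ i) = 0"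
  then have "(\<Sum>i<n. Re (x $ i)) = 0" "(\<Sum>i<n. Im (x $ i)) = 0"
    by (metis Re_sum Im_sum zero_complex.sel)+
  from cpd_on_index[where t = t, OF K t this(1)] cpd_on_index[where t = t, OF K t this(2)]
  show "0 \<le> (Matrix.mat n n (\<lambda>(i, j). complex_of_real (K (t i) (t j))) *\<^sub>v x) \<bullet>c x"
    by (subst kernel_mat_quadratic_form[where K = K, OF sym x]) (simp add: less_eq_complex_def)
qed

lemma cpd_on_kernel_mat:
  assumes sym: "\<And>s t. K s t = K t s"
    and K: "\<And>t. (\<And>i. i < n \<Longrightarrow> 0 < t i) \<Longrightarrow> cond_pos_def n (Matrix.mat n n (\<lambda>(i, j). complex_of_real (K (t i) (t j))))"
  shows "cpd_on n {0<..} K"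
  unfolding cpd_on_def
proof (intro allI impI, elim conjE)
  fix T :: "real set" and X :: "real \<Rightarrow> real"
  assume T: "finite T" "T \<subseteq> {0<..}" "card T \<le> n" and X: "sum X T = 0"
  obtain t x where t: "\<And>i. i < n \<Longrightarrow> t i \<in> insert 1 T" and x: "(\<Sum>i<n. x i) = sum X T"
    and tx: "(\<Sum>i<n. \<Sum>j<n. x i * x j * K (t i) (t j)) = (\<Sum>s\<in>T. \<Sum>r\<in>T. X s * X r * K s r)"
    by (rule quadratic_form_reindex_index[OF T(1,3), where X = X]) blast
  have "0 < t i" if "i < n" for i
    using t[OF that] T(2) by auto
  from K[OF this] have cpd: "cond_pos_def n (Matrix.mat n n (\<lambda>(i, j). complex_of_real (K (t i) (t j))))" .
  define v where "v = Matrix.vec n (\<lambda>i. complex_of_real (x i))"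
  have v: "v \<in> carrier_vec n" "(\<Sum>i<n. v $ i) = 0"
    using x X by (simp_all add: v_def flip: of_real_sum)
  then have "0 \<le> (Matrix.mat n n (\<lambda>(i, j). complex_of_real (K (t i) (t j))) *\<^sub>v v) \<bullet>c v"
    using cpd by (simp add: cond_pos_def_def)
  then show "0 \<le> (\<Sum>s\<in>T. \<Sum>r\<in>T. X s * X r * K s r)"
    by (subst (asm) kernel_mat_quadratic_form[where K = K, OF sym v(1)]) (simp add: less_eq_complex_def v_def tx)
qed


section \<open>Derivative of the functional calculus\<close>

lemma unitary_one: "unitary_mat n (1\<^sub>m n)"
  by (rule unitaryI) (auto simp: if_distrib cong: if_cong)

lemma mat_adjoint_one: "mat_adjoint (1\<^sub>m n) = (1\<^sub>m n :: complex mat)"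
  using unitary_one[of n] right_mult_one_mat[OF mat_adjoint_carrier[of "1\<^sub>m n :: complex mat" n n]]
  by (simp add: unitary_mat_def)

lemma conj_diag_conj:
  assumes V: "unitary_mat n V" and W: "W \<in> carrier_mat n n"
  shows "mat_adjoint V * (W * mat_diag n d * mat_adjoint W) * V
    = (mat_adjoint V * W) * mat_diag n d * mat_adjoint (mat_adjoint V * W)"
proof -
  have c: "V \<in> carrier_mat n n" "mat_adjoint V \<in> carrier_mat n n" "mat_adjoint W \<in> carrier_mat n n"
    using V W by (auto simp: unitary_mat_def)
  show ?thesis
    using c W by (simp add: mat_adjoint_mult[of _ n n _ n] mat_adjoint_adjoint mult_carrier_mat[of _ n n _ n]
        assoc_mult_mat[of _ n n _ n _ n])
qed

text \<open>Multiplying the eigenvector equation of the perturbed matrix by the adjoint of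
  \<open>V\<close> expresses it through the transition matrix and the perturbation in the basis
  \<open>V\<close>; its entries are the equation \<open>eig\<close>.\<close>

lemma perturbation_of_matrices:
  assumes V: "unitary_mat n V" and C: "C = V * mat_diag n (\<lambda>i. complex_of_real (c i)) * mat_adjoint V"
    and c: "\<And>i. i < n \<Longrightarrow> 0 < c i" and H: "H \<in> carrier_mat n n"
    and W: "\<And>s. unitary_mat n (W s)"
    and CW: "\<And>s. C + complex_of_real s \<cdot>\<^sub>m H = W s * mat_diag n (\<lambda>i. complex_of_real (b s i)) * mat_adjoint (W s)"
  shows "perturbation n (\<lambda>s i j. (mat_adjoint V * W s) $$ (i, j)) b c (\<lambda>i j. (mat_adjoint V * H * V) $$ (i, j))"
proof
  have R: "unitary_mat n (mat_adjoint V * W s)" for s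
    by (rule unitary_mult[OF unitary_adjoint[OF V] W])
  show "(\<Sum>j<n. (mat_adjoint V * W s) $$ (i, j) * cnj ((mat_adjoint V * W s) $$ (l, j))) = (if i = l then 1 else 0)"
    if "i < n" "l < n" for s i l
    by (rule unitary_rows[OF R that])
  show "(\<Sum>i<n. (mat_adjoint V * W s) $$ (i, j) * cnj ((mat_adjoint V * W s) $$ (i, j))) = 1" if "j < n" for s j
    using unitary_cols[OF R that that] by (simp add: mult.commute)
  show "0 < c i" if "i < n" for i
    using c that .
  fix s i j assume ij: "i < n" "j < n"
  have cs: "V \<in> carrier_mat n n" "mat_adjoint V \<in> carrier_mat n n" "W s \<in> carrier_mat n n"
    and Vu: "mat_adjoint V * V = 1\<^sub>m n" "V * mat_adjoint V = 1\<^sub>m n"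
    using V W[of s] by (auto simp: unitary_mat_def)
  have Cc: "C \<in> carrier_mat n n"
    unfolding C by (rule conj_diag_carrier[OF cs(1)])
  define R where "R = mat_adjoint V * W s"
  have Rc: "R \<in> carrier_mat n n"
    using cs by (simp add: R_def mult_carrier_mat[of _ n n _ n])
  define D where "D = mat_diag n (\<lambda>i. complex_of_real (c i))"
  define H' where "H' = mat_adjoint V * H * V"
  have H'c: "H' \<in> carrier_mat n n" and Dc: "D \<in> carrier_mat n n"
    using cs H by (auto simp: H'_def D_def mult_carrier_mat[of _ n n _ n])
  have CH: "C + complex_of_real s \<cdot>\<^sub>m H \<in> carrier_mat n n"
    using Cc H by simp
  have "(C + complex_of_real s \<cdot>\<^sub>m H) * W s = W s * mat_diag n (\<lambda>i. complex_of_real (b s i))"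
    using diagonalization_iff[OF W CH] CW by blast
  then have "mat_adjoint V * ((C + complex_of_real s \<cdot>\<^sub>m H) * W s) = R * mat_diag n (\<lambda>i. complex_of_real (b s i))"
    using cs by (simp add: R_def assoc_mult_mat[of _ n n _ n _ n])
  moreover have "mat_adjoint V * ((C + complex_of_real s \<cdot>\<^sub>m H) * W s) = D * R + complex_of_real s \<cdot>\<^sub>m (H' * R)"
  proof -
    have "mat_adjoint V * ((C + complex_of_real s \<cdot>\<^sub>m H) * W s)
      = mat_adjoint V * (C * W s) + complex_of_real s \<cdot>\<^sub>m (mat_adjoint V * (H * W s))"
      using cs Cc H
      by (simp add: add_mult_distrib_mat[of _ n n] mult_add_distrib_mat[of _ n n _ n] mult_carrier_mat[of _ n n _ n]
          mult_smult_distrib[of _ n n _ n] mult_smult_assoc_mat[of _ n n _ n])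
    also have "mat_adjoint V * (C * W s) = mat_adjoint V * V * (D * R)"
      using cs Dc unfolding C D_def[symmetric] R_def
      by (simp add: assoc_mult_mat[of _ n n _ n _ n] mult_carrier_mat[of _ n n _ n])
    also have "\<dots> = D * R"
      using Dc Rc by (simp add: Vu mult_carrier_mat[of _ n n _ n])
    also have "mat_adjoint V * (H * W s) = mat_adjoint V * (H * (V * mat_adjoint V * W s))"
      using cs by (simp add: Vu)
    also have "\<dots> = H' * R"
      using cs H by (simp add: H'_def R_def assoc_mult_mat[of _ n n _ n _ n] mult_carrier_mat[of _ n n _ n])
    finally show ?thesis .
  qed
  ultimately have eq: "R * mat_diag n (\<lambda>i. complex_of_real (b s i)) = D * R + complex_of_real s \<cdot>\<^sub>m (H' * R)"
    by simp
  have DR: "(D * R) $$ (i, j) = complex_of_real (c i) * R $$ (i, j)"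
    using ij Rc by (simp add: D_def mat_diag_mult_left[of R n n])
  have HRc: "H' * R \<in> carrier_mat n n" and DRc: "D * R \<in> carrier_mat n n"
    using H'c Rc Dc by (auto simp: mult_carrier_mat[of _ n n _ n])
  have "R $$ (i, j) * complex_of_real (b s j) = (D * R + complex_of_real s \<cdot>\<^sub>m (H' * R)) $$ (i, j)"
    using eq diag_mult_index[OF Rc ij] by metis
  also have "\<dots> = (D * R) $$ (i, j) + complex_of_real s * (H' * R) $$ (i, j)"
    using ij carrier_matD[OF HRc] carrier_matD[OF DRc] by (simp del: index_mult_mat(1))
  finally have "R $$ (i, j) * complex_of_real (b s j) = complex_of_real (c i) * R $$ (i, j) + complex_of_real s * (\<Sum>m<n. H' $$ (i, m) * R $$ (m, j))"
    unfolding DR mult_mat_index[OF H'c Rc ij] .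
  then show "complex_of_real (b s j - c i) * (mat_adjoint V * W s) $$ (i, j)
    = complex_of_real s * (\<Sum>m<n. (mat_adjoint V * H * V) $$ (i, m) * (mat_adjoint V * W s) $$ (m, j))"
    unfolding R_def[symmetric] H'_def[symmetric] by (simp add: algebra_simps)
qed

text \<open>The derivative is the form of the Schur product of the divided difference matrix with
  \<open>H\<close>, taken in an eigenbasis of \<open>C\<close>. The eigenbases of the perturbed
  matrices are chosen separately for each \<open>s\<close>, with no regularity in
  \<open>s\<close>.\<close>

lemma mat_fun_perturbation:
  assumes diff: "\<And>x. 0 < x \<Longrightarrow> f differentiable (at x)"
    and V: "unitary_mat n V" and C: "C = V * mat_diag n (\<lambda>i. complex_of_real (c i)) * mat_adjoint V"
    and c: "\<And>i. i < n \<Longrightarrow> 0 < c i" and H: "hermitian_mat n H" and x: "x \<in> carrier_vec n"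
  shows "\<forall>\<^sub>F s in at 0. spectrum (C + complex_of_real s \<cdot>\<^sub>m H) \<subseteq> complex_of_real ` {0<..}"
    and "((\<lambda>s. ((mat_fun f (C + complex_of_real s \<cdot>\<^sub>m H) *\<^sub>v x) \<bullet>c x - (mat_fun f C *\<^sub>v x) \<bullet>c x) / complex_of_real s)
      \<longlongrightarrow> (\<Sum>i<n. \<Sum>l<n. complex_of_real (divided_diff f (c i) (c l)) * (mat_adjoint V * H * V) $$ (i, l)
          * (mat_adjoint V *\<^sub>v x) $ l * cnj ((mat_adjoint V *\<^sub>v x) $ i))) (at 0)"
proof -
  have Vc: "V \<in> carrier_mat n n" "mat_adjoint V \<in> carrier_mat n n" and Vu: "mat_adjoint V * V = 1\<^sub>m n"
    using V by (auto simp: unitary_mat_def)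
  have Hc: "H \<in> carrier_mat n n"
    using H by (simp add: hermitian_mat_def)
  have "hermitian_mat n C"
    unfolding C by (rule conj_diag_hermitian[OF Vc(1)])
  then have "\<forall>s. \<exists>U d. unitary_mat n U \<and> C + complex_of_real s \<cdot>\<^sub>m H = U * mat_diag n (\<lambda>i. complex_of_real (d i)) * mat_adjoint U"
    using hermitian_diagonalizable hermitian_add_smult H by blast
  then obtain W where "\<forall>s. \<exists>d. unitary_mat n (W s) \<and> C + complex_of_real s \<cdot>\<^sub>m H = W s * mat_diag n (\<lambda>i. complex_of_real (d i)) * mat_adjoint (W s)"
    using choice by metis
  then obtain b where Wb: "\<forall>s. unitary_mat n (W s) \<and> C + complex_of_real s \<cdot>\<^sub>m H = W s * mat_diag n (\<lambda>i. complex_of_real (b s i)) * mat_adjoint (W s)"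
    using choice[of "\<lambda>s d. unitary_mat n (W s) \<and> C + complex_of_real s \<cdot>\<^sub>m H = W s * mat_diag n (\<lambda>i. complex_of_real (d i)) * mat_adjoint (W s)"]
    by blast
  then have W: "unitary_mat n (W s)" and CW: "C + complex_of_real s \<cdot>\<^sub>m H = W s * mat_diag n (\<lambda>i. complex_of_real (b s i)) * mat_adjoint (W s)" for s
    by auto
  have Wc: "W s \<in> carrier_mat n n" for s
    using W by (simp add: unitary_mat_def)
  interpret perturbation n "\<lambda>s i j. (mat_adjoint V * W s) $$ (i, j)" b c "\<lambda>i j. (mat_adjoint V * H * V) $$ (i, j)"
    by (rule perturbation_of_matrices[OF V C c Hc W CW])
  show "\<forall>\<^sub>F s in at 0. spectrum (C + complex_of_real s \<cdot>\<^sub>m H) \<subseteq> complex_of_real ` {0<..}"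
    using eigenvalues_pos
  proof eventually_elim
    case (elim s)
    then show ?case
      unfolding CW spectrum_conj_diag[OF W] by auto
  qed
  define z where "z = mat_adjoint V *\<^sub>v x"
  have z: "z \<in> carrier_vec n"
    unfolding z_def by (rule mult_mat_vec_carrier[OF Vc(2) x])
  define E where "E s i l = (\<Sum>j<n. complex_of_real (f (b s j)) * (mat_adjoint V * W s) $$ (i, j) * cnj ((mat_adjoint V * W s) $$ (l, j)))" for s i l
  define E0 where "E0 i l = (if i = l then complex_of_real (f (c i)) else 0)" for i l :: nat
  have q: "(mat_fun f (C + complex_of_real s \<cdot>\<^sub>m H) *\<^sub>v x) \<bullet>c x = (\<Sum>i<n. \<Sum>l<n. E s i l * z $ l * cnj (z $ i))" for s
  proof -
    let ?D = "mat_diag n (\<lambda>i. complex_of_real (f (b s i)))"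
    have Rc: "mat_adjoint V * W s \<in> carrier_mat n n"
      using Vc Wc[of s] by (simp add: mult_carrier_mat[of _ n n _ n])
    have "(mat_fun f (C + complex_of_real s \<cdot>\<^sub>m H) *\<^sub>v x) \<bullet>c x
      = (((mat_adjoint V * W s) * ?D * mat_adjoint (mat_adjoint V * W s)) *\<^sub>v z) \<bullet>c z"
      unfolding mat_fun_eqI[OF W CW] z_def
      unfolding quadratic_form_unitary[OF V conj_diag_carrier[OF Wc] x] conj_diag_conj[OF V Wc] ..
    also have "\<dots> = (\<Sum>i<n. \<Sum>l<n. E s i l * z $ l * cnj (z $ i))"
      unfolding quadratic_form_index[OF conj_diag_carrier[OF Rc] z] E_def
      by (intro sum.cong refl) (simp add: conj_diag_index[OF Rc] del: index_mult_mat(1))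
    finally show ?thesis .
  qed
  have q0: "(mat_fun f C *\<^sub>v x) \<bullet>c x = (\<Sum>i<n. \<Sum>l<n. E0 i l * z $ l * cnj (z $ i))"
  proof -
    let ?D = "mat_diag n (\<lambda>i. complex_of_real (f (c i)))"
    have "mat_adjoint V * (V * ?D * mat_adjoint V) * V = ?D"
      unfolding conj_diag_conj[OF V Vc(1)] Vu by (simp add: mat_adjoint_one)
    then have "(mat_fun f C *\<^sub>v x) \<bullet>c x = (?D *\<^sub>v z) \<bullet>c z"
      unfolding mat_fun_eqI[OF V C] z_def
      using quadratic_form_unitary[OF V conj_diag_carrier[OF Vc(1)] x] by metis
    also have "\<dots> = (\<Sum>i<n. \<Sum>l<n. E0 i l * z $ l * cnj (z $ i))"
      unfolding quadratic_form_index[OF mat_diag_dim z] E0_def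
      by (intro sum.cong refl) (simp add: mat_diag_def)
    finally show ?thesis .
  qed
  have "((\<lambda>s. \<Sum>i<n. \<Sum>l<n. (E s i l - E0 i l) / complex_of_real s * z $ l * cnj (z $ i))
      \<longlongrightarrow> (\<Sum>i<n. \<Sum>l<n. complex_of_real (divided_diff f (c i) (c l)) * (mat_adjoint V * H * V) $$ (i, l) * z $ l * cnj (z $ i))) (at 0)"
    unfolding E_def E0_def by (intro tendsto_sum tendsto_mult_right difference_quotient diff) auto
  moreover have "(\<Sum>i<n. \<Sum>l<n. (E s i l - E0 i l) / complex_of_real s * z $ l * cnj (z $ i))
     = ((mat_fun f (C + complex_of_real s \<cdot>\<^sub>m H) *\<^sub>v x) \<bullet>c x - (mat_fun f C *\<^sub>v x) \<bullet>c x) / complex_of_real s" for s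
    unfolding q q0 by (simp add: sum_subtractf[symmetric] sum_divide_distrib left_diff_distrib diff_divide_distrib)
  ultimately show "((\<lambda>s. ((mat_fun f (C + complex_of_real s \<cdot>\<^sub>m H) *\<^sub>v x) \<bullet>c x - (mat_fun f C *\<^sub>v x) \<bullet>c x) / complex_of_real s)
      \<longlongrightarrow> (\<Sum>i<n. \<Sum>l<n. complex_of_real (divided_diff f (c i) (c l)) * (mat_adjoint V * H * V) $$ (i, l)
          * (mat_adjoint V *\<^sub>v x) $ l * cnj ((mat_adjoint V *\<^sub>v x) $ i))) (at 0)"
    by (simp add: z_def)
qed

lemma quadratic_form_diff:
  fixes A B :: "complex mat"
  assumes "A \<in> carrier_mat n n" "B \<in> carrier_mat n n" "x \<in> carrier_vec n"
  shows "((A - B) *\<^sub>v x) \<bullet>c x = (A *\<^sub>v x) \<bullet>c x - (B *\<^sub>v x) \<bullet>c x"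
proof -
  have "A - B \<in> carrier_mat n n"
    using assms(2) by (rule minus_carrier_mat)
  from quadratic_form_index[OF this assms(3)] show ?thesis
    using assms by (simp add: quadratic_form_index[of _ n] left_diff_distrib sum_subtractf)
qed

lemma quadratic_form_add_smult:
  fixes A B :: "complex mat"
  assumes "A \<in> carrier_mat n n" "B \<in> carrier_mat n n" "x \<in> carrier_vec n"
  shows "((A + k \<cdot>\<^sub>m B) *\<^sub>v x) \<bullet>c x = (A *\<^sub>v x) \<bullet>c x + k * ((B *\<^sub>v x) \<bullet>c x)"
proof -
  have "A + k \<cdot>\<^sub>m B \<in> carrier_mat n n"
    using assms by simp
  from quadratic_form_index[OF this assms(3)] show ?thesis
    using assms by (simp add: quadratic_form_index[of _ n] distrib_right sum.distrib sum_distrib_left mult.assoc)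
qed

text \<open>At the diagonal matrix of the points \<open>t i\<close>, the derivative in the direction
  of the all-ones matrix is the Loewner form, because the Schur product with that matrix changes
  nothing. The all-ones matrix is positive semidefinite, so monotonicity gives the sign.\<close>

lemma matrix_monotone_imp_psd_on:
  assumes diff: "\<And>x. 0 < x \<Longrightarrow> f differentiable (at x)"
    and f: "matrix_monotone n f {0<..}"
  shows "psd_on n {0<..} (divided_diff f)"
  unfolding psd_on_def
proof (intro allI impI, elim conjE)
  fix T :: "real set" and X :: "real \<Rightarrow> real"
  assume T: "finite T" "T \<subseteq> {0<..}" "card T \<le> n"
  obtain t x where t: "\<And>i. i < n \<Longrightarrow> t i \<in> insert 1 T" and "(\<Sum>i<n. x i) = sum X T"
    and tx: "\<And>K. (\<Sum>i<n. \<Sum>j<n. x i * x j * K (t i) (t j)) = (\<Sum>s\<in>T. \<Sum>r\<in>T. X s * X r * K s r)"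
    by (rule quadratic_form_reindex_index[OF T(1,3), where X = X]) blast
  have tpos: "0 < t i" if "i < n" for i
    using t[OF that] T(2) by auto
  \<comment> \<open>The identity serves as diagonalizing unitary, the form that
    \<open>mat_fun_perturbation\<close> expects.\<close>
  define C where "C = 1\<^sub>m n * mat_diag n (\<lambda>i. complex_of_real (t i)) * mat_adjoint (1\<^sub>m n)"
  define H where "H = Matrix.mat n n (\<lambda>_. 1 :: complex)"
  define v where "v = Matrix.vec n (\<lambda>i. complex_of_real (x i))"
  have v: "v \<in> carrier_vec n"
    by (simp add: v_def)
  have Hh: "hermitian_mat n H" and Hc: "H \<in> carrier_mat n n"
    by (auto simp: H_def intro!: hermitianI)
  have Cc: "C \<in> carrier_mat n n" and Ch: "hermitian_mat n C"
    unfolding C_def by (rule conj_diag_carrier conj_diag_hermitian; simp)+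
  have specC: "spectrum C \<subseteq> complex_of_real ` {0<..}"
    unfolding C_def spectrum_conj_diag[OF unitary_one] using tpos by auto
  have Hpos: "0 \<le> (H *\<^sub>v y) \<bullet>c y" if y: "y \<in> carrier_vec n" for y
  proof -
    have "(H *\<^sub>v y) \<bullet>c y = (\<Sum>i<n. \<Sum>l<n. y $ l * cnj (y $ i))"
      using quadratic_form_index[OF Hc y] by (simp add: H_def)
    also have "\<dots> = (\<Sum>l<n. y $ l) * cnj (\<Sum>i<n. y $ i)"
      by (subst sum.swap) (simp add: sum_product)
    also have "\<dots> = complex_of_real ((cmod (\<Sum>l<n. y $ l))\<^sup>2)"
      by (rule complex_norm_square[symmetric])
    finally show ?thesis
      by (simp add: less_eq_complex_def)
  qed
  note lim = mat_fun_perturbation[OF diff unitary_one C_def tpos Hh v]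
  \<comment> \<open>Only s > 0 yields an increase of the matrix, hence the restriction to right-hand
    limits.\<close>
  have ev: "\<forall>\<^sub>F s in at_right 0. spectrum (C + complex_of_real s \<cdot>\<^sub>m H) \<subseteq> complex_of_real ` {0<..}"
    by (rule filter_leD[OF at_le lim(1)]) auto
  have lim2: "((\<lambda>s. Re (((mat_fun f (C + complex_of_real s \<cdot>\<^sub>m H) *\<^sub>v v) \<bullet>c v - (mat_fun f C *\<^sub>v v) \<bullet>c v) / complex_of_real s))
      \<longlongrightarrow> Re (\<Sum>i<n. \<Sum>l<n. complex_of_real (divided_diff f (t i) (t l)) * (mat_adjoint (1\<^sub>m n) * H * 1\<^sub>m n) $$ (i, l)
          * (mat_adjoint (1\<^sub>m n) *\<^sub>v v) $ l * cnj ((mat_adjoint (1\<^sub>m n) *\<^sub>v v) $ i))) (at_right 0)"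
    by (intro tendsto_Re tendsto_within_subset[OF lim(2)]) auto
  have lim_eq: "Re (\<Sum>i<n. \<Sum>l<n. complex_of_real (divided_diff f (t i) (t l)) * (mat_adjoint (1\<^sub>m n) * H * 1\<^sub>m n) $$ (i, l)
          * (mat_adjoint (1\<^sub>m n) *\<^sub>v v) $ l * cnj ((mat_adjoint (1\<^sub>m n) *\<^sub>v v) $ i))
       = (\<Sum>i<n. \<Sum>l<n. x i * x l * divided_diff f (t i) (t l))"
    unfolding mat_adjoint_one one_mult_mat_vec[OF v] left_mult_one_mat[OF Hc] right_mult_one_mat[OF Hc]
    by (simp add: H_def v_def mult_ac)
  have pos: "\<forall>\<^sub>F s in at_right 0. 0 \<le> Re (((mat_fun f (C + complex_of_real s \<cdot>\<^sub>m H) *\<^sub>v v) \<bullet>c v - (mat_fun f C *\<^sub>v v) \<bullet>c v) / complex_of_real s)"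
    using eventually_at_right_less[of 0] ev
  proof eventually_elim
    case (elim s)
    have Csh: "hermitian_mat n (C + complex_of_real s \<cdot>\<^sub>m H)"
      by (rule hermitian_add_smult[OF Ch Hh])
    have Cs: "C + complex_of_real s \<cdot>\<^sub>m H \<in> carrier_mat n n"
      using Cc Hc by simp
    have "C + complex_of_real s \<cdot>\<^sub>m H - C = 0\<^sub>m n n + complex_of_real s \<cdot>\<^sub>m H"
      using Cc Hc by (intro eq_matI) auto
    moreover have "pos_semidef n (0\<^sub>m n n + complex_of_real s \<cdot>\<^sub>m H)"
      unfolding pos_semidef_def
    proof (intro conjI ballI hermitian_add_smult Hh)
      show "hermitian_mat n (0\<^sub>m n n)"
        by (rule hermitianI) auto
      fix y :: "complex vec" assume y: "y \<in> carrier_vec n"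
      have "(0\<^sub>m n n *\<^sub>v y) \<bullet>c y = 0"
        using quadratic_form_index[OF zero_carrier_mat y] by simp
      then show "0 \<le> ((0\<^sub>m n n + complex_of_real s \<cdot>\<^sub>m H) *\<^sub>v y) \<bullet>c y"
        unfolding quadratic_form_add_smult[OF zero_carrier_mat Hc y] using Hpos[OF y] elim(1)
        by (simp add: less_eq_complex_def)
    qed
    ultimately have "pos_semidef n (mat_fun f (C + complex_of_real s \<cdot>\<^sub>m H) - mat_fun f C)"
      using f Csh Ch elim(2) specC by (auto simp: matrix_monotone_def)
    then have "0 \<le> ((mat_fun f (C + complex_of_real s \<cdot>\<^sub>m H) - mat_fun f C) *\<^sub>v v) \<bullet>c v"
      using v by (simp add: pos_semidef_def)
    also have "\<dots> = (mat_fun f (C + complex_of_real s \<cdot>\<^sub>m H) *\<^sub>v v) \<bullet>c v - (mat_fun f C *\<^sub>v v) \<bullet>c v"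
      using mat_fun_hermitian[OF Csh, of f] mat_fun_hermitian[OF Ch, of f]
      by (intro quadratic_form_diff[OF _ _ v]) (simp_all add: hermitian_mat_def)
    finally show ?case
      using elim(1) by (simp add: less_eq_complex_def Re_divide_of_real)
  qed
  have "0 \<le> (\<Sum>i<n. \<Sum>l<n. x i * x l * divided_diff f (t i) (t l))"
    using tendsto_lowerbound[OF lim2 pos] unfolding lim_eq by simp
  then show "0 \<le> (\<Sum>s\<in>T. \<Sum>r\<in>T. X s * X r * divided_diff f s r)"
    unfolding tx .
qed


section \<open>Loewner's theorem for a fixed matrix size\<close>

text \<open>Schur product theorem: the spectral decomposition writes \<open>H\<close> as a
  nonnegative combination of rank one matrices, and each of these merely changes the weights in the
  form of \<open>K\<close>.\<close>

lemma schur_product_nonneg: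
  assumes H: "hermitian_mat n H" and Hpos: "\<And>y. y \<in> carrier_vec n \<Longrightarrow> 0 \<le> Re ((H *\<^sub>v y) \<bullet>c y)"
    and K: "psd_on n S K" and sym: "\<And>s t. K s t = K t s" and c: "\<And>i. i < n \<Longrightarrow> c i \<in> S"
  shows "0 \<le> Re (\<Sum>i<n. \<Sum>l<n. complex_of_real (K (c i) (c l)) * H $$ (i, l) * z l * cnj (z i))"
proof -
  obtain P p where P: "unitary_mat n P" and HP: "H = P * mat_diag n (\<lambda>i. complex_of_real (p i)) * mat_adjoint P"
    using hermitian_diagonalizable[OF H] by blast
  have Pc: "P \<in> carrier_mat n n"
    using P by (simp add: unitary_mat_def)
  have p: "0 \<le> p m" if "m < n" for m
    using Hpos that unfolding HP by (rule pos_semidef_eigenvalues[OF P])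
  define w where "w m i = P $$ (i, m) * cnj (z i)" for m i
  have "(\<Sum>i<n. \<Sum>l<n. complex_of_real (K (c i) (c l)) * H $$ (i, l) * z l * cnj (z i))
    = (\<Sum>i<n. \<Sum>l<n. \<Sum>m<n. complex_of_real (p m) * (complex_of_real (K (c i) (c l)) * (w m i * cnj (w m l))))"
    unfolding HP by (intro sum.cong refl)
      (simp add: conj_diag_index[OF Pc] sum_distrib_left sum_distrib_right w_def mult_ac del: index_mult_mat(1))
  also have "\<dots> = (\<Sum>i<n. \<Sum>m<n. \<Sum>l<n. complex_of_real (p m) * (complex_of_real (K (c i) (c l)) * (w m i * cnj (w m l))))"
    by (intro sum.cong refl sum.swap)
  also have "\<dots> = (\<Sum>m<n. \<Sum>i<n. \<Sum>l<n. complex_of_real (p m) * (complex_of_real (K (c i) (c l)) * (w m i * cnj (w m l))))"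
    by (rule sum.swap)
  also have "\<dots> = (\<Sum>m<n. complex_of_real (p m) * (\<Sum>i<n. \<Sum>l<n. complex_of_real (K (c i) (c l)) * (w m i * cnj (w m l))))"
    by (simp add: sum_distrib_left)
  also have "\<dots> = (\<Sum>m<n. complex_of_real (p m * ((\<Sum>i<n. \<Sum>l<n. Re (w m i) * Re (w m l) * K (c i) (c l))
      + (\<Sum>i<n. \<Sum>l<n. Im (w m i) * Im (w m l) * K (c i) (c l)))))"
  proof (intro sum.cong refl)
    fix m
    show "complex_of_real (p m) * (\<Sum>i<n. \<Sum>l<n. complex_of_real (K (c i) (c l)) * (w m i * cnj (w m l)))
      = complex_of_real (p m * ((\<Sum>i<n. \<Sum>l<n. Re (w m i) * Re (w m l) * K (c i) (c l))
      + (\<Sum>i<n. \<Sum>l<n. Im (w m i) * Im (w m l) * K (c i) (c l))))"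
      using complex_quadratic_form[where K = "\<lambda>i l. K (c i) (c l)" and w = "w m" and n = n] sym
      by (simp only: of_real_mult)
  qed
  finally have "Re (\<Sum>i<n. \<Sum>l<n. complex_of_real (K (c i) (c l)) * H $$ (i, l) * z l * cnj (z i))
    = (\<Sum>m<n. p m * ((\<Sum>i<n. \<Sum>l<n. Re (w m i) * Re (w m l) * K (c i) (c l))
      + (\<Sum>i<n. \<Sum>l<n. Im (w m i) * Im (w m l) * K (c i) (c l))))"
    by (simp only: Re_sum Re_complex_of_real)
  also have "0 \<le> \<dots>"
  proof (rule sum_nonneg)
    fix m assume "m \<in> {..<n}"
    then have "0 \<le> p m"
      using p by simp
    then show "0 \<le> p m * ((\<Sum>i<n. \<Sum>l<n. Re (w m i) * Re (w m l) * K (c i) (c l))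
      + (\<Sum>i<n. \<Sum>l<n. Im (w m i) * Im (w m l) * K (c i) (c l)))"
      using psd_on_index[where t = c, OF K c] by (intro mult_nonneg_nonneg add_nonneg_nonneg) blast+
  qed
  finally show ?thesis .
qed

lemma quadratic_form_pos:
  assumes U: "unitary_mat n U" and d: "\<And>i. i < n \<Longrightarrow> 0 < d i" and x: "x \<in> carrier_vec n" "x \<noteq> 0\<^sub>v n"
  shows "0 < Re (((U * mat_diag n (\<lambda>i. complex_of_real (d i)) * mat_adjoint U) *\<^sub>v x) \<bullet>c x)"
proof -
  have c: "U \<in> carrier_mat n n" "mat_adjoint U \<in> carrier_mat n n" and u: "U * mat_adjoint U = 1\<^sub>m n"
    using U by (auto simp: unitary_mat_def)
  define y where "y = mat_adjoint U *\<^sub>v x"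
  have y: "y \<in> carrier_vec n"
    unfolding y_def by (rule mult_mat_vec_carrier[OF c(2) x(1)])
  have "U *\<^sub>v y = x"
    using assoc_mult_mat_vec[OF c(1,2) x(1)] x by (simp add: y_def u)
  then have "y \<noteq> 0\<^sub>v n"
    using x(2) c(1) by auto
  then obtain j where j: "j < n" "y $ j \<noteq> 0"
    using y by (metis carrier_vecD eq_vecI index_zero_vec)
  have "0 < (\<Sum>j<n. d j * (cmod (y $ j))\<^sup>2)"
    using j d by (intro sum_pos2[of _ j]) (auto simp: less_imp_le)
  then show ?thesis
    unfolding quadratic_form_conj_diag[OF c(1) x(1)] y_def by simp
qed

text \<open>Along the segment from \<open>B\<close> to \<open>A\<close> the form of f at a fixed
  vector has as derivative a Schur product form of two positive matrices, so it is
  nondecreasing.\<close>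

lemma psd_on_imp_matrix_monotone:
  assumes diff: "\<And>x. 0 < x \<Longrightarrow> f differentiable (at x)"
    and K: "psd_on n {0<..} (divided_diff f)"
  shows "matrix_monotone n f {0<..}"
  unfolding matrix_monotone_def
proof (intro conjI allI impI; (elim conjE)?)
  show "continuous_on {0<..} f"
    using diff by (intro continuous_at_imp_continuous_on ballI differentiable_imp_continuous_within) auto
next
  fix A B
  assume A: "hermitian_mat n A" and B: "hermitian_mat n B"
    and specB: "spectrum B \<subseteq> complex_of_real ` {0<..}" and AB: "pos_semidef n (A - B)"
  have Ac: "A \<in> carrier_mat n n" and Bc: "B \<in> carrier_mat n n"
    using A B by (auto simp: hermitian_mat_def)
  define H where "H = A - B"
  have H: "hermitian_mat n H" and Hpos: "\<And>y. y \<in> carrier_vec n \<Longrightarrow> 0 \<le> (H *\<^sub>v y) \<bullet>c y"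
    using AB by (auto simp: H_def pos_semidef_def)
  have Hc: "H \<in> carrier_mat n n"
    using H by (simp add: hermitian_mat_def)
  have HRe: "0 \<le> Re ((H *\<^sub>v y) \<bullet>c y)" if "y \<in> carrier_vec n" for y
    using Hpos[OF that] by (simp add: less_eq_complex_def)
  obtain U d where U: "unitary_mat n U" and BU: "B = U * mat_diag n (\<lambda>i. complex_of_real (d i)) * mat_adjoint U"
    using hermitian_diagonalizable[OF B] by blast
  have d: "0 < d i" if "i < n" for i
    using specB that unfolding BU spectrum_conj_diag[OF U] by auto
  define P where "P s = B + complex_of_real s \<cdot>\<^sub>m H" for s
  have Ph: "hermitian_mat n (P s)" for s
    unfolding P_def by (rule hermitian_add_smult[OF B H])
  have P01: "P 0 = B" "P 1 = A"
    using Ac Bc by (auto simp: P_def H_def intro!: eq_matI)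
  have Padd: "P (s + h) = P s + complex_of_real h \<cdot>\<^sub>m H" for s h
    using Bc Hc by (intro eq_matI) (auto simp: P_def distrib_right)
  have mono: "Re ((mat_fun f (P 0) *\<^sub>v x) \<bullet>c x) \<le> Re ((mat_fun f (P 1) *\<^sub>v x) \<bullet>c x)" if x: "x \<in> carrier_vec n" for x
  proof (rule DERIV_nonneg_imp_nondecreasing[of 0 1 "\<lambda>s. Re ((mat_fun f (P s) *\<^sub>v x) \<bullet>c x)"])
    fix s :: real assume s: "0 \<le> s" "s \<le> 1"
    obtain V c where V: "unitary_mat n V" and PV: "P s = V * mat_diag n (\<lambda>i. complex_of_real (c i)) * mat_adjoint V"
      using hermitian_diagonalizable[OF Ph] by blast
    have Vc: "V \<in> carrier_mat n n" "mat_adjoint V \<in> carrier_mat n n"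
      using V by (auto simp: unitary_mat_def)
    \<comment> \<open>At an eigenvector the form of \<open>P s\<close> is that of \<open>B\<close>,
      which is positive, plus a nonnegative multiple of that of \<open>H\<close>; so the segment
      stays in the domain of \<open>f\<close>.\<close>
    have c: "0 < c i" if i: "i < n" for i
    proof -
      define v where "v = V *\<^sub>v unit_vec n i"
      have v: "v \<in> carrier_vec n"
        unfolding v_def by (rule mult_mat_vec_carrier[OF Vc(1)]) simp
      have Vv: "mat_adjoint V *\<^sub>v v = unit_vec n i"
        unfolding v_def by (rule unitary_adjoint_mult_vec[OF V]) simp
      have "v \<noteq> 0\<^sub>v n"
      proof
        assume "v = 0\<^sub>v n"
        moreover have "mat_adjoint V *\<^sub>v 0\<^sub>v n = 0\<^sub>v n"
          using Vc(1) mult_vec_index[OF Vc(2) zero_carrier_vec]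
          by (intro eq_vecI) (auto simp del: index_mult_mat_vec)
        ultimately have "unit_vec n i = (0\<^sub>v n :: complex vec)"
          using Vv by simp
        then show False
          using i by (metis index_unit_vec(1) index_zero_vec(1) zero_neq_one)
      qed
      have "Re ((P s *\<^sub>v v) \<bullet>c v) = Re ((B *\<^sub>v v) \<bullet>c v) + s * Re ((H *\<^sub>v v) \<bullet>c v)"
        unfolding P_def quadratic_form_add_smult[OF Bc Hc v] by simp
      moreover have "0 < Re ((B *\<^sub>v v) \<bullet>c v)"
        unfolding BU by (rule quadratic_form_pos[OF U d v \<open>v \<noteq> 0\<^sub>v n\<close>])
      moreover have "0 \<le> s * Re ((H *\<^sub>v v) \<bullet>c v)"
        using s HRe[OF v] by simp
      moreover have "(P s *\<^sub>v v) \<bullet>c v = complex_of_real (\<Sum>j<n. if j = i then c i else 0)"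
        unfolding PV quadratic_form_conj_diag[OF Vc(1) v] Vv
        using i by (intro arg_cong[of _ _ complex_of_real] sum.cong refl) simp
      ultimately show ?thesis
        using i by simp
    qed
    define L where "L = (\<Sum>i<n. \<Sum>l<n. complex_of_real (divided_diff f (c i) (c l)) * (mat_adjoint V * H * V) $$ (i, l)
          * (mat_adjoint V *\<^sub>v x) $ l * cnj ((mat_adjoint V *\<^sub>v x) $ i))"
    have "((\<lambda>h. ((mat_fun f (P (s + h)) *\<^sub>v x) \<bullet>c x - (mat_fun f (P s) *\<^sub>v x) \<bullet>c x) / complex_of_real h) \<longlongrightarrow> L) (at 0)"
      unfolding L_def Padd by (rule mat_fun_perturbation(2)[OF diff V PV c H x])
    from tendsto_Re[OF this]
    have "((\<lambda>s. Re ((mat_fun f (P s) *\<^sub>v x) \<bullet>c x)) has_real_derivative Re L) (at s)"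
      by (simp add: DERIV_def Re_divide_of_real)
    moreover have "0 \<le> Re L"
      unfolding L_def
    proof (rule schur_product_nonneg[OF hermitian_conj[OF H Vc(1)] _ K divided_diff_commute])
      fix y :: "complex vec" assume y: "y \<in> carrier_vec n"
      have Vy: "V *\<^sub>v y \<in> carrier_vec n"
        by (rule mult_mat_vec_carrier[OF Vc(1) y])
      show "0 \<le> Re ((mat_adjoint V * H * V *\<^sub>v y) \<bullet>c y)"
        using HRe[OF Vy] unfolding quadratic_form_unitary[OF V Hc Vy] unitary_adjoint_mult_vec[OF V y] .
    qed (use c in auto)
    ultimately show "\<exists>y. ((\<lambda>s. Re ((mat_fun f (P s) *\<^sub>v x) \<bullet>c x)) has_real_derivative y) (at s) \<and> 0 \<le> y"
      by blast
  qed simp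
  have fA: "hermitian_mat n (mat_fun f A)" and fB: "hermitian_mat n (mat_fun f B)"
    using mat_fun_hermitian A B by auto
  have fc: "mat_fun f A \<in> carrier_mat n n" "mat_fun f B \<in> carrier_mat n n"
    using fA fB by (auto simp: hermitian_mat_def)
  have dh: "hermitian_mat n (mat_fun f A - mat_fun f B)"
  proof (rule hermitianI)
    fix i j assume ij: "i < n" "j < n"
    show "(mat_fun f A - mat_fun f B) $$ (i, j) = cnj ((mat_fun f A - mat_fun f B) $$ (j, i))"
      using ij fc hermitian_index[OF fA ij] hermitian_index[OF fB ij] by simp
  qed (use fc in auto)
  have real: "Im ((E *\<^sub>v x) \<bullet>c x) = 0" if E: "hermitian_mat n E" and x: "x \<in> carrier_vec n" for E x
  proof -
    obtain Q q where Q: "unitary_mat n Q" and EQ: "E = Q * mat_diag n (\<lambda>i. complex_of_real (q i)) * mat_adjoint Q"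
      using hermitian_diagonalizable[OF E] by blast
    have Qc: "Q \<in> carrier_mat n n"
      using Q by (simp add: unitary_mat_def)
    show ?thesis
      unfolding EQ quadratic_form_conj_diag[OF Qc x] by simp
  qed
  show "pos_semidef n (mat_fun f A - mat_fun f B)"
    unfolding pos_semidef_def
  proof (intro conjI ballI dh)
    fix x :: "complex vec" assume x: "x \<in> carrier_vec n"
    show "0 \<le> ((mat_fun f A - mat_fun f B) *\<^sub>v x) \<bullet>c x"
      using mono[OF x] real[OF fA x] real[OF fB x] unfolding P01 quadratic_form_diff[OF fc x]
      by (simp add: less_eq_complex_def)
  qed
qed

lemma matrix_monotone_iff_psd_on:
  assumes "\<And>x. 0 < x \<Longrightarrow> f differentiable (at x)"
  shows "matrix_monotone n f {0<..} \<longleftrightarrow> psd_on n {0<..} (divided_diff f)"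
  using psd_on_imp_matrix_monotone matrix_monotone_imp_psd_on assms by blast

lemma cond_pos_def_kernel_mat_iff:
  assumes sym: "\<And>s t. K s t = K t s"
  shows "(\<forall>t. (\<forall>i<n. t i > 0) \<longrightarrow> cond_pos_def n (Matrix.mat n n (\<lambda>(i, j). complex_of_real (K (t i) (t j)))))
    \<longleftrightarrow> cpd_on n {0<..} K"
proof
  assume "cpd_on n {0<..} K"
  then show "\<forall>t. (\<forall>i<n. t i > 0) \<longrightarrow> cond_pos_def n (Matrix.mat n n (\<lambda>(i, j). complex_of_real (K (t i) (t j))))"
    by (intro allI impI cond_pos_def_kernel_mat[where S = "{0<..}"] sym) auto
qed (rule cpd_on_kernel_mat, auto intro: sym)

lemma cond_pos_def_loewner_iff:
  "(\<forall>t. (\<forall>i<n. t i > 0) \<longrightarrow> cond_pos_def n (loewner_mat n g t)) \<longleftrightarrow> cpd_on n {0<..} (divided_diff g)"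
  unfolding loewner_mat_def by (rule cond_pos_def_kernel_mat_iff[OF divided_diff_commute])

lemma cond_neg_def_loewner_iff:
  "(\<forall>t. (\<forall>i<n. t i > 0) \<longrightarrow> cond_neg_def n (loewner_mat n g t))
    \<longleftrightarrow> cpd_on n {0<..} (\<lambda>s t. - divided_diff g s t)"
proof -
  have eq: "- loewner_mat n g t = Matrix.mat n n (\<lambda>(i, j). complex_of_real (- divided_diff g (t i) (t j)))" for t
    by (rule eq_matI) (auto simp: loewner_mat_def)
  have "- divided_diff g s t = - divided_diff g t s" for s t
    by (simp only: divided_diff_commute[of g s t])
  then show ?thesis
    unfolding cond_neg_def_def eq by (rule cond_pos_def_kernel_mat_iff)
qed

section \<open>Boundary conditions and the main theorem\<close>

lemma exists_small_le_of_Liminf: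
  fixes g :: "real \<Rightarrow> real"
  assumes "Liminf (at_right 0) (\<lambda>t. ereal (g t)) \<le> 0" "0 < e" "0 < d"
  shows "\<exists>t. 0 < t \<and> t < d \<and> g t \<le> e"
proof (rule ccontr)
  assume none: "\<not> ?thesis"
  have "\<forall>\<^sub>F t in at_right 0. ereal e \<le> ereal (g t)"
    using eventually_at_right_real[OF assms(3)] by eventually_elim (use none in force)
  then have "ereal e \<le> Liminf (at_right 0) (\<lambda>t. ereal (g t))"
    by (rule Liminf_bounded)
  then have "ereal e \<le> 0"
    using assms(1) by (rule order_trans)
  with assms(2) show False
    by simp
qed

lemma exists_small_ge_of_Limsup:
  fixes g :: "real \<Rightarrow> real"
  assumes "0 \<le> Limsup (at_right 0) (\<lambda>t. ereal (g t))" "0 < e" "0 < d"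
  shows "\<exists>t. 0 < t \<and> t < d \<and> - e \<le> g t"
proof (rule ccontr)
  assume none: "\<not> ?thesis"
  have "\<forall>\<^sub>F t in at_right 0. ereal (g t) \<le> ereal (- e)"
    using eventually_at_right_real[OF assms(3)] by eventually_elim (use none in force)
  then have "Limsup (at_right 0) (\<lambda>t. ereal (g t)) \<le> ereal (- e)"
    by (rule Limsup_bounded)
  with assms(1) have "0 \<le> ereal (- e)"
    by (rule order_trans)
  with assms(2) show False
    by simp
qed

text \<open>A real \<open>c\<close> below the upper limit is exceeded at arbitrarily large
  \<open>t\<close>, and \<open>- (e * t)\<close> is below \<open>c\<close> once \<open>t\<close>
  passes \<open>- c / e\<close>.\<close>

lemma exists_large_ge_of_Limsup:
  fixes f :: "real \<Rightarrow> real"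
  assumes "- \<infinity> < Limsup at_top (\<lambda>t. ereal (f t))" "0 < e"
  shows "\<exists>t>N. - (e * t) \<le> f t"
proof (rule ccontr)
  assume none: "\<not> ?thesis"
  obtain c :: real where c: "ereal c < Limsup at_top (\<lambda>t. ereal (f t))"
    using assms(1) ereal_dense2 by blast
  have "\<forall>\<^sub>F t in at_top. ereal (f t) \<le> ereal c"
    using eventually_gt_at_top[of "max N (- c / e)"]
  proof eventually_elim
    case (elim t)
    then have "- c / e < t"
      by (simp only: max_less_iff_conj)
    then have "- c < t * e"
      by (simp only: pos_divide_less_eq[OF assms(2)])
    then show ?case
      using none elim by (force simp: mult.commute)
  qed
  then have "Limsup at_top (\<lambda>t. ereal (f t)) \<le> ereal c"
    by (rule Limsup_bounded)
  with c show False
    by simp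
qed

text \<open>A linear bound \<open>c * t\<close> is below \<open>e * t^2\<close> once
  \<open>t\<close> passes \<open>c / e\<close>; \<open>taylor_quot_nonpos\<close> uses the condition
  in this form.\<close>

lemma exists_large_le_of_Limsup:
  fixes f :: "real \<Rightarrow> real"
  assumes "Limsup at_top (\<lambda>t. ereal (f t / t)) < \<infinity>" "0 < e"
  shows "\<exists>t>N. f t \<le> e * t\<^sup>2"
proof -
  obtain c :: real where "Limsup at_top (\<lambda>t. ereal (f t / t)) < ereal c"
    using assms(1) ereal_dense2 by blast
  then have "\<forall>\<^sub>F t in at_top. ereal (f t / t) < ereal c"
    by (rule Limsup_lessD)
  then have "\<forall>\<^sub>F t in at_top. N < t \<and> f t \<le> e * t\<^sup>2"
    using eventually_gt_at_top[of "max (max N 0) (c / e)"]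
  proof eventually_elim
    case (elim t)
    have "f t \<le> c * t"
      using elim by (simp add: divide_less_eq)
    moreover have "c * t \<le> (e * t) * t"
      using elim assms(2) by (intro mult_right_mono) (auto simp: divide_less_eq mult.commute)
    ultimately have "f t \<le> e * t\<^sup>2"
      by (simp only: power2_eq_square mult.assoc order_trans)
    then show ?case
      using elim by simp
  qed
  then show ?thesis
    using eventually_happens'[OF trivial_limit_at_top_linorder] by blast
qed

lemma Liminf_mult_id_nonpos:
  assumes "\<And>t. 0 < t \<Longrightarrow> t \<le> 1 \<Longrightarrow> f t \<le> c"
  shows "Liminf (at_right 0) (\<lambda>t. ereal (t * f t)) \<le> 0"
proof -
  have "Liminf (at_right 0) (\<lambda>t. ereal (t * f t)) \<le> Limsup (at_right 0) (\<lambda>t. ereal (t * f t))"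
    by (rule Liminf_le_Limsup) simp
  also have "\<dots> \<le> Limsup (at_right 0) (\<lambda>t. ereal (t * c))"
  proof (rule Limsup_mono)
    show "\<forall>\<^sub>F t in at_right 0. ereal (t * f t) \<le> ereal (t * c)"
      using eventually_at_right_real[of 0 1] by (rule eventually_mono) (auto intro!: mult_left_mono assms)
  qed
  also have "Limsup (at_right 0) (\<lambda>t. ereal (t * c)) = 0"
  proof (rule lim_imp_Limsup)
    have "((\<lambda>t. t * c) \<longlongrightarrow> 0 * c) (at_right 0)"
      by (intro tendsto_intros)
    then show "((\<lambda>t. ereal (t * c)) \<longlongrightarrow> 0) (at_right 0)"
      using tendsto_ereal by (fastforce simp: zero_ereal_def)
  qed simp
  finally show ?thesis .
qed

text \<open>The bound gives t^2 f(t) \<ge> - c t, which tends to 0. The range up to 1/2 leaves room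
  for a Taylor quotient based at 1.\<close>

lemma Limsup_mult_square_nonneg:
  assumes "\<And>t. 0 < t \<Longrightarrow> t \<le> 1 / 2 \<Longrightarrow> - c \<le> t * f t"
  shows "0 \<le> Limsup (at_right 0) (\<lambda>t. ereal (t\<^sup>2 * f t))"
proof -
  have "Limsup (at_right 0) (\<lambda>t. ereal (t * - c)) = 0"
  proof (rule lim_imp_Limsup)
    have "((\<lambda>t. t * - c) \<longlongrightarrow> 0 * - c) (at_right 0)"
      by (intro tendsto_intros)
    then show "((\<lambda>t. ereal (t * - c)) \<longlongrightarrow> 0) (at_right 0)"
      using tendsto_ereal by (fastforce simp: zero_ereal_def)
  qed simp
  moreover have "Limsup (at_right 0) (\<lambda>t. ereal (t * - c)) \<le> Limsup (at_right 0) (\<lambda>t. ereal (t\<^sup>2 * f t))"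
  proof (rule Limsup_mono)
    have "\<forall>\<^sub>F t in at_right 0. t \<in> {0<..<1 / 2 :: real}"
      by (intro eventually_at_right_real) auto
    then show "\<forall>\<^sub>F t in at_right 0. ereal (t * - c) \<le> ereal (t\<^sup>2 * f t)"
    proof eventually_elim
      case (elim t)
      then have "t * - c \<le> t * (t * f t)"
        by (intro mult_left_mono assms) auto
      then show ?case
        by (simp add: power2_eq_square mult.assoc)
    qed
  qed
  ultimately show ?thesis
    by simp
qed

lemma Limsup_at_top_mono_gt:
  fixes f :: "real \<Rightarrow> real"
  assumes "\<And>t. 1 \<le> t \<Longrightarrow> f 1 \<le> f t"
  shows "- \<infinity> < Limsup at_top (\<lambda>t. ereal (f t))"
proof -
  have "\<forall>\<^sub>F t in at_top. ereal (f 1) \<le> ereal (f t)"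
    using eventually_ge_at_top[of 1] by eventually_elim (simp add: assms)
  then have "ereal (f 1) \<le> Liminf at_top (\<lambda>t. ereal (f t))"
    by (rule Liminf_bounded)
  also have "\<dots> \<le> Limsup at_top (\<lambda>t. ereal (f t))"
    by (rule Liminf_le_Limsup) simp
  finally show ?thesis
    by (rule less_le_trans[rotated]) simp
qed

theorem theorem2p6:
  fixes f :: "real \<Rightarrow> real" and n :: nat
  assumes "f C1_differentiable_on {0<..}"
    and "n \<ge> 1"
  shows "(n \<ge> 2 \<longrightarrow> matrix_monotone n f {0<..} \<longrightarrow> cond_b n f) \<and>
         (cond_b (4 * n + 1) f \<longrightarrow> matrix_monotone n f {0<..}) \<and>
         (matrix_monotone (2 * n + 2) f {0<..} \<longrightarrow> cond_c n f) \<and>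
         (cond_c (2 * n + 1) f \<longrightarrow> matrix_monotone n f {0<..}) \<and>
         (n \<ge> 2 \<longrightarrow> matrix_monotone n f {0<..} \<longrightarrow> cond_d n f) \<and>
         (cond_c (2 * n + 1) f \<longrightarrow> cond_d n f) \<and>
         (cond_d (2 * n + 1) f \<longrightarrow> cond_c n f)"
proof -
  have diff: "f differentiable (at x)" if "0 < x" for x
    using assms(1) that by (auto simp: C1_differentiable_on_def intro: differentiableI_vector)
  have n: "1 \<le> n"
    by (rule assms(2))
  have mono_iff: "matrix_monotone m f {0<..} \<longleftrightarrow> psd_on m {0<..} (divided_diff f)" for m
    by (rule matrix_monotone_iff_psd_on[OF diff])
  note iff = cond_pos_def_loewner_iff cond_neg_def_loewner_iff
  have diffk: "(\<lambda>t. - (t * f t)) differentiable (at x)" if "0 < x" for x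
    using diff[OF that] by (rule mult_id_differentiable)
  \<comment> \<open>The sign moves into the function so that the results on divided differences
    apply; at equal nodes this uses differentiability, hence the restriction to positive
    \<open>x\<close>.\<close>
  have neg_k: "(\<lambda>s t. - divided_diff (\<lambda>s. s * f s) s t) x y = divided_diff (\<lambda>t. - (t * f t)) x y" if "0 < x" for x y
  proof -
    have "(\<lambda>t. t * f t) differentiable (at x)"
      using DERIV_mult_id[OF diff[OF that]] by (auto simp: real_differentiable_def)
    then show ?thesis
      by (simp add: divided_diff_uminus)
  qed
  have neg: "cpd_on m {0<..} (\<lambda>s t. - divided_diff (\<lambda>s. s * f s) s t) \<Longrightarrow> cpd_on m {0<..} (divided_diff (\<lambda>t. - (t * f t)))" for m
    by (erule cpd_on_transform[where m = "\<lambda>t. t" and \<alpha> = "\<lambda>_. 0"]) (auto simp: neg_k)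
  have ab: "cond_b n f" if "2 \<le> n" and K: "psd_on n {0<..} (divided_diff f)"
  proof -
    have K2: "psd_on 2 {0<..} (divided_diff f)"
      using K by (rule psd_on_mono) (use that in auto)
    have "\<forall>\<^sub>F t in at_top. ereal (f t / t) \<le> ereal (\<bar>f 1\<bar> + deriv f 1)"
      using eventually_ge_at_top[of 1]
    proof eventually_elim
      case (elim t)
      then show ?case
        using psd_on_two_linear_bound[OF diff K2 elim] by (simp add: divide_le_eq abs_le_iff)
    qed
    then have "Limsup at_top (\<lambda>t. ereal (f t / t)) \<le> ereal (\<bar>f 1\<bar> + deriv f 1)"
      by (rule Limsup_bounded)
    then have "Limsup at_top (\<lambda>t. ereal (f t / t)) < \<infinity>"
      by (rule le_less_trans) simp
    moreover have "- \<infinity> < Limsup at_top (\<lambda>t. ereal (f t))"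
      using psd_on_one_mono[OF diff K n] by (intro Limsup_at_top_mono_gt) auto
    ultimately show ?thesis
      unfolding cond_b_def iff using psd_on_imp_cpd_on[OF K] by simp
  qed
  \<comment> \<open>One additional point is consumed: n + 1 \<le> 4 n + 1.\<close>
  have ba: "psd_on n {0<..} (divided_diff f)" if b: "cond_b (4 * n + 1) f"
  proof (rule cpd_on_imp_psd_on[OF diff _ n])
    show "cpd_on (Suc n) {0<..} (divided_diff f)"
      by (rule cpd_on_mono[of "4 * n + 1" "{0<..}"]) (use b in \<open>auto simp: cond_b_def iff\<close>)
    show "\<exists>t>N. f t \<le> e * t\<^sup>2" if "0 < e" for e N
      by (rule exists_large_le_of_Limsup[OF _ that]) (use b in \<open>simp add: cond_b_def\<close>)
    show "\<exists>t>N. - (e * t) \<le> f t" if "0 < e" for e N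
      by (rule exists_large_ge_of_Limsup[OF _ that]) (use b in \<open>simp add: cond_b_def\<close>)
  qed
  \<comment> \<open>Kept at n + 1 points because (d) ==> (c) reuses it with a kernel known to be
    positive on only 2 n points.\<close>
  have ac: "cond_c n f" if K: "psd_on (Suc n) {0<..} (divided_diff f)"
  proof -
    have "Liminf (at_right 0) (\<lambda>t. ereal (t * f t)) \<le> 0"
      using psd_on_one_mono[OF diff K] by (intro Liminf_mult_id_nonpos[of f "f 1"]) auto
    moreover have "- \<infinity> < Limsup at_top (\<lambda>t. ereal (f t))"
      using psd_on_one_mono[OF diff K] by (intro Limsup_at_top_mono_gt) auto
    ultimately show ?thesis
      unfolding cond_c_def iff using psd_on_imp_cpd_on_mult_id[OF diff K] by simp
  qed
  \<comment> \<open>Two additional points are consumed, and n + 2 \<le> 2 n + 1 by n \<ge>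
    1.\<close>
  have ca: "psd_on n {0<..} (divided_diff f)" if c: "cond_c (2 * n + 1) f"
  proof (rule cpd_on_mult_id_imp_psd_on[OF diff])
    show "cpd_on (Suc (Suc n)) {0<..} (divided_diff (\<lambda>t. - (t * f t)))"
      by (rule cpd_on_mono[OF neg, of "2 * n + 1"]) (use c n in \<open>auto simp: cond_c_def iff\<close>)
    show "\<exists>t. 0 < t \<and> t < d \<and> t * f t \<le> e" if "0 < e" "0 < d" for e d
      by (rule exists_small_le_of_Liminf[OF _ that]) (use c in \<open>simp add: cond_c_def\<close>)
    show "\<exists>t>N. - (e * t) \<le> f t" if "0 < e" for e N
      by (rule exists_large_ge_of_Limsup[OF _ that]) (use c in \<open>simp add: cond_c_def\<close>)
  qed
  have ad: "cond_d n f" if "2 \<le> n" and K: "psd_on n {0<..} (divided_diff f)"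
  proof -
    have K2: "psd_on 2 {0<..} (divided_diff f)"
      using K by (rule psd_on_mono) (use that in auto)
    \<comment> \<open>The constant of the linear bound for the inverted function; at infinity that
      bound says that t f(t) is bounded near 0.\<close>
    define c where "c = \<bar>f 1\<bar> + deriv (\<lambda>t. - f (1 / t)) 1"
    have "- c \<le> t * f t" if t: "0 < t" "t \<le> 1 / 2" for t
    proof -
      have "\<bar>- f (1 / (1 / t))\<bar> \<le> (\<bar>- f (1 / 1)\<bar> + deriv (\<lambda>t. - f (1 / t)) 1) * (1 / t)"
        using t by (intro psd_on_two_linear_bound[OF inversion_differentiable[OF diff] psd_on_inversion'[OF diff K2]]) auto
      then have "\<bar>f t\<bar> * t \<le> c"
        using t by (simp add: c_def field_simps)
      moreover have "- (t * f t) \<le> \<bar>f t\<bar> * t"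
        using t abs_ge_minus_self[of "t * f t"] by (simp add: abs_mult mult.commute)
      ultimately show ?thesis
        by linarith
    qed
    then have "0 \<le> Limsup (at_right 0) (\<lambda>t. ereal (t\<^sup>2 * f t))"
      by (rule Limsup_mult_square_nonneg)
    moreover have "Liminf (at_right 0) (\<lambda>t. ereal (t * f t)) \<le> 0"
      using psd_on_one_mono[OF diff K n] by (intro Liminf_mult_id_nonpos[of f "f 1"]) auto
    ultimately show ?thesis
      unfolding cond_d_def iff using psd_on_mult_square[OF diff K] by simp
  qed
  have cd: "cond_d n f" if c: "cond_c (2 * n + 1) f"
  proof -
    have "cpd_on 2 {0<..} (divided_diff (\<lambda>t. - (t * f t)))"
      by (rule cpd_on_mono[OF neg, of "2 * n + 1"]) (use c n in \<open>auto simp: cond_c_def iff\<close>)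
    note K2 = this
    define k where "k = (\<lambda>t. - (t * f t))"
    \<comment> \<open>Monotonicity of the Taylor quotient of \<open>k\<close> at 1 bounds it on (0,
      1/2] by its value at 1/2. So \<open>k\<close> is bounded above near 0, that is, t f(t) is
      bounded below.\<close>
    define m where "m = taylor_quot k 1 (1 / 2)"
    have "- (\<bar>k 1\<bar> + \<bar>deriv k 1\<bar> + \<bar>m\<bar>) \<le> t * f t" if t: "0 < t" "t \<le> 1 / 2" for t
    proof -
      have "taylor_quot k 1 t \<le> m"
        unfolding m_def k_def using t by (intro taylor_quot_mono[OF diffk K2]) auto
      then have "k t \<le> k 1 + deriv k 1 * (t - 1) + m * (t - 1)\<^sup>2"
        using t by (simp add: taylor_quot_def divide_le_eq split: if_splits)
      also have "deriv k 1 * (t - 1) \<le> \<bar>deriv k 1\<bar>"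
        using t abs_ge_self[of "deriv k 1 * (t - 1)"] mult_left_le[of "\<bar>t - 1\<bar>" "\<bar>deriv k 1\<bar>"]
        by (simp add: abs_mult)
      also have "m * (t - 1)\<^sup>2 \<le> \<bar>m\<bar>"
      proof -
        have "(t - 1)\<^sup>2 \<le> 1"
          using t by (simp add: abs_square_le_1)
        then show ?thesis
          using abs_ge_self[of "m * (t - 1)\<^sup>2"] mult_left_le[of "(t - 1)\<^sup>2" "\<bar>m\<bar>"] by (simp add: abs_mult)
      qed
      finally have "k t \<le> k 1 + \<bar>deriv k 1\<bar> + \<bar>m\<bar>"
        by simp
      then show ?thesis
        using abs_ge_self[of "k 1"] by (simp add: k_def)
    qed
    then have "0 \<le> Limsup (at_right 0) (\<lambda>t. ereal (t\<^sup>2 * f t))"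
      by (rule Limsup_mult_square_nonneg)
    then show ?thesis
      unfolding cond_d_def iff using c psd_on_mult_square[OF diff ca[OF c]] by (simp add: cond_c_def)
  qed
  have dc: "cond_c n f" if d: "cond_d (2 * n + 1) f"
  proof -
    \<comment> \<open>The detour through (a) loses one point, and 2 n \<ge> n + 1 leaves enough for
      \<open>ac\<close>.\<close>
    have "psd_on (2 * n) {0<..} (divided_diff f)"
    proof (rule cpd_on_mult_square_imp_psd_on[OF diff])
      show "cpd_on (Suc (2 * n)) {0<..} (divided_diff (\<lambda>t. t\<^sup>2 * f t))"
        using d by (simp add: cond_d_def iff)
      show "1 \<le> 2 * n"
        using n by simp
      show "\<exists>t. 0 < t \<and> t < r \<and> t * f t \<le> e" if "0 < e" "0 < r" for e r
        by (rule exists_small_le_of_Liminf[OF _ that]) (use d in \<open>simp add: cond_d_def\<close>)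
      show "\<exists>t. 0 < t \<and> t < r \<and> - e \<le> t\<^sup>2 * f t" if "0 < e" "0 < r" for e r
        by (rule exists_small_ge_of_Limsup[OF _ that]) (use d in \<open>simp add: cond_d_def\<close>)
    qed
    then have "psd_on (Suc n) {0<..} (divided_diff f)"
      by (rule psd_on_mono) (use n in auto)
    then show ?thesis
      by (rule ac)
  qed
  have ac': "cond_c n f" if "psd_on (2 * n + 2) {0<..} (divided_diff f)"
    by (rule ac[OF psd_on_mono[OF that]]) auto
  show ?thesis
    unfolding mono_iff using ab ba ac' ca ad cd dc by blast
qed

end
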